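(* Assume hypothesis (H) and that the positive equilibrium $K$ of $u'(t)=-u(t)+g(u(t-h))$ is globally attracting. Let $\psi$ be a solution of this equation on $\mathbb{R}$ with $\psi(-\infty)=0$, $\psi(+\infty)=K$, and let $\lambda$ be the positive root of $z=-1+pe^{-zh}$. Then for every $\delta\in(0,\lambda)$ there exist an interval $\mathcal{E}=(-\varepsilon_0,\varepsilon_0)$ and a continuous map $\varepsilon\mapsto\psi_\varepsilon$ from $\mathcal{E}$ into $C_{\lambda-\delta}(\mathbb{R})$ such that each $\psi_\varepsilon$ is a positive solution on $\mathbb{R}$ of $$\varepsilon^2x''(t)-x'(t)-x(t)+g(x(t-h))=0$$ with $\psi_\varepsilon(-\infty)=0$, $\psi_\varepsilon(+\infty)=K$, and moreover $\psi_0=\psi$ and $\int_{-\infty}^0\psi_\varepsilon(s)\psi'(s)\,ds=\tfrac12\psi(0)^2$. Furthermore, for every $\varepsilon\in\mathcal{E}\setminus\{0\}$ there is $t_0=t_0(\varepsilon)\in\mathbb{R}$ such that, as $t\to-\infty$, $$\psi_\varepsilon(t-t_0)=e^{\lambda_1(\varepsilon)t}+O(e^{2\lambda t}),\qquad \psi_\varepsilon'(t-t_0)=\lambda_1(\varepsilon)e^{\lambda_1(\varepsilon)t}+O(e^{2\lambda t}),$$ and $\psi_\varepsilon'>0$ on some semi-axis $(-\infty,z]$.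
   Context: Hypothesis (H): for $h>0$ and $g:\mathbb{R}_+\to\mathbb{R}_+$, the equation $u'(t)=-u(t)+g(u(t-h))$, $u\ge0$, has exactly two constant solutions $0$ and $K>0$; $K$ is exponentially asymptotically stable and $0$ is hyperbolic; $g\in C^1(\mathbb{R}_+,\mathbb{R}_+)$, $g$ is $C^2$ near $0$ and near $K$, and $p:=g'(0)>1$. Globally attracting: every solution with nonnegative, not identically zero initial function converges to $K$. $\lambda_1(\varepsilon)$ is the smallest positive real root of $\varepsilon^2z^2-z-1+pe^{-zh}=0$. For $\mu>0$, $C_\mu(\mathbb{R})$ is the space of continuous $x:\mathbb{R}\to\mathbb{R}$ such that $\|x\|^-_\mu=\sup_{s\le0}e^{-\mu s}|x(s)|<\infty$ and the limit $x(+\infty)$ exists and is finite, with norm $\|x\|_\mu=\max\{\sup_{s\ge0}|x(s)|,\|x\|^-_\mu\}$. *)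

theory Defs
  imports "HOL-Analysis.Analysis" "HOL-Library.Landau_Symbols"
begin

definition dde_sol :: "(real \<Rightarrow> real) \<Rightarrow> real \<Rightarrow> (real \<Rightarrow> real) \<Rightarrow> bool" where
  "dde_sol g h u \<longleftrightarrow> continuous_on {-h..} u \<and>
     (\<forall>t\<ge>0. (u has_real_derivative (- u t + g (u (t - h)))) (at t within {0..}))"

definition C1_nonneg :: "(real \<Rightarrow> real) \<Rightarrow> (real \<Rightarrow> real) \<Rightarrow> bool" where
  "C1_nonneg g g' \<longleftrightarrow> (\<forall>x\<ge>0. g x \<ge> 0) \<and> continuous_on {0..} g' \<and>
     (\<forall>x\<ge>0. (g has_real_derivative g' x) (at x within {0..}))"

definition C2_near :: "(real \<Rightarrow> real) \<Rightarrow> real \<Rightarrow> bool" where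
  "C2_near g' K \<longleftrightarrow> (\<exists>r>0. \<exists>g''. continuous_on ({0..<r} \<union> {K-r<..<K+r}) g'' \<and>
     (\<forall>x \<in> {0..<r} \<union> {K-r<..<K+r}. (g' has_real_derivative g'' x) (at x within {0..})))"

definition exp_stable :: "(real \<Rightarrow> real) \<Rightarrow> real \<Rightarrow> real \<Rightarrow> bool" where
  "exp_stable g h K \<longleftrightarrow> (\<exists>\<delta>>0. \<exists>C>0. \<exists>\<gamma>>0. \<forall>u r.
     dde_sol g h u \<and> r \<le> \<delta> \<and> (\<forall>s\<in>{-h..0}. u s \<ge> 0 \<and> \<bar>u s - K\<bar> \<le> r) \<longrightarrow>
     (\<forall>t\<ge>0. \<bar>u t - K\<bar> \<le> C * exp (- \<gamma> * t) * r))"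

text \<open>Hyperbolicity of the equilibrium 0: the characteristic equation
  z = -1 + g'(0) e^{-zh} has no roots on the imaginary axis.\<close>
definition hyperbolic0 :: "real \<Rightarrow> real \<Rightarrow> bool" where
  "hyperbolic0 p h \<longleftrightarrow> (\<forall>w::real.
     \<i> * of_real w + 1 - of_real p * exp (- \<i> * of_real w * of_real h) \<noteq> (0::complex))"

definition hypH :: "(real \<Rightarrow> real) \<Rightarrow> (real \<Rightarrow> real) \<Rightarrow> real \<Rightarrow> real \<Rightarrow> bool" where
  "hypH g g' h K \<longleftrightarrow> h > 0 \<and> K > 0 \<and> {x. x \<ge> 0 \<and> g x = x} = {0, K} \<and>
     exp_stable g h K \<and> hyperbolic0 (g' 0) h \<and> C1_nonneg g g' \<and> C2_near g' 0 \<and> C2_near g' K \<and>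
     g' 0 > 1"

definition globally_attracting :: "(real \<Rightarrow> real) \<Rightarrow> real \<Rightarrow> real \<Rightarrow> bool" where
  "globally_attracting g h K \<longleftrightarrow> (\<forall>u. dde_sol g h u \<and> (\<forall>s\<in>{-h..0}. u s \<ge> 0) \<and>
     (\<exists>s\<in>{-h..0}. u s \<noteq> 0) \<longrightarrow> (u \<longlongrightarrow> K) at_top)"

definition lambda1 :: "real \<Rightarrow> real \<Rightarrow> real \<Rightarrow> real" where
  "lambda1 p h \<epsilon> = (LEAST z. z > 0 \<and> \<epsilon>^2 * z^2 - z - 1 + p * exp (- z * h) = 0)"

definition Cmu :: "real \<Rightarrow> (real \<Rightarrow> real) set" where
  "Cmu \<mu> = {x. continuous_on UNIV x \<and> (\<exists>B. \<forall>s\<le>0. exp (- \<mu> * s) * \<bar>x s\<bar> \<le> B) \<and>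
     (\<exists>L. (x \<longlongrightarrow> L) at_top)}"

definition norm_mu :: "real \<Rightarrow> (real \<Rightarrow> real) \<Rightarrow> real" where
  "norm_mu \<mu> x = max (SUP s\<in>{0..}. \<bar>x s\<bar>) (SUP s\<in>{..0}. exp (- \<mu> * s) * \<bar>x s\<bar>)"

end

theory Submission
  imports Defs
begin

text \<open>Factoring \<open>\<epsilon>\<^sup>2 z\<^sup>2 - z - 1\<close> turns the second order equation into
  \<open>(1 + \<theta>) x' = - x + avg \<theta> (g (x(\<cdot> - h)))\<close>, where \<open>\<theta> + \<theta>\<^sup>2 = \<epsilon>\<^sup>2\<close> and \<open>avg \<theta>\<close> averages forward in time
  against an exponential density of mean \<open>\<theta>\<close>: a regular perturbation of the delay equation on Lipschitz
  functions. Rescaling time by \<open>\<lambda>\<^sub>1(\<epsilon>) / \<lambda>\<close> makes \<open>\<lambda>\<close> a characteristic root at 0 for every \<open>\<epsilon>\<close>, so all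
  solutions can be sought as \<open>\<psi> + w\<close> with \<open>w = O(e\<^bsup>2\<lambda>t\<^esup>)\<close> at \<open>-\<infinity>\<close> and \<open>w \<rightarrow> 0\<close> at \<open>+\<infinity>\<close>. On this
  space the linearization along \<open>\<psi>\<close> is invertible: at \<open>-\<infinity>\<close> because \<open>2\<lambda>\<close> exceeds the dominant root,
  at \<open>+\<infinity>\<close> because \<open>K\<close> is exponentially stable. A contraction gives a family depending on \<open>\<epsilon>\<close> in a
  Lipschitz way and already carrying the asymptotics; the phase condition is then met by a
  translation in time, since \<open>\<integral> \<psi>'\<^sup>2 > 0\<close>.\<close>

section \<open>Delay equations, exponential averages and weighted contractions\<close>

text \<open>The factorization is \<epsilon>^2 D^2 - D - 1 = -(1 - \<theta> D)(1 + (1 + \<theta>) D).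
  Inverting 1 - \<theta> D on bounded functions discards the fast growing mode exp(t / \<theta>),
  which is what makes the limit \<epsilon> = 0 regular; the price is that the average looks forward,
  so the equation is no initial value problem and has to be solved on the whole line at once. Two
  obstacles shape the estimates. The weight exp(2 lam t) works only if a change of parameters
  disturbs the equation at that order, whereas the decay rates of the unscaled fronts depend on
  \<epsilon>; the rescaling removes exactly this first order term. And g' is in general only
  continuous, so the difference of g along two candidates is Lipschitz in time only up to a small
  remainder, which the contraction must tolerate. The unknown is therefore the forcing f of the
  linearized equation that produces w: a bound on f bounds w and w' alike, and w' controls the
  averages. The loss of \<delta> in the target space comes from undoing the rescaling, which costs a
  factor |t| at minus infinity.\<close>

lemma antiderivative_exists:
  fixes u :: "real \<Rightarrow> real"
  assumes "continuous_on UNIV u"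
  shows "\<exists>U. \<forall>t. (U has_real_derivative u t) (at t)"
proof (intro exI allI)
  fix t :: real
  let ?a = "- \<bar>t\<bar> - 1" and ?b = "\<bar>t\<bar> + 1"
  have "((\<lambda>x. LBINT y=ereal 0..ereal x. u y) has_vector_derivative u t) (at t within {?a..?b})"
    by (rule interval_integral_FTC2)
      (auto intro: continuous_on_subset[OF assms] simp: abs_if)
  moreover have "at t within {?a..?b} = at t"
    by (rule at_within_interior) (auto simp: abs_if)
  ultimately show "((\<lambda>x. LBINT y=ereal 0..ereal x. u y) has_real_derivative u t) (at t)"
    by (simp add: has_real_derivative_iff_has_vector_derivative)
qed

section \<open>Comparison estimates for u' = -u + r, from minus infinity and forward in time\<close>

lemma upper_bound_from_minus_infinity:
  fixes u r :: "real \<Rightarrow> real"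
  assumes u: "\<And>t. t \<le> T \<Longrightarrow> (u has_real_derivative (- u t + r t)) (at t)"
    and r: "\<And>t. t \<le> T \<Longrightarrow> r t \<le> R1 * exp (a * t) + R2 * exp (b * t)"
    and ab: "a > -1" "b > -1"
    and B: "\<And>t. t \<le> T \<Longrightarrow> \<bar>u t\<bar> \<le> B"
    and t: "t \<le> T"
  shows "u t \<le> R1 / (1 + a) * exp (a * t) + R2 / (1 + b) * exp (b * t)"
proof -
  \<comment> \<open>\<open>q\<close> is \<open>exp s * u s\<close> minus the corresponding integral
    of the bound on \<open>r\<close>. It is nonincreasing, and boundedness of \<open>u\<close>
    together with \<open>a, b > -1\<close> makes it vanish at minus infinity, so \<open>q t\<close>
    is nonpositive. Two exponentials are allowed because the weight used later for the linear
    equation has two parts.\<close>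
  define q where "q s = exp s * u s - R1 / (1 + a) * exp ((1 + a) * s)
      - R2 / (1 + b) * exp ((1 + b) * s)" for s
  have dq: "(q has_real_derivative (exp s * (r s - R1 * exp (a * s) - R2 * exp (b * s)))) (at s)"
    if "s \<le> T" for s
  proof -
    obtain A1 A2 where A: "A1 = R1 / (1 + a)" "A2 = R2 / (1 + b)" by blast
    then have R: "R1 = A1 * (1 + a)" "R2 = A2 * (1 + b)" using ab by auto
    show ?thesis unfolding q_def A[symmetric] unfolding R
      by (auto intro!: derivative_eq_intros u[OF that] simp: algebra_simps exp_add)
  qed
  have mono: "q t \<le> q s" if "s \<le> t" for s
  proof (rule DERIV_nonpos_imp_nonincreasing[OF that])
    fix x assume "s \<le> x" "x \<le> t"
    then have "x \<le> T" using t by simp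
    from dq[OF this] r[OF this] show "\<exists>y. (q has_real_derivative y) (at x) \<and> y \<le> 0"
      by (intro exI conjI) (auto intro!: mult_nonneg_nonpos)
  qed
  have e: "((\<lambda>s. exp (c * s)) \<longlongrightarrow> 0) at_bot" if "c > 0" for c :: real
  proof -
    have "filterlim (\<lambda>s. c * s) at_bot at_bot"
      using that by (intro filterlim_tendsto_pos_mult_at_bot[OF tendsto_const]) (auto intro: filterlim_ident)
    then show ?thesis by (rule filterlim_compose[OF exp_at_bot])
  qed
  have "((\<lambda>s. exp s * u s) \<longlongrightarrow> 0) at_bot"
  proof (rule Lim_null_comparison)
    show "\<forall>\<^sub>F s in at_bot. norm (exp s * u s) \<le> B * exp s"
      using eventually_le_at_bot[of T] by eventually_elim (auto simp: abs_mult B mult.commute mult_left_mono)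
    show "((\<lambda>s. B * exp s) \<longlongrightarrow> 0) at_bot"
      using tendsto_mult_right_zero[OF exp_at_bot] by simp
  qed
  moreover have "((\<lambda>s. R1 / (1 + a) * exp ((1 + a) * s)) \<longlongrightarrow> 0) at_bot"
    using ab by (intro tendsto_mult_right_zero e) auto
  moreover have "((\<lambda>s. R2 / (1 + b) * exp ((1 + b) * s)) \<longlongrightarrow> 0) at_bot"
    using ab by (intro tendsto_mult_right_zero e) auto
  ultimately have "((\<lambda>s. exp s * u s - R1 / (1 + a) * exp ((1 + a) * s)
      - R2 / (1 + b) * exp ((1 + b) * s)) \<longlongrightarrow> 0 - 0 - 0) at_bot"
    by (intro tendsto_diff)
  then have "(q \<longlongrightarrow> 0) at_bot" unfolding q_def by simp
  then have "q t \<le> 0"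
    by (rule tendsto_lowerbound) (use mono in \<open>auto intro: eventually_mono[OF eventually_le_at_bot[of t]]\<close>)
  then have "exp t * u t \<le> exp t * (R1 / (1 + a) * exp (a * t) + R2 / (1 + b) * exp (b * t))"
    by (simp add: q_def algebra_simps exp_add)
  then show ?thesis by simp
qed

lemma bound_from_minus_infinity:
  fixes u r :: "real \<Rightarrow> real"
  assumes u: "\<And>t. t \<le> T \<Longrightarrow> (u has_real_derivative (- u t + r t)) (at t)"
    and r: "\<And>t. t \<le> T \<Longrightarrow> \<bar>r t\<bar> \<le> R1 * exp (a * t) + R2 * exp (b * t)"
    and ab: "a > -1" "b > -1"
    and B: "\<And>t. t \<le> T \<Longrightarrow> \<bar>u t\<bar> \<le> B"
    and t: "t \<le> T"
  shows "\<bar>u t\<bar> \<le> R1 / (1 + a) * exp (a * t) + R2 / (1 + b) * exp (b * t)"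
proof -
  have "u t \<le> R1 / (1 + a) * exp (a * t) + R2 / (1 + b) * exp (b * t)"
    by (rule upper_bound_from_minus_infinity[OF u _ ab B t]) (use r in \<open>auto simp: abs_le_iff\<close>)
  moreover have "- u t \<le> R1 / (1 + a) * exp (a * t) + R2 / (1 + b) * exp (b * t)"
  proof (rule upper_bound_from_minus_infinity[OF _ _ ab _ t, where r = "\<lambda>t. - r t" and B = B])
    show "((\<lambda>t. - u t) has_real_derivative - (- u t) + - r t) (at t)" if "t \<le> T" for t
      by (auto intro!: derivative_eq_intros u[OF that])
  qed (use r B in \<open>auto simp: abs_le_iff\<close>)
  ultimately show ?thesis by (simp add: abs_le_iff)
qed

text \<open>\<open>exp s * (d s - R)\<close> is nonincreasing. The derivative is one-sided at
  \<open>a\<close> because a solution started from an arbitrary history has only a right derivative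
  at the initial time.\<close>

lemma upper_bound_forward:
  fixes d r :: "real \<Rightarrow> real"
  assumes d: "\<And>t. a \<le> t \<Longrightarrow> t \<le> b \<Longrightarrow> (d has_real_derivative (- d t + r t)) (at t within {a..})"
    and r: "\<And>t. a \<le> t \<Longrightarrow> t \<le> b \<Longrightarrow> r t \<le> R"
    and N: "d a \<le> N" and "N \<ge> 0" "R \<ge> 0" and t: "a \<le> t" "t \<le> b"
  shows "d t \<le> N + R"
proof (cases "a = t")
  case False
  with t have at: "a < t" by simp
  define q where "q s = exp s * (d s - R)" for s
  have dq: "(q has_real_derivative (exp s * (r s - R))) (at s within {a..})" if "a \<le> s" "s \<le> b" for s
    unfolding q_def by (auto intro!: derivative_eq_intros d[OF that] simp: algebra_simps)
  have "q t \<le> q a"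
  proof (rule DERIV_nonpos_imp_decreasing_open[OF less_imp_le[OF at]])
    show "\<exists>y. (q has_real_derivative y) (at x) \<and> y \<le> 0" if "a < x" "x < t" for x
    proof -
      have "at x within {a..} = at x" using that by (intro at_within_interior) auto
      then show ?thesis using dq[of x] r[of x] that t
        by (intro exI[of _ "exp x * (r x - R)"]) (auto intro!: mult_nonneg_nonpos)
    qed
    show "continuous_on {a..t} q"
      unfolding continuous_on_eq_continuous_within
    proof
      fix x assume "x \<in> {a..t}"
      with dq[of x] t have "continuous (at x within {a..}) q" by (auto intro: DERIV_continuous)
      then show "continuous (at x within {a..t}) q" by (rule continuous_within_subset) auto
    qed
  qed
  also have "q a \<le> exp a * N" unfolding q_def using N \<open>R \<ge> 0\<close> by (intro mult_left_mono) auto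
  also have "\<dots> \<le> exp t * N" using t \<open>N \<ge> 0\<close> by (intro mult_right_mono) auto
  finally show ?thesis by (simp add: q_def)
qed (use N \<open>R \<ge> 0\<close> in simp)

lemma bound_forward:
  fixes d r :: "real \<Rightarrow> real"
  assumes d: "\<And>t. a \<le> t \<Longrightarrow> t \<le> b \<Longrightarrow> (d has_real_derivative (- d t + r t)) (at t within {a..})"
    and r: "\<And>t. a \<le> t \<Longrightarrow> t \<le> b \<Longrightarrow> \<bar>r t\<bar> \<le> R"
    and N: "\<bar>d a\<bar> \<le> N" and R: "R \<ge> 0" and t: "a \<le> t" "t \<le> b"
  shows "\<bar>d t\<bar> \<le> N + R"
proof -
  have N0: "N \<ge> 0" using N by simp
  have "d t \<le> N + R"
    by (rule upper_bound_forward[where d=d and r=r and a=a and b=b]) (use assms N0 in \<open>auto simp: abs_le_iff\<close>)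
  moreover have "- d t \<le> N + R"
  proof (rule upper_bound_forward[where d="\<lambda>t. - d t" and r="\<lambda>t. - r t" and a=a and b=b])
    show "((\<lambda>t. - d t) has_real_derivative - (- d t) + - r t) (at t within {a..})" if "a \<le> t" "t \<le> b" for t
      by (auto intro!: derivative_eq_intros d[OF that])
  qed (use assms N0 in \<open>auto simp: abs_le_iff\<close>)
  ultimately show ?thesis by (simp add: abs_le_iff)
qed

text \<open>Banach's fixed point theorem for the distance sup |w - v| / M on a set \<open>S\<close>
  of functions. Closedness is asked in the form in which it is used: limits attained at a weighted
  uniform rate \<open>E n\<close> stay in \<open>S\<close>.\<close>

lemma weighted_contraction_fixpoint:
  fixes M :: "real \<Rightarrow> real" and Phi :: "(real \<Rightarrow> real) \<Rightarrow> real \<Rightarrow> real"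
  assumes M: "\<And>t. M t > 0"
    and w0: "w0 \<in> S" and Phi: "\<And>w. w \<in> S \<Longrightarrow> Phi w \<in> S"
    and bd: "\<And>w v. w \<in> S \<Longrightarrow> v \<in> S \<Longrightarrow> \<exists>D. \<forall>t. \<bar>w t - v t\<bar> \<le> D * M t"
    and contr: "\<And>w v D. w \<in> S \<Longrightarrow> v \<in> S \<Longrightarrow> \<forall>t. \<bar>w t - v t\<bar> \<le> D * M t \<Longrightarrow>
        \<forall>t. \<bar>Phi w t - Phi v t\<bar> \<le> q * D * M t"
    and q: "0 \<le> q" "q < 1"
    and closed: "\<And>W w E. (\<And>n. W n \<in> S) \<Longrightarrow> E \<longlonglongrightarrow> 0 \<Longrightarrow>
        (\<And>n t. \<bar>W n t - w t\<bar> \<le> E n * M t) \<Longrightarrow> w \<in> S"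
  shows "\<exists>w\<in>S. \<forall>t. Phi w t = w t"
proof -
  define W where "W n = (Phi ^^ n) w0" for n
  have WS: "W n \<in> S" for n by (induction n) (auto simp: W_def w0 Phi)
  have W_Suc: "W (Suc n) = Phi (W n)" for n by (simp add: W_def)
  obtain D where D: "\<bar>W 1 t - W 0 t\<bar> \<le> D * M t" for t using bd[OF WS WS] by blast
  have step: "\<forall>t. \<bar>W (Suc n) t - W n t\<bar> \<le> q ^ n * D * M t" for n
  proof (induction n)
    case (Suc n)
    from contr[OF WS WS Suc] show ?case by (simp add: W_Suc mult.assoc)
  qed (use D in simp)
  have D0: "D \<ge> 0" using D[of 0] M[of 0] by (metis abs_ge_zero order_trans zero_le_mult_iff not_less less_eq_real_def)
  \<comment> \<open>The exact partial sum of the geometric series is kept so that the induction on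
    \<open>k\<close> closes; \<open>far'\<close> then drops the subtracted term.\<close>
  have far: "\<bar>W (n + k) t - W n t\<bar> \<le> (q ^ n - q ^ (n + k)) / (1 - q) * D * M t" for n k t
  proof (induction k)
    case (Suc k)
    have "\<bar>W (n + Suc k) t - W n t\<bar> \<le> \<bar>W (Suc (n + k)) t - W (n + k) t\<bar> + \<bar>W (n + k) t - W n t\<bar>" by simp
    also have "\<dots> \<le> q ^ (n + k) * D * M t + (q ^ n - q ^ (n + k)) / (1 - q) * D * M t"
      using step[of "n + k"] Suc by (intro add_mono) auto
    also have "\<dots> = (q ^ (n+k) + (q ^ n - q ^ (n + k)) / (1 - q)) * D * M t" by (simp add: algebra_simps)
    also have "q ^ (n+k) + (q ^ n - q ^ (n + k)) / (1 - q) = (q ^ n - q ^ (n + Suc k)) / (1 - q)"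
      using q by (simp add: field_simps)
    finally show ?case .
  qed simp
  have far': "\<bar>W (n + k) t - W n t\<bar> \<le> q ^ n / (1 - q) * D * M t" for n k t
  proof -
    have "(q ^ n - q ^ (n + k)) / (1 - q) \<le> q ^ n / (1 - q)" using q by (intro divide_right_mono) auto
    then show ?thesis using far[of n k t] D0 M[of t]
      by (meson mult_right_mono order_trans less_imp_le)
  qed
  have q0: "(\<lambda>n. q ^ n / (1 - q) * D * c) \<longlonglongrightarrow> 0" for c
  proof -
    have "(\<lambda>n. q ^ n * (D * c / (1 - q))) \<longlonglongrightarrow> 0"
      by (intro tendsto_mult_left_zero LIMSEQ_power_zero) (use q in auto)
    then show ?thesis by (simp add: field_simps)
  qed
  have "Cauchy (\<lambda>n. W n t)" for t
  proof (rule metric_CauchyI)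
    fix e :: real assume "e > 0"
    from order_tendstoD(2)[OF q0[of "M t"], of "e/2"] \<open>e > 0\<close> obtain N where
      N: "q ^ N / (1 - q) * D * M t < e / 2" by (auto simp: eventually_sequentially)
    have *: "\<bar>W m t - W N t\<bar> < e / 2" if "m \<ge> N" for m
      using order.strict_trans1[OF far'[of N "m - N" t] N] that by simp
    show "\<exists>N. \<forall>m\<ge>N. \<forall>n\<ge>N. dist (W m t) (W n t) < e"
    proof (intro exI allI impI)
      fix m n assume "m \<ge> N" "n \<ge> N"
      from *[OF this(1)] *[OF this(2)] show "dist (W m t) (W n t) < e"
        unfolding dist_real_def by linarith
    qed
  qed
  then have "\<forall>t. \<exists>L. (\<lambda>n. W n t) \<longlonglongrightarrow> L" using Cauchy_convergent_iff convergent_def by blast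
  then obtain w where w: "\<And>t. (\<lambda>n. W n t) \<longlonglongrightarrow> w t" by metis
  have near: "\<bar>W n t - w t\<bar> \<le> q ^ n / (1 - q) * D * M t" for n t
  proof (rule tendsto_upperbound)
    show "((\<lambda>k. \<bar>W n t - W (k + n) t\<bar>) \<longlonglongrightarrow> \<bar>W n t - w t\<bar>)"
      by (intro tendsto_intros LIMSEQ_ignore_initial_segment w)
    show "\<forall>\<^sub>F k in sequentially. \<bar>W n t - W (k + n) t\<bar> \<le> q ^ n / (1 - q) * D * M t"
      using far'[of n _ t] by (intro always_eventually) (simp add: abs_minus_commute add.commute)
  qed simp
  have wS: "w \<in> S" by (rule closed[OF WS q0[of 1]]) (use near in \<open>auto\<close>)
  have "Phi w t = w t" for t
  proof -
    have "(\<lambda>n. W (Suc n) t) \<longlonglongrightarrow> Phi w t"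
    proof (rule LIM_zero_cancel, rule Lim_null_comparison)
      show "\<forall>\<^sub>F n in sequentially. norm (W (Suc n) t - Phi w t) \<le> q * (q ^ n / (1 - q) * D) * M t"
        using contr[OF WS wS, of _ "q ^ _ / (1 - q) * D"] near by (intro always_eventually) (auto simp: W_Suc)
      show "(\<lambda>n. q * (q ^ n / (1 - q) * D) * M t) \<longlonglongrightarrow> 0"
        using tendsto_mult_right_zero[OF q0[of "M t"], of q] by (simp add: mult.assoc)
    qed
    then show ?thesis using LIMSEQ_Suc[OF w] LIMSEQ_unique by blast
  qed
  with wS show ?thesis by blast
qed

text \<open>Method of steps: \<open>Nx u\<close> at time t depends on \<open>u\<close> only up to t
  - h, so each Picard iterate is final on one more delay interval, and continuity of
  \<open>F\<close> suffices. No convergence argument is involved: the solution is read off as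
  \<open>X (k t) t\<close> from an iterate that is already stationary there.\<close>

lemma delay_equation_exists:
  fixes F phi :: "real \<Rightarrow> real"
  assumes h: "h > 0" and F: "continuous_on UNIV F" and phi: "continuous_on UNIV phi"
  shows "\<exists>u. continuous_on UNIV u \<and> (\<forall>t\<le>0. u t = phi t) \<and>
    (\<forall>t\<ge>0. (u has_real_derivative (- u t + F (u (t - h)))) (at t within {0..}))"
proof -
  define Nx where "Nx u t = (if t \<le> 0 then phi t else
      exp (- t) * (phi 0 + integral {0..t} (\<lambda>s. exp s * F (u (s - h)))))" for u and t :: real
  have Nx_form: "\<exists>U. (\<forall>t. (U has_real_derivative exp t * F (u (t - h))) (at t)) \<and>
      (\<forall>t\<ge>0. Nx u t = exp (- t) * (phi 0 + U t - U 0))" if u: "continuous_on UNIV u" for u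
  proof -
    have Fc: "continuous_on UNIV (\<lambda>s. exp s * F (u (s - h)))"
      by (intro continuous_intros continuous_on_compose2[OF F] continuous_on_compose2[OF u]) auto
    from antiderivative_exists[OF Fc] obtain U where U: "\<And>t. (U has_real_derivative exp t * F (u (t - h))) (at t)" by blast
    have "integral {0..t} (\<lambda>s. exp s * F (u (s - h))) = U t - U 0" if "t \<ge> 0" for t
      using that U by (intro integral_unique fundamental_theorem_of_calculus)
        (auto simp flip: has_real_derivative_iff_has_vector_derivative intro: has_field_derivative_at_within)
    then have "\<forall>t\<ge>0. Nx u t = exp (- t) * (phi 0 + U t - U 0)"
      by (auto simp: Nx_def add_diff_eq)
    with U show ?thesis by blast
  qed
  have Nx_der: "(Nx u has_real_derivative (- Nx u t + F (u (t - h)))) (at t within {0..})"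
    if u: "continuous_on UNIV u" and t: "t \<ge> 0" for u t
  proof -
    from Nx_form[OF u] obtain U where U: "\<And>t. (U has_real_derivative exp t * F (u (t - h))) (at t)"
      and eq: "\<And>t. t \<ge> 0 \<Longrightarrow> Nx u t = exp (- t) * (phi 0 + U t - U 0)" by blast
    have "((\<lambda>t. exp (- t) * (phi 0 + U t - U 0)) has_real_derivative (- Nx u t + F (u (t - h)))) (at t within {0..})"
      unfolding eq[OF t]
      by (auto intro!: derivative_eq_intros has_field_derivative_at_within[OF U] simp: algebra_simps simp flip: exp_add)
    then show ?thesis
      by (rule has_field_derivative_transform_within[OF _ zero_less_one]) (use eq t in auto)
  qed
  have Nx_cont: "continuous_on UNIV (Nx u)" if u: "continuous_on UNIV u" for u
  proof -
    have "continuous_on {0..} (Nx u)"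
      unfolding continuous_on_eq_continuous_within using Nx_der[OF u] DERIV_continuous by blast
    moreover have "continuous_on {..0} (Nx u)"
      by (rule continuous_on_eq[OF continuous_on_subset[OF phi]]) (auto simp: Nx_def)
    ultimately have "continuous_on ({..0} \<union> {0..}) (Nx u)"
      by (intro continuous_on_closed_Un) auto
    moreover have "{..0} \<union> {0::real..} = UNIV" by auto
    ultimately show ?thesis by simp
  qed
  have Nx_cong: "Nx u t = Nx v t" if "\<And>s. s \<le> t - h \<Longrightarrow> u s = v s" for u v t
    using that by (auto simp: Nx_def intro!: integral_cong)
  define X where "X n = (Nx ^^ n) phi" for n
  have X_Suc: "X (Suc n) = Nx (X n)" for n by (simp add: X_def)
  have Xc: "continuous_on UNIV (X n)" for n by (induction n) (auto simp: X_def phi Nx_cont)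
  have X_step: "t \<le> real n * h \<Longrightarrow> X (Suc n) t = X n t" for n t
  proof (induction n arbitrary: t)
    case 0 then show ?case by (simp add: X_def Nx_def)
  next
    case (Suc n)
    have "Nx (X (Suc n)) t = Nx (X n) t"
      by (rule Nx_cong, rule Suc.IH) (use Suc.prems in \<open>auto simp: algebra_simps\<close>)
    then show ?case by (simp only: X_Suc)
  qed
  have X_stab: "t \<le> real n * h \<Longrightarrow> n \<le> m \<Longrightarrow> X m t = X n t" for n m t
  proof (induction m)
    case (Suc m)
    show ?case
    proof (cases "n = Suc m")
      case False
      then have "n \<le> m" using Suc by simp
      then have "real n * h \<le> real m * h" using h by (intro mult_right_mono) auto
      then show ?thesis using Suc \<open>n \<le> m\<close> X_step[of t m] by simp
    qed simp
  qed simp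
  define k where "k t = nat \<lceil>t / h\<rceil>" for t
  have k: "t \<le> real (k t) * h" for t
    using h by (simp add: k_def pos_divide_le_eq[symmetric] of_nat_nat) linarith
  define u where "u t = X (k t) t" for t
  have u_eq: "u t = X n t" if "t \<le> real n * h" for t n
  proof (cases "k t \<le> n")
    case True then show ?thesis using X_stab[OF k True] by (simp add: u_def)
  next
    case False then show ?thesis using X_stab[OF that, of "k t"] by (simp add: u_def)
  qed
  have "isCont u t" for t
  proof -
    obtain n where n: "t + 1 \<le> real n * h" using k by blast
    have "isCont (X n) t" using Xc by (simp add: continuous_on_eq_continuous_at)
    moreover have "\<forall>\<^sub>F s in nhds t. u s = X n s"
    proof (rule eventually_nhds_in_open[of "{..<t+1}", THEN eventually_mono])
      show "u s = X n s" if "s \<in> {..<t+1}" for s using that n by (intro u_eq) auto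
    qed auto
    ultimately show ?thesis using isCont_cong by blast
  qed
  then have uc: "continuous_on UNIV u" by (simp add: continuous_on_eq_continuous_at)
  have u_Nx: "u t = Nx u t" for t
  proof -
    have "u t = X (Suc (k t)) t" using u_eq[OF k] X_step[OF k] by simp
    also have "\<dots> = Nx u t" unfolding X_Suc
    proof (rule Nx_cong)
      show "X (k t) s = u s" if "s \<le> t - h" for s
        using that k[of t] h by (intro u_eq[symmetric]) auto
    qed
    finally show ?thesis .
  qed
  then have "Nx u = u" by auto
  with Nx_der[OF uc] have "\<forall>t\<ge>0. (u has_real_derivative (- u t + F (u (t - h)))) (at t within {0..})" by simp
  moreover have "\<forall>t\<le>0. u t = phi t" using u_Nx by (metis Nx_def)
  ultimately show ?thesis using uc by blast
qed

text \<open>The bounded solution V of \<theta> V' = V - Y, that is, the inverse of 1 - \<theta> D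
  applied to Y. For positive \<theta> it averages the future, for \<theta> = -1 it is the variation
  of constants formula for V' = -V + Y from minus infinity, and for \<theta> = 0 it is the
  identity.\<close>

definition avg :: "real \<Rightarrow> (real \<Rightarrow> real) \<Rightarrow> real \<Rightarrow> real" where
  "avg \<theta> Y t = integral {0..} (\<lambda>u. exp (- u) * Y (t + \<theta> * u))"

lemma weighted_exp_integral:
  assumes "k < 1"
  shows "((\<lambda>u. exp (- u) * (C * exp (k * u))) has_integral C / (1 - k)) {0::real..}"
proof -
  have "((\<lambda>u. C * exp (- (1 - k) * u)) has_integral C * (exp (- (1 - k) * 0) / (1 - k))) {0..}"
    using assms by (intro has_integral_mult_right has_integral_exp_minus_to_infinity) auto
  moreover have "(\<lambda>u. C * exp (- (1 - k) * u)) = (\<lambda>u. exp (- u) * (C * exp (k * u)))"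
    by (simp add: algebra_simps exp_add[symmetric] fun_eq_iff)
  ultimately show ?thesis by simp
qed

lemma
  assumes Y: "continuous_on UNIV Y" and bd: "\<And>u. u \<ge> 0 \<Longrightarrow> \<bar>Y (t + \<theta> * u)\<bar> \<le> C * exp (k * u)" and k: "k < 1"
  shows avg_integrable: "(\<lambda>u. exp (- u) * Y (t + \<theta> * u)) integrable_on {0..}"
    and avg_bound: "\<bar>avg \<theta> Y t\<bar> \<le> C / (1 - k)"
proof -
  have c: "continuous_on {0..} (\<lambda>u. exp (- u) * Y (t + \<theta> * u))"
    by (intro continuous_intros continuous_on_compose2[OF Y]) auto
  show i: "(\<lambda>u. exp (- u) * Y (t + \<theta> * u)) integrable_on {0..}"
    by (rule measurable_bounded_by_integrable_imp_integrable_real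
        [OF continuous_imp_measurable_on_sets_lebesgue[OF c] has_integral_integrable[OF weighted_exp_integral[OF k]]])
      (use bd in \<open>auto simp: abs_mult intro!: mult_left_mono\<close>)
  have "norm (integral {0..} (\<lambda>u. exp (- u) * Y (t + \<theta> * u))) \<le> integral {0..} (\<lambda>u. exp (- u) * (C * exp (k * u)))"
    by (rule integral_norm_bound_integral[OF i has_integral_integrable[OF weighted_exp_integral[OF k]]])
      (use bd in \<open>auto simp: abs_mult intro!: mult_left_mono\<close>)
  then show "\<bar>avg \<theta> Y t\<bar> \<le> C / (1 - k)"
    using integral_unique[OF weighted_exp_integral[OF k, of C]] by (simp add: avg_def)
qed

lemma avg_0 [simp]: "avg 0 Y t = Y t"
proof -
  have "((\<lambda>u. exp (- u) * (Y t * exp (0 * u))) has_integral Y t / (1 - 0)) {0::real..}"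
    by (rule weighted_exp_integral) simp
  from integral_unique[OF this] show ?thesis by (simp add: avg_def)
qed

lemma avg_exp:
  assumes "\<theta> * a < 1"
  shows "avg \<theta> (\<lambda>s. exp (a * s)) t = exp (a * t) / (1 - \<theta> * a)"
proof -
  have "((\<lambda>u. exp (- u) * (exp (a * t) * exp (\<theta> * a * u))) has_integral exp (a * t) / (1 - \<theta> * a)) {0::real..}"
    by (rule weighted_exp_integral[OF assms])
  moreover have "(\<lambda>u. exp (- u) * (exp (a * t) * exp (\<theta> * a * u))) = (\<lambda>u. exp (- u) * exp (a * (t + \<theta> * u)))"
    by (simp add: algebra_simps exp_add[symmetric] fun_eq_iff)
  ultimately show ?thesis by (simp add: avg_def integral_unique)
qed

lemma avg_scale: "\<theta> \<noteq> 0 \<Longrightarrow> avg \<theta> Y t = avg 1 (\<lambda>s. Y (\<theta> * s)) (t / \<theta>)"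
  by (simp add: avg_def distrib_left)

text \<open>The average equals exp t times the integral of exp(-s) Y s over [t, \<infinity>). With
  an antiderivative \<open>V\<close> of the integrand this integral is the limit of \<open>V\<close>
  at plus infinity minus \<open>V t\<close>. The limit, computed in \<open>lim\<close>, does not
  depend on t, so the average is exp t times (constant - \<open>V t\<close>) and can be
  differentiated explicitly.\<close>

lemma avg_1_derivative:
  assumes Y: "continuous_on UNIV Y" and k: "k < 1"
    and bd: "\<And>t. \<exists>C. \<forall>u\<ge>0. \<bar>Y (t + u)\<bar> \<le> C * exp (k * u)"
  shows "(avg 1 Y has_real_derivative (avg 1 Y t - Y t)) (at t)"
proof -
  have c: "continuous_on UNIV (\<lambda>s. exp (- s) * Y s)"
    by (intro continuous_intros continuous_on_compose2[OF Y]) auto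
  from antiderivative_exists[OF this] obtain V where V: "\<And>s. (V has_real_derivative exp (- s) * Y s) (at s)" by blast
  have lim: "(V \<longlongrightarrow> V t + exp (- t) * avg 1 Y t) at_top" for t
  proof -
    from bd obtain C where C: "\<And>u. u \<ge> 0 \<Longrightarrow> \<bar>Y (t + u)\<bar> \<le> C * exp (k * u)" by blast
    let ?f = "\<lambda>u. exp (- u) * Y (t + u)"
    have i: "?f integrable_on {0..}" using avg_integrable[of Y t 1 C k] Y C k by simp
    have est: "\<bar>avg 1 Y t - exp t * (V (t + y) - V t)\<bar> \<le> C / (1 - k) * exp (- (1 - k) * y)" if y: "y \<ge> 0" for y
    proof -
      have i1: "(?f has_integral exp t * V (t + y) - exp t * V (t + 0)) {0..y}"
        using y by (intro fundamental_theorem_of_calculus)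
          (auto simp flip: has_real_derivative_iff_has_vector_derivative
            intro!: derivative_eq_intros DERIV_chain2[OF V] simp: mult.assoc[symmetric] exp_add[symmetric])
      have bi: "(\<lambda>u. exp (- u) * (C * exp (k * u))) = (\<lambda>u. C * exp (- (1 - k) * u))"
        by (simp add: algebra_simps exp_add[symmetric] fun_eq_iff)
      have b: "((\<lambda>u. exp (- u) * (C * exp (k * u))) has_integral C * (exp (- (1 - k) * y) / (1 - k))) {y..}"
        unfolding bi using k by (intro has_integral_mult_right has_integral_exp_minus_to_infinity) auto
      have cf: "continuous_on {y..} ?f"
        by (intro continuous_intros continuous_on_compose2[OF Y]) auto
      have i2: "?f integrable_on {y..}"
        by (rule measurable_bounded_by_integrable_imp_integrable_real
            [OF continuous_imp_measurable_on_sets_lebesgue[OF cf] has_integral_integrable[OF b]])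
          (use C y in \<open>auto simp: abs_mult intro!: mult_left_mono\<close>)
      have "norm (integral {y..} ?f) \<le> integral {y..} (\<lambda>u. exp (- u) * (C * exp (k * u)))"
        by (rule integral_norm_bound_integral[OF i2 has_integral_integrable[OF b]])
          (use C y in \<open>auto simp: abs_mult intro!: mult_left_mono\<close>)
      also have "\<dots> = C / (1 - k) * exp (- (1 - k) * y)" using integral_unique[OF b] by simp
      finally have n: "\<bar>integral {y..} ?f\<bar> \<le> C / (1 - k) * exp (- (1 - k) * y)" by simp
      have "(?f has_integral (exp t * V (t + y) - exp t * V (t + 0)) + integral {y..} ?f) ({0..y} \<union> {y..})"
        by (rule has_integral_Un[OF i1 integrable_integral[OF i2]])
          (use y in \<open>auto intro!: negligible_subset[of "{y}"]\<close>)
      moreover have "{0..y} \<union> {y..} = {0..}" using y by auto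
      ultimately have "avg 1 Y t = (exp t * V (t + y) - exp t * V (t + 0)) + integral {y..} ?f"
        by (simp add: avg_def integral_unique)
      then show ?thesis using n by (simp add: algebra_simps)
    qed
    have "((\<lambda>y. exp t * (V (t + y) - V t)) \<longlongrightarrow> avg 1 Y t) at_top"
    proof (rule LIM_zero_cancel, rule Lim_null_comparison)
      show "\<forall>\<^sub>F y in at_top. norm (exp t * (V (t + y) - V t) - avg 1 Y t) \<le> C / (1 - k) * exp (- (1 - k) * y)"
        using eventually_ge_at_top[of 0] by eventually_elim (use est in \<open>auto simp: abs_minus_commute\<close>)
      have "filterlim (\<lambda>y. - (1 - k) * y) at_bot at_top"
        using k by (intro filterlim_tendsto_neg_mult_at_bot[OF tendsto_const]) (auto intro: filterlim_ident)
      from filterlim_compose[OF exp_at_bot this] show "((\<lambda>y. C / (1 - k) * exp (- (1 - k) * y)) \<longlongrightarrow> 0) at_top"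
        by (intro tendsto_mult_right_zero)
    qed
    from tendsto_add[OF tendsto_const[of "V t"] tendsto_mult[OF tendsto_const[of "exp (- t)"] this]]
    have "((\<lambda>y. V (t + y)) \<longlongrightarrow> V t + exp (- t) * avg 1 Y t) at_top"
      by (simp add: exp_minus field_simps)
    moreover have "filterlim (\<lambda>y. y - t) at_top at_top"
      by (rule filterlim_at_top_mono[OF filterlim_tendsto_add_at_top[OF tendsto_const[of "-t"] filterlim_ident]]) auto
    ultimately show ?thesis using filterlim_compose[of "\<lambda>y. V (t + y)" _ at_top "\<lambda>y. y - t" at_top] by simp
  qed
  have eq: "avg 1 Y t = exp t * (V 0 + avg 1 Y 0 - V t)" for t
  proof -
    have "V t + exp (- t) * avg 1 Y t = V 0 + exp (- 0) * avg 1 Y 0"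
      by (rule tendsto_unique[OF _ lim lim]) simp
    then have "exp (- t) * avg 1 Y t = V 0 + avg 1 Y 0 - V t" by simp
    then have "exp t * (exp (- t) * avg 1 Y t) = exp t * (V 0 + avg 1 Y 0 - V t)" by simp
    then show ?thesis by (simp add: mult.assoc[symmetric] exp_add[symmetric])
  qed
  have "((\<lambda>t. exp t * (V 0 + avg 1 Y 0 - V t)) has_real_derivative (avg 1 Y t - Y t)) (at t)"
    unfolding eq[of t] by (auto intro!: derivative_eq_intros V simp: algebra_simps simp flip: exp_add)
  then show ?thesis unfolding eq[symmetric] .
qed

lemma avg_derivative:
  assumes Y: "continuous_on UNIV Y" and \<theta>: "\<theta> \<noteq> 0" and k: "k < 1"
    and bd: "\<And>t. \<exists>C. \<forall>u\<ge>0. \<bar>Y (t + \<theta> * u)\<bar> \<le> C * exp (k * u)"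
  shows "(avg \<theta> Y has_real_derivative (avg \<theta> Y t - Y t) / \<theta>) (at t)"
proof -
  have "(avg 1 (\<lambda>s. Y (\<theta> * s)) has_real_derivative (avg 1 (\<lambda>s. Y (\<theta> * s)) (t / \<theta>) - Y (\<theta> * (t / \<theta>)))) (at (t / \<theta>))"
  proof (rule avg_1_derivative[OF _ k])
    show "continuous_on UNIV (\<lambda>s. Y (\<theta> * s))" by (intro continuous_intros continuous_on_compose2[OF Y]) auto
    show "\<exists>C. \<forall>u\<ge>0. \<bar>Y (\<theta> * (s + u))\<bar> \<le> C * exp (k * u)" for s
      using bd[of "\<theta> * s"] by (simp add: distrib_left)
  qed
  note chain = DERIV_chain2[where g = "\<lambda>t. t / \<theta>" and Db = "1 / \<theta>", OF this]
  have "((\<lambda>t. avg 1 (\<lambda>s. Y (\<theta> * s)) (t / \<theta>)) has_real_derivative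
     (avg 1 (\<lambda>s. Y (\<theta> * s)) (t / \<theta>) - Y (\<theta> * (t / \<theta>))) * (1 / \<theta>)) (at t)"
    by (rule chain) (use \<theta> in \<open>auto intro!: derivative_eq_intros\<close>)
  moreover have "avg \<theta> Y = (\<lambda>t. avg 1 (\<lambda>s. Y (\<theta> * s)) (t / \<theta>))"
    using avg_scale[OF \<theta>] by auto
  ultimately show ?thesis using \<theta> by simp
qed

lemma avg_tendsto_at_top:
  assumes Y: "continuous_on UNIV Y" and lim: "(Y \<longlongrightarrow> L) at_top" and \<theta>: "\<theta> \<ge> 0" and B: "\<And>t. \<bar>Y t\<bar> \<le> B"
  shows "(avg \<theta> Y \<longlongrightarrow> L) at_top"
proof (rule tendstoI)
  fix e :: real assume e: "e > 0"
  from tendstoD[OF lim, of "e/2"] e obtain S where S: "\<And>s. s \<ge> S \<Longrightarrow> \<bar>Y s - L\<bar> < e / 2"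
    by (auto simp: eventually_at_top_linorder dist_real_def)
  have "dist (avg \<theta> Y t) L < e" if "t \<ge> S" for t
  proof -
    have "(\<lambda>u. exp (- u) * Y (t + \<theta> * u)) integrable_on {0..}"
      using B by (intro avg_integrable[OF Y, of _ _ B 0]) auto
    moreover have "((\<lambda>u. exp (- u) * L) has_integral L) {0..}"
      using weighted_exp_integral[of 0 L] by simp
    ultimately have "avg \<theta> (\<lambda>s. Y s - L) t = avg \<theta> Y t - L"
      by (simp add: avg_def right_diff_distrib integral_diff has_integral_integrable integral_unique del: integral_mult_left)
    moreover have "\<bar>avg \<theta> (\<lambda>s. Y s - L) t\<bar> \<le> (e / 2) / (1 - 0)"
      using S[of "t + \<theta> * _"] that \<theta> by (intro avg_bound continuous_intros Y) (auto intro!: less_imp_le simp: add_increasing2)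
    ultimately show ?thesis using e by (simp add: dist_real_def)
  qed
  then show "\<forall>\<^sub>F t in at_top. dist (avg \<theta> Y t) L < e" by (auto simp: eventually_at_top_linorder)
qed

section \<open>The linear delay equation\<close>

text \<open>Iterating D \<mapsto> q D + E converges to E / (1 - q) whatever the initial constant. So
  any finite bound \<open>D0\<close>, however bad, is upgraded to one depending only on
  \<open>E\<close> and \<open>q\<close>.\<close>

lemma self_improving_bound:
  fixes A M :: "real \<Rightarrow> real"
  assumes base: "\<And>x. x \<in> S \<Longrightarrow> A x \<le> D0 * M x"
    and step: "\<And>D. (\<And>x. x \<in> S \<Longrightarrow> A x \<le> D * M x) \<Longrightarrow> (\<And>x. x \<in> S \<Longrightarrow> A x \<le> (q * D + E) * M x)"
    and q: "0 \<le> q" "q < 1" and x: "x \<in> S"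
  shows "A x \<le> E / (1 - q) * M x"
proof -
  have it: "\<forall>x\<in>S. A x \<le> (q ^ n * (D0 - E / (1 - q)) + E / (1 - q)) * M x" for n
  proof (induction n)
    case (Suc n)
    have eq: "q * (q ^ n * (D0 - E / (1 - q)) + E / (1 - q)) + E = q ^ Suc n * (D0 - E / (1 - q)) + E / (1 - q)"
    proof -
      obtain c where c: "c = E / (1 - q)" by blast
      then have "E = c * (1 - q)" using q by simp
      then show ?thesis unfolding c[symmetric] by (simp add: algebra_simps)
    qed
    show ?case using step[OF bspec[OF Suc]] unfolding eq by blast
  qed (use base in auto)
  have "(\<lambda>n. (q ^ n * (D0 - E / (1 - q)) + E / (1 - q)) * M x) \<longlonglongrightarrow> (0 * (D0 - E / (1 - q)) + E / (1 - q)) * M x"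
    by (intro tendsto_intros LIMSEQ_power_zero) (use q in auto)
  then show ?thesis
    by (intro tendsto_lowerbound[where a = "A x"]) (use it x in \<open>auto intro!: always_eventually\<close>)
qed

lemma weighted_limit_continuous:
  fixes M w :: "real \<Rightarrow> real" and W :: "nat \<Rightarrow> real \<Rightarrow> real"
  assumes W: "\<And>n. continuous_on UNIV (W n)" and M: "continuous_on UNIV M"
    and E: "E \<longlonglongrightarrow> 0" and near: "\<And>n t. \<bar>W n t - w t\<bar> \<le> E n * M t"
  shows "continuous_on UNIV w"
proof -
  have "isCont w t" for t
  proof -
    have "compact (M ` {t-1..t+1})" by (intro compact_continuous_image continuous_on_subset[OF M]) auto
    from compact_imp_bounded[OF this] obtain B where "\<forall>y\<in>M ` {t-1..t+1}. norm y \<le> B"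
      unfolding bounded_iff by blast
    then have B: "\<And>s. s \<in> {t-1..t+1} \<Longrightarrow> \<bar>M s\<bar> \<le> B" by auto
    have B0: "B \<ge> 0" using B[of t] by simp
    have "uniform_limit {t-1..t+1} W w sequentially"
    proof (rule uniform_limitI)
      fix e :: real assume e: "e > 0"
      have "(\<lambda>n. \<bar>E n\<bar> * B) \<longlonglongrightarrow> 0" using tendsto_mult_left_zero[OF tendsto_rabs_zero[OF E]] .
      then have "\<forall>\<^sub>F n in sequentially. \<bar>E n\<bar> * B < e" using e order_tendstoD(2) by blast
      then show "\<forall>\<^sub>F n in sequentially. \<forall>x\<in>{t-1..t+1}. dist (W n x) (w x) < e"
      proof eventually_elim
        case (elim n)
        show ?case
        proof
          fix x assume "x \<in> {t-1..t+1}"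
          then have "\<bar>E n * M x\<bar> \<le> \<bar>E n\<bar> * B" using B[of x] by (simp add: abs_mult mult_left_mono)
          then show "dist (W n x) (w x) < e" using near[of n x] elim by (simp add: dist_real_def)
        qed
      qed
    qed
    then have "continuous_on {t-1..t+1} w"
      by (rule uniform_limit_theorem[rotated]) (auto intro!: always_eventually continuous_on_subset[OF W])
    then show "isCont w t" by (rule continuous_on_interior) auto
  qed
  then show ?thesis by (simp add: continuous_on_eq_continuous_at)
qed

text \<open>The solution is a fixed point of the variation of constants operator \<open>Phi\<close>.
  For t \<le> T the delayed term contracts in the weight exp(\<nu> t) with factor \<open>q0\<close>,
  because the delay and the integration gain exp(- \<nu> h) / (1 + \<nu>). To the right of
  \<open>T\<close>, where only the bound \<open>B\<close> on the coefficient is known, a fast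
  growing exponential is added to the weight, which makes any bounded coefficient contractive; the
  bound obtained there is not exported.\<close>

lemma linear_delay_exists:
  fixes b f :: "real \<Rightarrow> real"
  assumes b: "continuous_on UNIV b" and B: "\<And>t. \<bar>b t\<bar> \<le> B" and pb: "\<And>t. t \<le> T \<Longrightarrow> \<bar>b t\<bar> \<le> pb"
    and q: "pb * exp (- \<nu> * h) < 1 + \<nu>" and pos: "\<nu> > 0" "h > 0"
    and f: "continuous_on UNIV f" and D: "\<And>t. \<bar>f t\<bar> \<le> D * exp (\<nu> * t)"
  shows "\<exists>w C. (\<forall>t. (w has_real_derivative (- w t + (b t * w (t - h) + f t))) (at t)) \<and>
    (\<forall>t\<le>T. \<bar>w t\<bar> \<le> C * exp (\<nu> * t))"
proof -
  have pb0: "pb \<ge> 0" and B0: "B \<ge> 0" using pb[of T] B[of 0] by auto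
  define q0 where "q0 = pb * exp (- \<nu> * h) / (1 + \<nu>)"
  have q0: "0 \<le> q0" "q0 < 1" using pb0 pos q by (auto simp: q0_def)
  \<comment> \<open>\<open>q0\<close> vanishes if \<open>pb\<close> does, and \<Gamma> divides by
    the contraction constant; the midpoint between \<open>q0\<close> and 1 is positive.\<close>
  define q where "q = (q0 + 1) / 2"
  have q: "0 < q" "q < 1" "q0 \<le> q" using q0 by (auto simp: q_def)
  \<comment> \<open>This value gives q (1 + \<Gamma>) \<ge> 2 B. The 2 appears because beyond
    \<open>T\<close> both parts of \<open>M (s - h)\<close> are estimated by the second part of
    \<open>M s\<close>.\<close>
  define \<Gamma> where "\<Gamma> = \<nu> + 2 * B / q"
  have \<Gamma>: "\<Gamma> \<ge> \<nu>" using B0 q by (simp add: \<Gamma>_def)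
  have "q * \<Gamma> = q * \<nu> + 2 * B" using q by (simp add: \<Gamma>_def field_simps)
  then have \<Gamma>B: "2 * B \<le> q * (1 + \<Gamma>)" using q pos by (simp add: distrib_left add_nonneg_nonneg)
  define M where "M t = exp (\<nu> * t) + exp (\<nu> * T) * exp (\<Gamma> * (t - T))" for t
  have Mpos: "M t > 0" for t by (simp add: M_def add_pos_pos)
  have Mmono: "M s \<le> M t" if "s \<le> t" for s t
    unfolding M_def using that pos \<Gamma> by (intro add_mono mult_left_mono) (auto intro!: mult_left_mono)
  have Mc: "continuous_on UNIV M" unfolding M_def by (intro continuous_intros)
  have key: "\<bar>b s\<bar> * M (s - h) \<le> q * (1 + \<nu>) * exp (\<nu> * s) + q * (1 + \<Gamma>) * (exp (\<nu> * T) * exp (\<Gamma> * (s - T)))" for s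
  proof (cases "s \<le> T")
    case True
    have "\<bar>b s\<bar> * exp (\<nu> * (s - h)) \<le> pb * exp (\<nu> * (s - h))" using pb[OF True] by (intro mult_right_mono) auto
    also have "\<dots> = q0 * (1 + \<nu>) * exp (\<nu> * s)"
    proof -
      have "q0 * (1 + \<nu>) = pb * exp (- \<nu> * h)" using pos by (simp add: q0_def)
      moreover have "exp (\<nu> * (s - h)) = exp (- \<nu> * h) * exp (\<nu> * s)" by (simp add: exp_add[symmetric] algebra_simps)
      ultimately show ?thesis by simp
    qed
    also have "\<dots> \<le> q * (1 + \<nu>) * exp (\<nu> * s)" using q pos by (intro mult_right_mono) auto
    finally have 1: "\<bar>b s\<bar> * exp (\<nu> * (s - h)) \<le> q * (1 + \<nu>) * exp (\<nu> * s)" .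
    have "\<bar>b s\<bar> * (exp (\<nu> * T) * exp (\<Gamma> * (s - h - T))) \<le> B * (exp (\<nu> * T) * exp (\<Gamma> * (s - T)))"
      using B[of s] B0 pos \<Gamma> by (intro mult_mono) (auto intro!: mult_left_mono)
    also have "\<dots> \<le> q * (1 + \<Gamma>) * (exp (\<nu> * T) * exp (\<Gamma> * (s - T)))"
      using \<Gamma>B B0 by (intro mult_right_mono) auto
    finally have "\<bar>b s\<bar> * (exp (\<nu> * T) * exp (\<Gamma> * (s - h - T))) \<le> q * (1 + \<Gamma>) * (exp (\<nu> * T) * exp (\<Gamma> * (s - T)))" .
    from add_mono[OF 1 this] show ?thesis by (simp only: M_def distrib_left)
  next
    case False
    have "exp (\<nu> * (s - h)) \<le> exp (\<nu> * T) * exp (\<Gamma> * (s - T))"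
    proof -
      have "\<nu> * (s - h) \<le> \<nu> * T + \<nu> * (s - T)" using pos by (simp add: algebra_simps)
      also have "\<dots> \<le> \<nu> * T + \<Gamma> * (s - T)" using \<Gamma> False by (intro add_left_mono mult_right_mono) auto
      finally show ?thesis by (simp add: exp_add[symmetric])
    qed
    moreover have "exp (\<nu> * T) * exp (\<Gamma> * (s - h - T)) \<le> exp (\<nu> * T) * exp (\<Gamma> * (s - T))"
      using pos \<Gamma> by (auto intro!: mult_left_mono)
    ultimately have "M (s - h) \<le> 2 * (exp (\<nu> * T) * exp (\<Gamma> * (s - T)))" unfolding M_def by linarith
    then have "\<bar>b s\<bar> * M (s - h) \<le> B * (2 * (exp (\<nu> * T) * exp (\<Gamma> * (s - T))))"
      using B[of s] B0 Mpos[of "s - h"] by (intro mult_mono) auto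
    also have "\<dots> \<le> q * (1 + \<Gamma>) * (exp (\<nu> * T) * exp (\<Gamma> * (s - T)))"
      using mult_right_mono[OF \<Gamma>B, of "exp (\<nu> * T) * exp (\<Gamma> * (s - T))"] by (simp add: algebra_simps)
    also have "\<dots> \<le> q * (1 + \<nu>) * exp (\<nu> * s) + q * (1 + \<Gamma>) * (exp (\<nu> * T) * exp (\<Gamma> * (s - T)))"
      using q pos by simp
    finally show ?thesis .
  qed
  define S where "S = {w. continuous_on UNIV w \<and> (\<exists>C. \<forall>t. \<bar>w t\<bar> \<le> C * M t)}"
  define Phi where "Phi w = avg (-1) (\<lambda>s. b s * w (s - h) + f s)" for w
  have D0: "D \<ge> 0" using D[of 0] by simp
  have rhs: "continuous_on UNIV (\<lambda>s. b s * w (s - h) + f s) \<and> (\<exists>C. \<forall>s t. s \<le> t \<longrightarrow> \<bar>b s * w (s - h) + f s\<bar> \<le> C * M t)" if "w \<in> S" for w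
  proof -
    from that obtain C where wc: "continuous_on UNIV w" and C: "\<And>t. \<bar>w t\<bar> \<le> C * M t" by (auto simp: S_def)
    have C0: "C \<ge> 0" using C[of 0] Mpos[of 0] by (metis abs_ge_zero order_trans zero_le_mult_iff not_less)
    have "\<bar>b s * w (s - h) + f s\<bar> \<le> (B * C + D) * M t" if "s \<le> t" for s t
    proof -
      have "\<bar>b s * w (s - h)\<bar> \<le> B * (C * M t)" unfolding abs_mult
        using B[of s] C[of "s - h"] B0 Mmono[of "s - h" t] that pos C0
        by (intro mult_mono) (auto intro: order_trans[OF _ mult_left_mono[of "M (s - h)" "M t" C]])
      moreover have "\<bar>f s\<bar> \<le> D * M t"
      proof -
        have "exp (\<nu> * s) \<le> M s" by (simp add: M_def)
        then have "D * exp (\<nu> * s) \<le> D * M t" using Mmono[OF that] D0 by (intro mult_left_mono) auto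
        then show ?thesis using D[of s] by simp
      qed
      ultimately show ?thesis by (simp add: algebra_simps)
    qed
    moreover have "continuous_on UNIV (\<lambda>s. b s * w (s - h) + f s)"
      by (intro continuous_intros b f continuous_on_compose2[OF wc]) auto
    ultimately show ?thesis by blast
  qed
  have Phi_der: "(Phi w has_real_derivative (- Phi w t + (b t * w (t - h) + f t))) (at t)" if "w \<in> S" for w t
  proof -
    from rhs[OF that] obtain C where c: "continuous_on UNIV (\<lambda>s. b s * w (s - h) + f s)"
      and C: "\<And>s t. s \<le> t \<Longrightarrow> \<bar>b s * w (s - h) + f s\<bar> \<le> C * M t" by blast
    have "(avg (-1) (\<lambda>s. b s * w (s - h) + f s) has_real_derivative
       (avg (-1) (\<lambda>s. b s * w (s - h) + f s) t - (b t * w (t - h) + f t)) / (-1)) (at t)"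
    proof (rule avg_derivative[OF c, of _ 0])
      show "\<exists>C'. \<forall>u\<ge>0. \<bar>b (s + - 1 * u) * w (s + - 1 * u - h) + f (s + - 1 * u)\<bar> \<le> C' * exp (0 * u)" for s
        by (rule exI[of _ "C * M s"]) (use C[of _ s] in simp)
    qed auto
    then show ?thesis by (simp add: Phi_def)
  qed
  have Phi_bd: "\<exists>C. \<forall>t. \<bar>Phi w t\<bar> \<le> C * M t" if "w \<in> S" for w
  proof -
    from rhs[OF that] obtain C where c: "continuous_on UNIV (\<lambda>s. b s * w (s - h) + f s)"
      and C: "\<And>s t. s \<le> t \<Longrightarrow> \<bar>b s * w (s - h) + f s\<bar> \<le> C * M t" by blast
    have "\<bar>Phi w t\<bar> \<le> C * M t / (1 - 0)" for t unfolding Phi_def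
      by (rule avg_bound[OF c]) (use C in \<open>auto\<close>)
    then show ?thesis by auto
  qed
  have PhiS: "Phi w \<in> S" if "w \<in> S" for w
    using Phi_bd[OF that] DERIV_isCont[OF Phi_der[OF that]]
    by (auto simp: S_def continuous_on_eq_continuous_at)
  have diff_bd: "\<exists>D. \<forall>t. \<bar>w t - v t\<bar> \<le> D * M t" if "w \<in> S" "v \<in> S" for w v
  proof -
    from that obtain C1 C2 where "\<And>t. \<bar>w t\<bar> \<le> C1 * M t" "\<And>t. \<bar>v t\<bar> \<le> C2 * M t" by (auto simp: S_def)
    then have "\<bar>w t - v t\<bar> \<le> (C1 + C2) * M t" for t
      by (smt (verit) distrib_right)
    then show ?thesis by blast
  qed
  have "\<exists>w\<in>S. \<forall>t. Phi w t = w t"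
  proof (rule weighted_contraction_fixpoint[where M = M and q = q])
    show "(\<lambda>t. 0) \<in> S" by (auto simp: S_def intro!: exI[of _ 0])
    show "\<forall>t. \<bar>Phi w t - Phi v t\<bar> \<le> q * D * M t"
      if wv: "w \<in> S" "v \<in> S" and d: "\<forall>t. \<bar>w t - v t\<bar> \<le> D * M t" for w v D
    proof
      fix t
      have D0: "D \<ge> 0" using d[rule_format, of 0] Mpos[of 0] by (metis abs_ge_zero order_trans zero_le_mult_iff not_less)
      from diff_bd[OF PhiS PhiS] wv obtain D2 where D2: "\<And>t. \<bar>Phi w t - Phi v t\<bar> \<le> D2 * M t" by blast
      have D20: "D2 \<ge> 0" using D2[of 0] Mpos[of 0] by (metis abs_ge_zero order_trans zero_le_mult_iff not_less)
      have "\<bar>Phi w t - Phi v t\<bar> \<le> (q * (1 + \<nu>) * D) / (1 + \<nu>) * exp (\<nu> * t)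
          + (q * (1 + \<Gamma>) * D * exp (\<nu> * T - \<Gamma> * T)) / (1 + \<Gamma>) * exp (\<Gamma> * t)"
      proof (rule bound_from_minus_infinity[where u = "\<lambda>t. Phi w t - Phi v t" and T = t and B = "D2 * M t" and
            r = "\<lambda>s. b s * (w (s - h) - v (s - h))"])
        show "((\<lambda>t. Phi w t - Phi v t) has_real_derivative
            - (Phi w s - Phi v s) + b s * (w (s - h) - v (s - h))) (at s)" for s
          by (auto intro!: derivative_eq_intros Phi_der wv simp: algebra_simps)
        show "\<bar>b s * (w (s - h) - v (s - h))\<bar> \<le> q * (1 + \<nu>) * D * exp (\<nu> * s) +
            q * (1 + \<Gamma>) * D * exp (\<nu> * T - \<Gamma> * T) * exp (\<Gamma> * s)" for s
        proof -
          have "\<bar>b s * (w (s - h) - v (s - h))\<bar> \<le> \<bar>b s\<bar> * (D * M (s - h))"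
            unfolding abs_mult using d by (intro mult_left_mono) auto
          also have "\<dots> \<le> D * (q * (1 + \<nu>) * exp (\<nu> * s) + q * (1 + \<Gamma>) * (exp (\<nu> * T) * exp (\<Gamma> * (s - T))))"
            using mult_left_mono[OF key D0, of s] by (simp add: mult_ac)
          also have "exp (\<nu> * T) * exp (\<Gamma> * (s - T)) = exp (\<nu> * T - \<Gamma> * T) * exp (\<Gamma> * s)"
            by (simp add: exp_add[symmetric] algebra_simps)
          finally show ?thesis by (simp add: algebra_simps)
        qed
        show "\<bar>Phi w s - Phi v s\<bar> \<le> D2 * M t" if "s \<le> t" for s
          using D2[of s] mult_left_mono[OF Mmono[OF that] D20] by simp
      qed (use pos \<Gamma> in auto)
      also have "\<dots> = q * D * M t"
      proof -
        have "(q * (1 + \<nu>) * D) / (1 + \<nu>) = q * D" using pos by simp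
        moreover have "(q * (1 + \<Gamma>) * D * exp (\<nu> * T - \<Gamma> * T)) / (1 + \<Gamma>) = q * D * exp (\<nu> * T - \<Gamma> * T)"
          using pos \<Gamma> by simp
        moreover have "exp (\<nu> * T - \<Gamma> * T) * exp (\<Gamma> * t) = exp (\<nu> * T) * exp (\<Gamma> * (t - T))"
          by (simp add: exp_add[symmetric] algebra_simps)
        ultimately show ?thesis by (simp add: M_def distrib_left mult.assoc)
      qed
      finally show "\<bar>Phi w t - Phi v t\<bar> \<le> q * D * M t" .
    qed
    show "w \<in> S" if W: "\<And>n. W n \<in> S" and E: "E \<longlonglongrightarrow> 0" and n: "\<And>n t. \<bar>W n t - w t\<bar> \<le> E n * M t" for W w E
    proof -
      have "continuous_on UNIV w"
        by (rule weighted_limit_continuous[OF _ Mc E n]) (use W in \<open>auto simp: S_def\<close>)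
      moreover obtain C where "\<And>t. \<bar>W 0 t\<bar> \<le> C * M t" using W[of 0] by (auto simp: S_def)
      then have "\<bar>w t\<bar> \<le> (C + E 0) * M t" for t using n[of 0 t] by (smt (verit) distrib_right)
      ultimately show ?thesis by (auto simp: S_def)
    qed
  qed (use Mpos PhiS diff_bd q in auto)
  then obtain w where w: "w \<in> S" "Phi w = w" by blast
  from w obtain C where C: "\<And>t. \<bar>w t\<bar> \<le> C * M t" by (auto simp: S_def)
  have C0: "C \<ge> 0" using C[of 0] Mpos[of 0] by (metis abs_ge_zero order_trans zero_le_mult_iff not_less)
  have "\<bar>w t\<bar> \<le> (2 * C) * exp (\<nu> * t)" if "t \<le> T" for t
  proof -
    have "\<nu> * T + \<Gamma> * (t - T) \<le> \<nu> * T + \<nu> * (t - T)"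
      using \<Gamma> that by (intro add_left_mono mult_right_mono_neg) auto
    then have "M t \<le> 2 * exp (\<nu> * t)" by (simp add: M_def exp_add[symmetric] algebra_simps)
    then show ?thesis using C[of t] mult_left_mono[of "M t" "2 * exp (\<nu> * t)" C] C0 by simp
  qed
  moreover have "\<forall>t. (w has_real_derivative (- w t + (b t * w (t - h) + f t))) (at t)"
    using Phi_der[OF w(1)] w(2) by simp
  ultimately show ?thesis by blast
qed

text \<open>Uniform asymptotic stability of the equations with coefficient close to
  \<open>bK\<close>, in a finite form: over \<open>n\<close> delays a solution stays controlled, and
  on the last delay interval, the history for the next window, the initial bound is halved up to the
  forcing. It is quantified over all \<open>b\<close>, \<open>f\<close> and starting times because
  the coefficient along the front depends on time. \<open>N\<close> is positive since the derivation
  normalizes by it.\<close>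

definition delay_window :: "real \<Rightarrow> real \<Rightarrow> real \<Rightarrow> nat \<Rightarrow> real \<Rightarrow> bool" where
  "delay_window h bK \<eta> n C \<longleftrightarrow> (\<forall>w b f a N D.
     (\<forall>t. (w has_real_derivative (- w t + (b t * w (t - h) + f t))) (at t)) \<longrightarrow>
     (\<forall>t\<ge>a. \<bar>b t - bK\<bar> \<le> \<eta> \<and> \<bar>f t\<bar> \<le> D) \<longrightarrow> (\<forall>t\<in>{a-h..a}. \<bar>w t\<bar> \<le> N) \<longrightarrow> N > 0 \<longrightarrow> D \<ge> 0 \<longrightarrow>
     (\<forall>t\<in>{a..a + real n * h}. \<bar>w t\<bar> \<le> C * (N + D)) \<and>
     (\<forall>t\<in>{a + real n * h - h..a + real n * h}. \<bar>w t\<bar> \<le> N / 2 + C * D))"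

text \<open>On a time window of fixed length the linear equation is compared with the solution of the
  nonlinear equation started at \<open>K\<close> plus a small multiple of the data; this transfers
  exponential stability from the nonlinear equation to the linearization.\<close>
lemma delay_window_from_exp_stable:
  fixes g G :: "real \<Rightarrow> real"
  assumes stab: "exp_stable g h K" and h: "h > 0" and K: "K > 0"
    and gG: "\<And>x. x \<ge> 0 \<Longrightarrow> g x = G x" and G0: "\<And>x. x \<ge> 0 \<Longrightarrow> G x \<ge> 0"
    and Gc: "continuous_on UNIV G" and GK: "G K = K" and dG: "(G has_real_derivative bK) (at K)"
  shows "\<exists>\<eta>>0. \<exists>n\<ge>1. \<exists>C\<ge>0. delay_window h bK \<eta> n C"
proof -
  from stab obtain \<delta> C0 \<gamma> where \<delta>: "\<delta> > 0" and C0: "C0 > 0" and \<gamma>: "\<gamma> > 0"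
    and st: "\<And>u r t. dde_sol g h u \<Longrightarrow> r \<le> \<delta> \<Longrightarrow> (\<forall>s\<in>{-h..0}. u s \<ge> 0 \<and> \<bar>u s - K\<bar> \<le> r) \<Longrightarrow> t \<ge> 0 \<Longrightarrow>
      \<bar>u t - K\<bar> \<le> C0 * exp (- \<gamma> * t) * r" unfolding exp_stable_def by metis
  have "((\<lambda>m. C0 * exp (- \<gamma> * h) ^ m) \<longlonglongrightarrow> 0)"
    using \<gamma> h by (intro tendsto_mult_right_zero LIMSEQ_power_zero) auto
  \<comment> \<open>After \<open>m\<close> delays the nonlinear decay factor is below 1/4; the
    comparison error will add at most another quarter of the data, apart from the forcing. One more
    delay, n = m + 1, makes the whole last interval lie beyond \<open>m * h\<close>.\<close>
  then obtain m where m: "C0 * exp (- \<gamma> * h) ^ m < 1 / 4"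
    using order_tendstoD(2)[of _ 0 sequentially "1/4"] by (force simp: eventually_sequentially)
  define n where "n = Suc m"
  define Bq where "Bq = \<bar>bK\<bar> + 1"
  define C1 where "C1 = max C0 1"
  define P where "P = (1 + Bq) ^ n"
  \<comment> \<open>\<open>P\<close> bounds the growth over \<open>n\<close> delays of the error
    committed in the comparison; \<eta> is small enough that its share of this error, 2 \<eta> C1 P,
    is at most 1/4.\<close>
  define \<eta> where "\<eta> = min 1 (1 / (8 * C1 * P))"
  have Bq: "Bq \<ge> 1" by (simp add: Bq_def)
  have C1: "C1 \<ge> 1" "C1 \<ge> C0" by (auto simp: C1_def)
  have P: "P \<ge> 1" unfolding P_def using Bq by (intro one_le_power) auto
  have \<eta>: "\<eta> > 0" "\<eta> \<le> 1" using C1 P by (auto simp: \<eta>_def)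
  have "\<eta> \<le> 1 / (8 * C1 * P)" by (simp add: \<eta>_def)
  then have \<eta>P: "2 * \<eta> * C1 * P \<le> 1 / 4" using C1 P by (simp add: field_simps)
  from dG have "((\<lambda>x. (G (K + x) - G K) / x) \<longlongrightarrow> bK) (at 0)" by (simp add: DERIV_def)
  from tendstoD[OF this \<eta>(1)] obtain \<rho> where \<rho>: "\<rho> > 0"
    and \<rho>': "\<And>x. x \<noteq> 0 \<Longrightarrow> \<bar>x\<bar> < \<rho> \<Longrightarrow> \<bar>(G (K + x) - G K) / x - bK\<bar> < \<eta>"
    by (auto simp: eventually_at dist_real_def)
  have lin: "\<bar>G (K + x) - K - bK * x\<bar> \<le> \<eta> * \<bar>x\<bar>" if "\<bar>x\<bar> < \<rho>" for x
  proof (cases "x = 0")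
    case False
    then have "G (K + x) - K - bK * x = ((G (K + x) - G K) / x - bK) * x" by (simp add: GK field_simps)
    then show ?thesis using \<rho>'[OF False that] by (auto simp: abs_mult intro!: mult_right_mono)
  qed (simp add: GK)
  \<comment> \<open>The three bounds keep the initial data in the stability range, keep them
    nonnegative (at least K / 2), and keep the whole solution, which stays within C1 r of
    \<open>K\<close>, in the region where \<open>G\<close> is linear up to \<eta>.\<close>
  define r where "r = Min {\<delta>, K / 2, \<rho> / (2 * C1)}"
  have r: "r > 0" "r \<le> \<delta>" "r \<le> K / 2" "r \<le> \<rho> / (2 * C1)" using \<delta> K \<rho> C1 by (auto simp: r_def)
  have r\<rho>: "C1 * r < \<rho>"
  proof -
    have "C1 * r \<le> C1 * (\<rho> / (2 * C1))" using r C1 by (intro mult_left_mono) auto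
    also have "\<dots> = \<rho> / 2" using C1 by simp
    finally show ?thesis using \<rho> by simp
  qed
  define C where "C = C1 + 1 + P"
  have "delay_window h bK \<eta> n C"
    unfolding delay_window_def
  proof (intro allI impI)
    fix w b f :: "real \<Rightarrow> real" and a N D :: real
    assume w: "\<forall>t. (w has_real_derivative (- w t + (b t * w (t - h) + f t))) (at t)"
      and bf: "\<forall>t\<ge>a. \<bar>b t - bK\<bar> \<le> \<eta> \<and> \<bar>f t\<bar> \<le> D" and wN: "\<forall>t\<in>{a-h..a}. \<bar>w t\<bar> \<le> N" and N: "N > 0" and D: "D \<ge> 0"
    have wc: "continuous_on UNIV w" using w DERIV_isCont by (auto simp: continuous_on_eq_continuous_at)
    define phi where "phi s = K + r * w (a + max (- h) (min s 0)) / N" for s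
    have phic: "continuous_on UNIV phi" unfolding phi_def
      by (intro continuous_intros continuous_on_compose2[OF wc]) (use N in auto)
    \<comment> \<open>The truncation at 0 makes the delayed term nonnegative whatever the sign of
      \<open>u\<close>, which yields \<open>u \<ge> 0\<close>; after that it can be removed, and
      \<open>u\<close> is a solution of the original equation.\<close>
    have Fc: "continuous_on UNIV (\<lambda>x. G (max x 0))"
      by (intro continuous_on_compose2[OF Gc] continuous_intros) auto
    from delay_equation_exists[OF h Fc phic] obtain u where uc: "continuous_on UNIV u"
      and u0: "\<And>t. t \<le> 0 \<Longrightarrow> u t = phi t"
      and u: "\<And>t. t \<ge> 0 \<Longrightarrow> (u has_real_derivative (- u t + G (max (u (t - h)) 0))) (at t within {0..})" by blast
    have init: "u s = K + r * w (a + s) / N" if "s \<in> {-h..0}" for s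
      using that u0[of s] by (simp add: phi_def max_absorb2)
    have initb: "\<bar>u s - K\<bar> \<le> r" if "s \<in> {-h..0}" for s
    proof -
      have "\<bar>w (a + s)\<bar> \<le> N" using that by (intro bspec[OF wN]) auto
      then have "r * (\<bar>w (a + s)\<bar> / N) \<le> r * 1" using N r by (intro mult_left_mono) auto
      then show ?thesis using init[OF that] N r by (simp add: abs_mult)
    qed
    have init0: "u s \<ge> 0" if "s \<in> {-h..0}" for s using initb[OF that] r K by (auto simp: abs_le_iff)
    have u_nonneg: "u t \<ge> 0" if "t \<ge> - h" for t
    proof (cases "t \<ge> 0")
      case True
      have "- u t \<le> 0 + 0"
      proof (rule upper_bound_forward[where d="\<lambda>t. - u t" and r="\<lambda>t. - G (max (u (t - h)) 0)" and a=0 and b=t])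
        show "((\<lambda>t. - u t) has_real_derivative - (- u s) + - G (max (u (s - h)) 0)) (at s within {0..})" if "0 \<le> s" "s \<le> t" for s
          by (auto intro!: derivative_eq_intros u[OF that(1)])
      qed (use True init0[of 0] h G0 in auto)
      then show ?thesis by simp
    qed (use init0 that in auto)
    have u_der: "(u has_real_derivative (- u t + G (u (t - h)))) (at t within {0..})" if "t \<ge> 0" for t
      using u[OF that] u_nonneg[of "t - h"] that by simp
    have "dde_sol g h u" unfolding dde_sol_def
      using u_der u_nonneg gG by (auto intro: continuous_on_subset[OF uc])
    from st[OF this r(2)] init0 initb have ust: "\<bar>u t - K\<bar> \<le> C0 * exp (- \<gamma> * t) * r" if "t \<ge> 0" for t using that by blast
    define v where "v t = (u t - K) / r" for t
    have v1: "\<bar>v t\<bar> \<le> C0 * exp (- \<gamma> * t)" if "t \<ge> 0" for t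
      using ust[OF that] r by (simp add: v_def field_simps)
    have vC: "\<bar>v t\<bar> \<le> C1" if "t \<ge> - h" for t
    proof (cases "t \<ge> 0")
      case True
      have "C0 * exp (- \<gamma> * t) \<le> C0 * 1" using True \<gamma> C0 by (intro mult_left_mono) auto
      then show ?thesis using v1[OF True] C1 by simp
    next
      case False
      then have "\<bar>v t\<bar> \<le> 1" using initb[of t] that r by (simp add: v_def)
      then show ?thesis using C1 by simp
    qed
    \<comment> \<open>The difference between the normalized linear solution and the normalized
      deviation of the nonlinear one from \<open>K\<close>. It has zero initial history, and its
      forcing \<open>rr\<close> is at most Bq |d(t - h)| + E, so its bound grows by a factor 1 + Bq
      per delay.\<close>
    define d where "d t = w (a + t) / N - v t" for t
    define rr where "rr t = b (a + t) * w (a + t - h) / N + f (a + t) / N - (G (u (t - h)) - K) / r" for t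
    have d_der: "(d has_real_derivative (- d t + rr t)) (at t within {0..})" if "t \<ge> 0" for t
    proof -
      have "((\<lambda>t. w (a + t)) has_real_derivative (- w (a + t) + (b (a + t) * w (a + t - h) + f (a + t))) * 1) (at t)"
        by (rule DERIV_chain2[where g = "\<lambda>t. a + t"]) (use w in \<open>auto intro!: derivative_eq_intros\<close>)
      note w' = has_field_derivative_at_within[OF this]
      have "(v has_real_derivative ((- u t + G (u (t - h))) - 0) / r) (at t within {0..})"
        unfolding v_def by (intro DERIV_cdivide DERIV_diff u_der that DERIV_const)
      from DERIV_diff[OF DERIV_cdivide[OF w', of N] this] show ?thesis unfolding d_def[abs_def] v_def rr_def
        by (rule DERIV_cong) (simp add: diff_divide_distrib add_divide_distrib)
    qed
    define E where "E = 2 * \<eta> * C1 + D / N"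
    have E0: "E \<ge> 0" using \<eta> C1 N D by (simp add: E_def)
    have rr: "\<bar>rr t\<bar> \<le> Bq * \<bar>d (t - h)\<bar> + E" if t: "t \<ge> 0" for t
    proof -
      have v: "\<bar>v (t - h)\<bar> \<le> C1" using vC[of "t - h"] t by simp
      have uv: "u (t - h) = K + r * v (t - h)" using r by (simp add: v_def)
      have "\<bar>r * v (t - h)\<bar> \<le> r * C1" using v r by (simp add: abs_mult)
      then have "\<bar>G (K + r * v (t - h)) - K - bK * (r * v (t - h))\<bar> \<le> \<eta> * \<bar>r * v (t - h)\<bar>"
        using r\<rho> by (intro lin) (simp add: mult.commute)
      also have "\<dots> \<le> \<eta> * (r * C1)" using \<open>\<bar>r * v (t - h)\<bar> \<le> r * C1\<close> \<eta> by (intro mult_left_mono) auto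
      finally have "\<bar>(G (u (t - h)) - K - bK * (r * v (t - h))) / r\<bar> \<le> \<eta> * C1" using r uv
        by (simp add: field_simps)
      then have om: "\<bar>(G (u (t - h)) - K) / r - bK * v (t - h)\<bar> \<le> \<eta> * C1" using r by (simp add: diff_divide_distrib)
      have wd: "w (a + t - h) / N = d (t - h) + v (t - h)" by (simp add: d_def add_diff_eq)
      have "rr t = b (a + t) * (w (a + t - h) / N) + f (a + t) / N - (G (u (t - h)) - K) / r" by (simp add: rr_def)
      also have "\<dots> = b (a + t) * d (t - h) + (b (a + t) - bK) * v (t - h) + f (a + t) / N - ((G (u (t - h)) - K) / r - bK * v (t - h))"
        unfolding wd by (simp add: algebra_simps)
      finally have eq: "rr t = \<dots>" .
      have bb: "\<bar>b (a + t) - bK\<bar> \<le> \<eta>" "\<bar>f (a + t)\<bar> \<le> D" using bf t by auto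
      have "\<bar>b (a + t) * d (t - h)\<bar> \<le> Bq * \<bar>d (t - h)\<bar>"
        unfolding abs_mult using bb \<eta> by (intro mult_right_mono) (auto simp: Bq_def)
      moreover have "\<bar>(b (a + t) - bK) * v (t - h)\<bar> \<le> \<eta> * C1"
        unfolding abs_mult using bb \<eta> v by (intro mult_mono) auto
      moreover have "\<bar>f (a + t) / N\<bar> \<le> D / N" using bb N by (simp add: divide_right_mono)
      ultimately show ?thesis using om unfolding eq E_def by linarith
    qed
    have d0: "d t = 0" if "t \<in> {-h..0}" for t using init[OF that] r by (simp add: d_def v_def)
    have dE: "\<forall>t\<in>{-h..real k * h}. \<bar>d t\<bar> \<le> E * (1 + Bq) ^ k" for k
    proof (induction k)
      case 0 then show ?case using d0 E0 by auto
    next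
      case (Suc k)
      have p1: "(1 + Bq) ^ k \<ge> 1" using Bq by (intro one_le_power) auto
      show ?case
      proof
        fix t assume t: "t \<in> {-h..real (Suc k) * h}"
        show "\<bar>d t\<bar> \<le> E * (1 + Bq) ^ Suc k"
        proof (cases "t \<ge> 0")
          case True
          have "\<bar>d t\<bar> \<le> 0 + (Bq * (E * (1 + Bq) ^ k) + E)"
          proof (rule bound_forward[where d=d and r=rr and a=0 and b=t])
            fix s assume s: "0 \<le> s" "s \<le> t"
            then have "\<bar>d (s - h)\<bar> \<le> E * (1 + Bq) ^ k" using t by (intro bspec[OF Suc]) (auto simp: algebra_simps)
            then have "Bq * \<bar>d (s - h)\<bar> \<le> Bq * (E * (1 + Bq) ^ k)" using Bq by (intro mult_left_mono) auto
            then show "\<bar>rr s\<bar> \<le> Bq * (E * (1 + Bq) ^ k) + E" using rr[OF s(1)] by simp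
          qed (use d_der True d0[of 0] h Bq E0 in auto)
          also have "\<dots> \<le> Bq * (E * (1 + Bq) ^ k) + E * (1 + Bq) ^ k"
            using mult_left_mono[OF p1 E0] by simp
          also have "\<dots> = E * (1 + Bq) ^ Suc k" by (simp add: algebra_simps)
          finally show ?thesis .
        next
          case False
          then show ?thesis using d0[of t] t E0 Bq by simp
        qed
      qed
    qed
    have EP: "E * P \<le> 1 / 4 + D * P / N"
    proof -
      have "E * P = 2 * \<eta> * C1 * P + D * P / N" by (simp add: E_def algebra_simps)
      then show ?thesis using \<eta>P by simp
    qed
    have wv: "\<bar>w (a + t)\<bar> \<le> N * c + N / 4 + P * D" if t: "t \<in> {0..real n * h}" and c: "\<bar>v t\<bar> \<le> c" for t c
    proof -
      have "\<bar>d t\<bar> \<le> E * P" using dE[of n] t h unfolding P_def by auto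
      then have "\<bar>d t\<bar> \<le> 1 / 4 + D * P / N" using EP by simp
      have "w (a + t) = N * (v t + d t)" using N by (simp add: d_def)
      then have "\<bar>w (a + t)\<bar> = N * \<bar>v t + d t\<bar>" using N by (simp add: abs_mult)
      also have "\<dots> \<le> N * (c + (1 / 4 + D * P / N))" using c \<open>\<bar>d t\<bar> \<le> 1 / 4 + D * P / N\<close> N by (intro mult_left_mono) auto
      also have "\<dots> = N * c + N / 4 + P * D" using N by (simp add: field_simps)
      finally show ?thesis .
    qed
    have PD: "P * D \<le> C * D" using D C1 by (intro mult_right_mono) (auto simp: C_def)
    show "(\<forall>t\<in>{a..a + real n * h}. \<bar>w t\<bar> \<le> C * (N + D)) \<and>
        (\<forall>t\<in>{a + real n * h - h..a + real n * h}. \<bar>w t\<bar> \<le> N / 2 + C * D)"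
    proof (intro conjI ballI)
      fix t assume t: "t \<in> {a..a + real n * h}"
      have "\<bar>w (a + (t - a))\<bar> \<le> N * C1 + N / 4 + P * D"
        using t h by (intro wv vC) auto
      also have "\<dots> \<le> N * C + C * D"
      proof -
        have "N * C = N * C1 + N + N * P" by (simp add: C_def algebra_simps)
        moreover have "N * P \<ge> 0" using N P by simp
        ultimately show ?thesis using PD N by linarith
      qed
      finally show "\<bar>w t\<bar> \<le> C * (N + D)" by (simp add: algebra_simps)
    next
      fix t assume t: "t \<in> {a + real n * h - h..a + real n * h}"
      have tm: "t - a \<ge> real m * h" using t by (simp add: n_def algebra_simps)
      moreover have "real m * h \<ge> 0" using h by simp
      ultimately have ta: "t - a \<ge> 0" by linarith
      have "C0 * exp (- \<gamma> * (t - a)) \<le> C0 * exp (- \<gamma> * (real m * h))"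
        using tm \<gamma> C0 by (intro mult_left_mono) (auto intro!: mult_left_mono)
      also have "\<dots> = C0 * exp (- \<gamma> * h) ^ m" by (simp add: exp_of_nat_mult[symmetric] mult_ac)
      finally have "\<bar>v (t - a)\<bar> \<le> 1 / 4" using m v1[OF ta] by linarith
      then have "\<bar>w (a + (t - a))\<bar> \<le> N * (1/4) + N / 4 + P * D"
        using t ta by (intro wv) auto
      then show "\<bar>w t\<bar> \<le> N / 2 + C * D" using PD by simp
    qed
  qed
  moreover have "n \<ge> 1" "C \<ge> 0" using C1 P by (auto simp: n_def C_def)
  ultimately show ?thesis using \<eta> by blast
qed

lemma delay_windowD:
  assumes "delay_window h bK \<eta> n C"
    and "\<And>t. (w has_real_derivative (- w t + (b t * w (t - h) + f t))) (at t)"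
    and "\<And>t. t \<ge> a \<Longrightarrow> \<bar>b t - bK\<bar> \<le> \<eta>" "\<And>t. t \<ge> a \<Longrightarrow> \<bar>f t\<bar> \<le> D"
    and "\<And>t. t \<in> {a-h..a} \<Longrightarrow> \<bar>w t\<bar> \<le> N" and "N > 0" "D \<ge> 0"
  shows "\<And>t. t \<in> {a..a + real n * h} \<Longrightarrow> \<bar>w t\<bar> \<le> C * (N + D)"
    and "\<And>t. t \<in> {a + real n * h - h..a + real n * h} \<Longrightarrow> \<bar>w t\<bar> \<le> N / 2 + C * D"
  using assms unfolding delay_window_def by metis+

text \<open>Windows are concatenated: the recursion N \<mapsto> N / 2 + C D has the fixed point 2 C
  D, and \<open>N j\<close> is its explicit solution started at N0 + 2 C D, slightly more than the
  given bound, which keeps the formula simple.\<close>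

lemma delay_window_chain:
  assumes W: "delay_window h bK \<eta> n C" and n: "n \<ge> 1" and h: "h > 0" and C: "C \<ge> 0"
    and w: "\<And>t. (w has_real_derivative (- w t + (b t * w (t - h) + f t))) (at t)"
    and b: "\<And>t. t \<ge> a \<Longrightarrow> \<bar>b t - bK\<bar> \<le> \<eta>" and f: "\<And>t. t \<ge> a \<Longrightarrow> \<bar>f t\<bar> \<le> D"
    and wN: "\<And>t. t \<in> {a-h..a} \<Longrightarrow> \<bar>w t\<bar> \<le> N0"
    and N0: "N0 > 0" and D: "D > 0"
  defines "N \<equiv> \<lambda>j::nat. N0 / 2 ^ j + 2 * C * D"
  shows "t \<ge> a + real j * (real n * h) \<Longrightarrow> \<bar>w t\<bar> \<le> C * (N j + D)"
proof -
  have Npos: "N j > 0" for j unfolding N_def using N0 C D by (intro add_pos_nonneg) auto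
  have init: "\<forall>t\<in>{a + real j * (real n * h) - h..a + real j * (real n * h)}. \<bar>w t\<bar> \<le> N j" for j
  proof (induction j)
    case 0
    have "2 * C * D \<ge> 0" using C D by simp
    then show ?case using wN by (fastforce simp: N_def)
  next
    case (Suc j)
    have "\<bar>w t\<bar> \<le> N j / 2 + C * D" if "t \<in> {(a + real j * (real n * h)) + real n * h - h..(a + real j * (real n * h)) + real n * h}" for t
    proof (rule delay_windowD(2)[OF W w _ _ _ Npos less_imp_le[OF D] that])
      fix t assume "a + real j * (real n * h) \<le> t"
      then have "a \<le> t" using h by (smt (verit) mult_nonneg_nonneg of_nat_0_le_iff)
      then show "\<bar>b t - bK\<bar> \<le> \<eta>" "\<bar>f t\<bar> \<le> D" using b f by auto
    qed (use Suc in auto)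
    moreover have "N j / 2 + C * D = N (Suc j)" by (simp add: N_def)
    moreover have "(a + real j * (real n * h)) + real n * h = a + real (Suc j) * (real n * h)" by (simp add: algebra_simps)
    ultimately show ?case by simp
  qed
  have block: "\<bar>w t\<bar> \<le> C * (N j + D)" if "t \<in> {a + real j * (real n * h)..a + real j * (real n * h) + real n * h}" for j t
  proof (rule delay_windowD(1)[OF W w _ _ _ Npos less_imp_le[OF D] that])
    fix t assume "a + real j * (real n * h) \<le> t"
    then have "a \<le> t" using h by (smt (verit) mult_nonneg_nonneg of_nat_0_le_iff)
    then show "\<bar>b t - bK\<bar> \<le> \<eta>" "\<bar>f t\<bar> \<le> D" using b f by auto
  qed (use init in auto)
  have Nmono: "N i \<le> N j" if "j \<le> i" for i j
  proof -
    have "(2::real) ^ j \<le> 2 ^ i" using that by (intro power_increasing) auto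
    then show ?thesis unfolding N_def using N0 by (intro add_right_mono divide_left_mono) auto
  qed
  show "\<bar>w t\<bar> \<le> C * (N j + D)" if t: "t \<ge> a + real j * (real n * h)"
  proof -
    have nh: "real n * h > 0" using n h by simp
    define i where "i = nat \<lfloor>(t - a) / (real n * h)\<rfloor>"
    have "real j * (real n * h) \<le> t - a" using t by simp
    then have j: "real j \<le> (t - a) / (real n * h)" using nh by (simp add: pos_le_divide_eq)
    then have "j \<le> i" unfolding i_def by linarith
    have "(t - a) / (real n * h) \<ge> 0" using j by (meson of_nat_0_le_iff order_trans)
    then have "real i \<le> (t - a) / (real n * h)" "(t - a) / (real n * h) \<le> real i + 1" unfolding i_def by linarith+
    then have "real i * (real n * h) \<le> t - a" "t - a \<le> (real i + 1) * (real n * h)"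
      using nh by (simp_all only: pos_le_divide_eq pos_divide_le_eq)
    then have "t \<in> {a + real i * (real n * h)..a + real i * (real n * h) + real n * h}" by (simp add: distrib_right)
    then have "\<bar>w t\<bar> \<le> C * (N i + D)" using block by blast
    also have "\<dots> \<le> C * (N j + D)" using Nmono[OF \<open>j \<le> i\<close>] C by (intro mult_left_mono) auto
    finally show ?thesis .
  qed
qed


text \<open>The line splits into three zones. Up to \<open>T\<close> the exponential weight is
  contractive and the bound improves itself; on the bounded stretch up to \<open>t0\<close> finitely
  many delay steps each cost a factor; from there on \<open>delay_window\<close> applies. The
  constant is independent of \<open>w\<close>, \<open>f\<close>, \<open>D\<close> and
  \<open>C'\<close>. The constant \<open>C'\<close> only states that \<open>w\<close> decays at the
  right rate at minus infinity, and forgetting it is the purpose: the estimate then contains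
  uniqueness.\<close>

lemma linear_delay_apriori:
  fixes b :: "real \<Rightarrow> real"
  assumes W: "delay_window h bK \<eta> n C" and n: "n \<ge> 1" and C: "C \<ge> 0"
    and B: "\<And>t. \<bar>b t\<bar> \<le> B" and pb: "\<And>t. t \<le> T \<Longrightarrow> \<bar>b t\<bar> \<le> pb"
    and q: "pb * exp (- \<nu> * h) < 1 + \<nu>" and pos: "\<nu> > 0" "h > 0"
    and bK: "\<And>t. t \<ge> t0 \<Longrightarrow> \<bar>b t - bK\<bar> \<le> \<eta>"
  shows "\<exists>C1\<ge>0. \<forall>w f D C'. (\<forall>t. (w has_real_derivative (- w t + (b t * w (t - h) + f t))) (at t)) \<longrightarrow>
    (\<forall>t\<le>T. \<bar>w t\<bar> \<le> C' * exp (\<nu> * t)) \<longrightarrow> (\<forall>t. \<bar>f t\<bar> \<le> D * min (exp (\<nu> * t)) 1) \<longrightarrow>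
    (\<forall>t. \<bar>w t\<bar> \<le> C1 * D * min (exp (\<nu> * t)) 1)"
proof -
  have pb0: "pb \<ge> 0" and B0: "B \<ge> 0" using pb[of T] B[of 0] by auto
  define q0 where "q0 = pb * exp (- \<nu> * h) / (1 + \<nu>)"
  have q0: "0 \<le> q0" "q0 < 1" using pb0 pos q by (auto simp: q0_def)
  define c1 where "c1 = 1 / (1 + \<nu>) / (1 - q0)"
  have c1: "c1 \<ge> 0" using q0 pos by (simp add: c1_def)
  define c where "c = max (c1 * exp (\<nu> * T)) 1"
  \<comment> \<open>\<open>m\<close> is a number of delay steps that leads from \<open>T\<close> to
    \<open>t0\<close> or beyond; one step turns a bound \<open>N\<close> into N + (B N + D), which
    is at most (2 + B) N as soon as D \<le> N.\<close>
  obtain m :: nat where "t0 - T < real m * h"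
    using reals_Archimedean3[OF pos(2), rule_format, of "t0 - T"] by blast
  then have m: "T + real m * h \<ge> t0" by simp
  define c2 where "c2 = c * (2 + B) ^ m"
  have c0: "c \<ge> 1" by (simp add: c_def)
  have c2: "c2 \<ge> 1" unfolding c2_def using c0 B0
    by (metis add_increasing2 le_add_same_cancel2 mult_ge1_I one_le_numeral one_le_power)
  define c3 where "c3 = C * (c2 + 2 * C + 1) + c2"
  have c3: "c3 \<ge> 0" unfolding c3_def using C c2 by (intro add_nonneg_nonneg mult_nonneg_nonneg) auto
  \<comment> \<open>For t > T the weight is at least its value at \<open>T\<close>, so a plain bound
    becomes a weighted one after division by that value.\<close>
  define c4 where "c4 = c3 / min (exp (\<nu> * T)) 1"
  have mT: "min (exp (\<nu> * T)) 1 > 0" by simp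
  have c4: "c4 \<ge> 0" unfolding c4_def using c3 mT by (intro divide_nonneg_pos) auto
  define C1 where "C1 = c1 * exp (\<nu> * \<bar>T\<bar>) + c4"
  have C1: "C1 \<ge> 0" using c1 c4 by (simp add: C1_def)
  have main: "\<bar>w t\<bar> \<le> C1 * D * min (exp (\<nu> * t)) 1"
    if w: "\<And>t. (w has_real_derivative (- w t + (b t * w (t - h) + f t))) (at t)"
    and wT: "\<And>t. t \<le> T \<Longrightarrow> \<bar>w t\<bar> \<le> C' * exp (\<nu> * t)"
    and f: "\<And>t. \<bar>f t\<bar> \<le> D * min (exp (\<nu> * t)) 1" and D: "D > 0" for w f D C' t
  proof -
    have fD: "\<bar>f t\<bar> \<le> D" for t using f[of t] D by (metis mult_left_mono less_imp_le min.cobounded2 mult_cancel_left1 order_trans)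
    have left: "\<bar>w t\<bar> \<le> (D / (1 + \<nu>)) / (1 - q0) * exp (\<nu> * t)" if "t \<in> {..T}" for t
    proof (rule self_improving_bound[where S = "{..T}" and ?D0.0 = C', OF _ _ q0 that])
      show "\<bar>w x\<bar> \<le> C' * exp (\<nu> * x)" if "x \<in> {..T}" for x using wT that by auto
      fix D' x assume D': "\<And>x. x \<in> {..T} \<Longrightarrow> \<bar>w x\<bar> \<le> D' * exp (\<nu> * x)" and x: "x \<in> {..T}"
      have D'0: "D' \<ge> 0" using D'[of T] by (metis abs_ge_zero atMost_iff exp_gt_zero order_refl order_trans zero_le_mult_iff not_less)
      have "\<bar>w x\<bar> \<le> (pb * exp (- \<nu> * h) * D' + D) / (1 + \<nu>) * exp (\<nu> * x) + 0 / (1 + 0) * exp (0 * x)"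
      proof (rule bound_from_minus_infinity[where T = T and B = "D' * exp (\<nu> * T)", OF w])
        fix t assume t: "t \<le> T"
        have "\<bar>b t * w (t - h)\<bar> \<le> pb * (D' * exp (\<nu> * (t - h)))"
          unfolding abs_mult using pb[OF t] D'[of "t - h"] t pos pb0 by (intro mult_mono) auto
        also have "\<dots> = pb * exp (- \<nu> * h) * D' * exp (\<nu> * t)"
          by (simp add: right_diff_distrib exp_diff exp_minus field_simps)
        finally have 1: "\<bar>b t * w (t - h)\<bar> \<le> pb * exp (- \<nu> * h) * D' * exp (\<nu> * t)" .
        have "D * min (exp (\<nu> * t)) 1 \<le> D * exp (\<nu> * t)" using D by (intro mult_left_mono) auto
        with 1 f[of t] show "\<bar>b t * w (t - h) + f t\<bar> \<le> (pb * exp (- \<nu> * h) * D' + D) * exp (\<nu> * t) + 0 * exp (0 * t)"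
          by (simp add: distrib_right)
        have "D' * exp (\<nu> * t) \<le> D' * exp (\<nu> * T)" using t pos D'0 by (intro mult_left_mono) auto
        then show "\<bar>w t\<bar> \<le> D' * exp (\<nu> * T)" using D'[of t] t by simp
      qed (use pos x in auto)
      also have "(pb * exp (- \<nu> * h) * D' + D) / (1 + \<nu>) = q0 * D' + D / (1 + \<nu>)"
        by (simp add: q0_def add_divide_distrib)
      finally show "\<bar>w x\<bar> \<le> (q0 * D' + D / (1 + \<nu>)) * exp (\<nu> * x)" by simp
    qed
    have left': "\<bar>w t\<bar> \<le> c1 * D * exp (\<nu> * t)" if "t \<le> T" for t using left[of t] that by (simp add: c1_def mult_ac)
    have mid: "\<forall>t \<le> T + real k * h. \<bar>w t\<bar> \<le> c * (2 + B) ^ k * D" for k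
    proof (induction k)
      case 0
      have "\<bar>w t\<bar> \<le> c * D" if "t \<le> T" for t
      proof -
        have "\<bar>w t\<bar> \<le> c1 * D * exp (\<nu> * T)"
          using left'[OF that] that pos c1 D by (elim order_trans) (auto intro!: mult_left_mono)
        also have "\<dots> = c1 * exp (\<nu> * T) * D" by simp
        also have "\<dots> \<le> c * D" using D by (intro mult_right_mono) (auto simp: c_def)
        finally show ?thesis .
      qed
      then show ?case by simp
    next
      case (Suc k)
      define N where "N = c * (2 + B) ^ k * D"
      have ge1: "(2 + B) ^ k \<ge> 1" using B0 by (intro one_le_power) auto
      have "1 * 1 \<le> c * (2 + B) ^ k" using c0 ge1 by (intro mult_mono) auto
      then have DN: "D \<le> N" using mult_right_mono[of 1 "c * (2 + B) ^ k" D] D by (simp add: N_def)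
      show ?case
      proof (intro allI impI)
        fix t assume t: "t \<le> T + real (Suc k) * h"
        show "\<bar>w t\<bar> \<le> c * (2 + B) ^ Suc k * D"
        proof (cases "t \<le> T")
          case True
          then have "t \<le> T + real k * h" using pos by (simp add: add_increasing2)
          then have "\<bar>w t\<bar> \<le> N" using Suc by (simp add: N_def)
          also have "N \<le> (2 + B) * N" using DN D B0 by (simp add: mult_le_cancel_right1)
          finally show ?thesis by (simp add: N_def mult_ac)
        next
          case False
          have "\<bar>w t\<bar> \<le> N + (B * N + D)"
          proof (rule bound_forward[where d = w and a = T and b = t and r = "\<lambda>s. b s * w (s - h) + f s"])
            show "(w has_real_derivative - w s + (b s * w (s - h) + f s)) (at s within {T..})" for s
              by (rule has_field_derivative_at_within[OF w])
            fix s assume s: "T \<le> s" "s \<le> t"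
            then have "\<bar>w (s - h)\<bar> \<le> N" using t Suc by (simp add: N_def algebra_simps)
            then have "\<bar>b s * w (s - h)\<bar> \<le> B * N" unfolding abs_mult using B[of s] B0 by (intro mult_mono) auto
            then show "\<bar>b s * w (s - h) + f s\<bar> \<le> B * N + D" using fD[of s] by linarith
          next
            have "T \<le> T + real k * h" using pos by simp
            then show "\<bar>w T\<bar> \<le> N" using Suc by (simp add: N_def)
          qed (use False B0 D DN in auto)
          also have "\<dots> \<le> (2 + B) * N" using DN by (simp add: distrib_right)
          finally show ?thesis by (simp add: N_def mult_ac)
        qed
      qed
    qed
    let ?a = "T + real m * h"
    have right: "\<bar>w t\<bar> \<le> C * ((c2 * D) / 2 ^ 0 + 2 * C * D + D)" if "t \<ge> ?a" for t
    proof (rule delay_window_chain[OF W n pos(2) C w, where a = ?a and j = 0])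
      show "\<bar>w t\<bar> \<le> c2 * D" if "t \<in> {?a - h..?a}" for t using mid[of m] that by (simp add: c2_def)
      show "c2 * D > 0" using c2 D by simp
    qed (use bK m fD D that in auto)
    have all: "\<bar>w t\<bar> \<le> c3 * D" for t
    proof (cases "t \<ge> ?a")
      case True
      have "C * ((c2 * D) / 2 ^ 0 + 2 * C * D + D) = C * (c2 + 2 * C + 1) * D" by (simp add: algebra_simps)
      also have "\<dots> \<le> c3 * D" using D c2 by (intro mult_right_mono) (auto simp: c3_def)
      finally show ?thesis using right[OF True] by simp
    next
      case False
      then have "\<bar>w t\<bar> \<le> c2 * D" using mid[of m] by (simp add: c2_def)
      also have "\<dots> \<le> c3 * D" using D c2 C unfolding c3_def
        by (intro mult_right_mono) auto
      finally show ?thesis .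
    qed
    show ?thesis
    proof (cases "t \<le> T")
      case True
      have "exp (\<nu> * t) \<le> exp (\<nu> * \<bar>T\<bar>) * min (exp (\<nu> * t)) 1"
      proof (cases "exp (\<nu> * t) \<le> 1")
        case True
        have "1 * exp (\<nu> * t) \<le> exp (\<nu> * \<bar>T\<bar>) * exp (\<nu> * t)" using pos by (intro mult_right_mono) auto
        with True show ?thesis by simp
      next
        case False
        have "exp (\<nu> * t) \<le> exp (\<nu> * \<bar>T\<bar>)" using \<open>t \<le> T\<close> pos by (auto intro!: mult_left_mono)
        with False show ?thesis by simp
      qed
      then have "c1 * D * exp (\<nu> * t) \<le> c1 * D * (exp (\<nu> * \<bar>T\<bar>) * min (exp (\<nu> * t)) 1)"
        using c1 D by (intro mult_left_mono) auto
      also have "\<dots> = c1 * exp (\<nu> * \<bar>T\<bar>) * (D * min (exp (\<nu> * t)) 1)" by simp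
      also have "\<dots> \<le> C1 * (D * min (exp (\<nu> * t)) 1)"
        using c4 D by (intro mult_right_mono) (auto simp: C1_def)
      finally show ?thesis using left'[OF True] by (simp add: mult.assoc)
    next
      case False
      have "min (exp (\<nu> * T)) 1 \<le> min (exp (\<nu> * t)) 1"
        using False pos by (intro min.mono) (auto intro!: mult_left_mono)
      then have "c4 * min (exp (\<nu> * T)) 1 \<le> c4 * min (exp (\<nu> * t)) 1" using c4 by (rule mult_left_mono)
      moreover have "c4 * min (exp (\<nu> * T)) 1 = c3" 
      proof -
        have "x / k * k = x" if "k > 0" for x k :: real using that by simp
        from this[OF mT] show ?thesis by (simp only: c4_def)
      qed
      ultimately have "c3 * D \<le> c4 * min (exp (\<nu> * t)) 1 * D" using D by (intro mult_right_mono) auto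
      also have "\<dots> = c4 * (D * min (exp (\<nu> * t)) 1)" by simp
      also have "\<dots> \<le> C1 * (D * min (exp (\<nu> * t)) 1)"
        using c1 D by (intro mult_right_mono) (auto simp: C1_def)
      finally show ?thesis using all[of t] by (simp add: mult.assoc)
    qed
  qed
  show ?thesis
  proof (intro exI[of _ C1] conjI allI impI C1)
    fix w f :: "real \<Rightarrow> real" and D C' t :: real
    assume w: "\<forall>t. (w has_real_derivative (- w t + (b t * w (t - h) + f t))) (at t)"
      and wT: "\<forall>t\<le>T. \<bar>w t\<bar> \<le> C' * exp (\<nu> * t)" and f: "\<forall>t. \<bar>f t\<bar> \<le> D * min (exp (\<nu> * t)) 1"
    have "0 \<le> D * min (exp (\<nu> * 0)) 1" using f abs_ge_zero order_trans by blast
    then have D: "D \<ge> 0" by simp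
    \<comment> \<open>\<open>main\<close> requires a strictly positive forcing bound; the case D =
      0, which is uniqueness, is reached by letting \<open>e\<close> tend to 0.\<close>
    have "\<bar>w t\<bar> \<le> C1 * (D + e) * min (exp (\<nu> * t)) 1" if "e > 0" for e
    proof (rule main[where f = f])
      show "\<bar>f t\<bar> \<le> (D + e) * min (exp (\<nu> * t)) 1" for t
      proof -
        have "D * min (exp (\<nu> * t)) 1 \<le> (D + e) * min (exp (\<nu> * t)) 1"
          using that by (intro mult_right_mono) auto
        then show ?thesis using f[rule_format, of t] by linarith
      qed
    qed (use w wT D that in auto)
    then have "\<forall>\<^sub>F e in at_right 0. \<bar>w t\<bar> \<le> C1 * (D + e) * min (exp (\<nu> * t)) 1"
      by (intro eventually_mono[OF eventually_at_right_less]) auto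
    moreover have "((\<lambda>e. C1 * (D + e) * min (exp (\<nu> * t)) 1) \<longlongrightarrow> C1 * (D + 0) * min (exp (\<nu> * t)) 1) (at_right 0)"
      by (intro tendsto_intros)
    ultimately show "\<bar>w t\<bar> \<le> C1 * D * min (exp (\<nu> * t)) 1"
      by (intro tendsto_lowerbound[where F = "at_right (0::real)" and a = "\<bar>w t\<bar>"]) auto
  qed
qed

lemma linear_delay_tendsto_0:
  assumes W: "delay_window h bK \<eta> n C" and n: "n \<ge> 1" and h: "h > 0" and C: "C \<ge> 0"
    and w: "\<And>t. (w has_real_derivative (- w t + (b t * w (t - h) + f t))) (at t)"
    and bK: "\<And>t. t \<ge> t0 \<Longrightarrow> \<bar>b t - bK\<bar> \<le> \<eta>" and f: "(f \<longlongrightarrow> 0) at_top" and wB: "\<And>t. \<bar>w t\<bar> \<le> B"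
  shows "(w \<longlongrightarrow> 0) at_top"
proof (rule tendstoI)
  fix e :: real assume e: "e > 0"
  \<comment> \<open>The chain of windows, restarted where |f| < D, ends with C (D + 2 C D + D) = 2 C
    (C + 1) D; this \<open>D\<close> keeps that below \<open>e\<close>, and the added 1 covers C =
    0.\<close>
  define D where "D = e / (4 * (C * (C + 1) + 1))"
  have CC: "C * (C + 1) \<ge> 0" using C by simp
  have D: "D > 0" using e CC by (simp add: D_def add_nonneg_pos)
  from tendstoD[OF f D] obtain a0 where a0: "\<And>t. t \<ge> a0 \<Longrightarrow> \<bar>f t\<bar> < D" by (auto simp: eventually_at_top_linorder)
  define a where "a = max a0 t0"
  have B1: "B + 1 > 0" using wB[of 0] by simp
  have "(\<lambda>j. (B + 1) * (1 / 2) ^ j) \<longlonglongrightarrow> 0" by (intro tendsto_mult_right_zero LIMSEQ_power_zero) auto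
  then obtain j where j: "(B + 1) * (1 / 2) ^ j < D" using order_tendstoD(2)[OF _ D] by (force simp: eventually_sequentially)
  have "\<bar>w t\<bar> < e" if "t \<ge> a + real j * (real n * h)" for t
  proof -
    have "\<bar>w t\<bar> \<le> C * ((B + 1) / 2 ^ j + 2 * C * D + D)"
      by (rule delay_window_chain[OF W n h C w, where a = a])
        (use a0 bK wB D B1 that in \<open>auto simp: a_def less_imp_le intro: order_trans[OF wB]\<close>)
    also have "\<dots> \<le> C * (D + 2 * C * D + D)" using j C by (intro mult_left_mono) (auto simp: power_divide)
    also have "\<dots> = 2 * (C * (C + 1)) * D" by (simp add: algebra_simps)
    also have "\<dots> < 4 * (C * (C + 1) + 1) * D" using D CC by (intro mult_strict_right_mono) auto
    also have "\<dots> = e" using CC by (simp add: D_def)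
    finally show ?thesis .
  qed
  then show "\<forall>\<^sub>F t in at_top. dist (w t) 0 < e" by (auto simp: eventually_at_top_linorder)
qed

section \<open>The front near minus infinity\<close>

lemma mvt_between:
  fixes f :: "real \<Rightarrow> real"
  assumes "\<And>x. (f has_real_derivative f' x) (at x)"
  obtains z where "min x y \<le> z" "z \<le> max x y" "f x - f y = f' z * (x - y)"
proof (cases x y rule: linorder_cases)
  case less
  from MVT2[OF less assms] obtain z where "x < z" "z < y" "f y - f x = (y - x) * f' z" by blast
  then show ?thesis by (intro that[of z]) (auto simp: algebra_simps)
next
  case greater
  from MVT2[OF greater assms] obtain z where "y < z" "z < x" "f x - f y = (x - y) * f' z" by blast
  then show ?thesis by (intro that[of z]) (auto simp: algebra_simps)
next
  case equal then show ?thesis by (intro that[of x]) auto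
qed

lemma DERIV_nonneg_mono:
  fixes f f' :: "real \<Rightarrow> real"
  assumes "\<And>x. (f has_real_derivative f' x) (at x)" "\<And>x. f' x \<ge> 0" "a \<le> b"
  shows "f a \<le> f b"
  by (rule DERIV_nonneg_imp_nondecreasing[OF assms(3)]) (use assms in blast)

lemma DERIV_delay:
  fixes f f' :: "real \<Rightarrow> real"
  assumes "\<And>t. (f has_real_derivative f' t) (at t)"
  shows "((\<lambda>t. f (t - h)) has_real_derivative f' (t - h)) (at t)"
proof -
  have "(f has_real_derivative f' (t - h)) (at (t + - h))" using assms[of "t - h"] by simp
  from iffD1[OF DERIV_shift this] show ?thesis by simp
qed

text \<open>The energy \<open>w\<^sup>2 + c \<integral>w\<^sup>2\<close> over a delay window is dissipated at rate \<open>w'\<^sup>2 / c\<close>, so \<open>w'\<close> is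
  square integrable; the energy of \<open>w'\<close> is monotone as well and must therefore vanish.\<close>
lemma bounded_backward_solution_constant:
  fixes w :: "real \<Rightarrow> real"
  assumes c: "c > 0" and h: "h > 0"
    and w: "\<And>t. (w has_real_derivative c * (w (t - h) - w t)) (at t)"
    and B: "\<And>t. t \<le> T \<Longrightarrow> \<bar>w t\<bar> \<le> B" and t: "t \<le> T"
  shows "w t = w T"
proof -
  define z where "z t = c * (w (t - h) - w t)" for t
  have wz: "(w has_real_derivative z t) (at t)" for t using w by (simp add: z_def)
  have zz: "(z has_real_derivative c * (z (t - h) - z t)) (at t)" for t
    unfolding z_def[abs_def] by (auto intro!: derivative_eq_intros DERIV_delay[where h = h, OF w] w simp: algebra_simps)
  have cont: "continuous_on UNIV f" if "\<And>t. (f has_real_derivative f' t) (at t)" for f f' :: "real \<Rightarrow> real"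
    using that DERIV_isCont by (auto simp: continuous_on_eq_continuous_at)
  from antiderivative_exists[of "\<lambda>t. (w t)\<^sup>2"] obtain Uw where Uw: "\<And>t. (Uw has_real_derivative (w t)\<^sup>2) (at t)"
    using cont[OF w] by (auto intro: continuous_intros)
  from antiderivative_exists[of "\<lambda>t. (z t)\<^sup>2"] obtain Uz where Uz: "\<And>t. (Uz has_real_derivative (z t)\<^sup>2) (at t)"
    using cont[OF zz] by (auto intro: continuous_intros)
  \<comment> \<open>\<open>Z\<close> is \<open>c\<close> times the energy, scaled so that its
    derivative is exactly \<open>- (z t)\<^sup>2\<close>. Hence \<open>Uz + Z\<close> is constant,
    and the increment of \<open>Uz\<close> over a delay can be expressed through \<open>Z\<close>,
    which is bounded above.\<close>
  define Z where "Z t = c * ((w t)\<^sup>2 + c * (Uw t - Uw (t - h)))" for t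
  have Zd: "(Z has_real_derivative - (z t)\<^sup>2) (at t)" for t
    unfolding Z_def[abs_def] z_def
    by (auto intro!: derivative_eq_intros DERIV_delay[where h = h, OF Uw] Uw w simp: algebra_simps power2_eq_square)
  define Ez where "Ez t = (z t)\<^sup>2 + c * (Uz t - Uz (t - h))" for t
  have Ezd: "(Ez has_real_derivative - (c * (z (t - h) - z t)\<^sup>2)) (at t)" for t
    unfolding Ez_def[abs_def]
    by (auto intro!: derivative_eq_intros DERIV_delay[where h = h, OF Uz] Uz zz simp: algebra_simps power2_eq_square)
  have UZ: "Uz t + Z t = Uz s + Z s" for s t
    by (rule DERIV_isconst_all[of "\<lambda>t. Uz t + Z t", rule_format]) (auto intro!: derivative_eq_intros Uz Zd)
  have "z t1 = 0" if t1: "t1 \<le> T" for t1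
  proof (rule ccontr)
    assume z1: "z t1 \<noteq> 0"
    define e1 where "e1 = Ez t1"
    have Umono: "Uz (t - h) \<le> Uz t" for t by (rule DERIV_nonneg_mono[OF Uz]) (use h in auto)
    have "e1 \<ge> (z t1)\<^sup>2" using Umono[of t1] c by (simp add: e1_def Ez_def)
    with z1 have e1: "e1 > 0" by (meson less_le_trans zero_less_power2)
    have Ez: "e1 \<le> Ez t" if "t \<le> t1" for t
      unfolding e1_def by (rule DERIV_nonpos_imp_nonincreasing[OF that]) (use c in \<open>auto intro!: exI conjI Ezd\<close>)
    define Zm where "Zm = c * (B\<^sup>2 + c * (h * B\<^sup>2))"
    have Zm: "Z t \<le> Zm" if "t \<le> T" for t
    proof -
      have wB: "(w s)\<^sup>2 \<le> B\<^sup>2" if "s \<le> T" for s using B[OF that] by (metis abs_ge_zero power2_abs power_mono)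
      obtain s where s: "min t (t - h) \<le> s" "s \<le> max t (t - h)" "Uw t - Uw (t - h) = (w s)\<^sup>2 * (t - (t - h))"
        using mvt_between[OF Uw] by blast
      then have "Uw t - Uw (t - h) \<le> B\<^sup>2 * h" using wB[of s] that h by (auto intro!: mult_right_mono)
      then show ?thesis unfolding Z_def Zm_def using wB[OF that] c
        by (intro mult_left_mono add_mono) (auto simp: mult.commute)
    qed
    from antiderivative_exists[OF cont[OF Zd]] obtain A where A: "\<And>t. (A has_real_derivative Z t) (at t)" by blast
    \<comment> \<open>Its derivative is \<open>e1 - Ez\<close>, which is nonpositive to the left of
      \<open>t1\<close> because the energy \<open>Ez\<close> of \<open>z\<close> stays above
      \<open>e1\<close> there. But the bound on \<open>Z\<close> gives Q t \<le> const + e1 t, which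
      tends to minus infinity with t: a contradiction at \<open>t2\<close>.\<close>
    define Q where "Q t = Z t + e1 * t + c * (A t - A (t - h))" for t
    have Qd: "(Q has_real_derivative (- (z t)\<^sup>2 + e1 + c * (Z t - Z (t - h)))) (at t)" for t
      unfolding Q_def[abs_def] by (auto intro!: derivative_eq_intros DERIV_delay[where h = h, OF A] A Zd simp: algebra_simps)
    have Q: "Q t1 \<le> Q t" if "t \<le> t1" for t
    proof (rule DERIV_nonpos_imp_nonincreasing[OF that], intro exI conjI, rule Qd)
      fix s assume "s \<le> t1"
      from Ez[OF this] have "e1 \<le> (z s)\<^sup>2 + c * (Uz s - Uz (s - h))" by (simp add: Ez_def)
      also have "Uz s - Uz (s - h) = Z (s - h) - Z s" using UZ[of s "s - h"] by simp
      finally show "- (z s)\<^sup>2 + e1 + c * (Z s - Z (s - h)) \<le> 0" by (simp add: algebra_simps)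
    qed
    have Qu: "Q t \<le> Zm + e1 * t + c * (h * Zm)" if "t \<le> T" for t
    proof -
      obtain s where s: "min t (t - h) \<le> s" "s \<le> max t (t - h)" "A t - A (t - h) = Z s * (t - (t - h))"
        using mvt_between[OF A] by blast
      then have "A t - A (t - h) \<le> h * Zm" using Zm[of s] that h by (auto simp: mult.commute intro!: mult_left_mono)
      then have "c * (A t - A (t - h)) \<le> c * (h * Zm)" using c by (intro mult_left_mono) auto
      then show ?thesis using Zm[OF that] by (simp add: Q_def)
    qed
    define t2 where "t2 = min t1 ((Q t1 - Zm - c * (h * Zm) - 1) / e1)"
    have "e1 * t2 \<le> e1 * ((Q t1 - Zm - c * (h * Zm) - 1) / e1)" using e1 by (intro mult_left_mono) (auto simp: t2_def)
    also have "\<dots> = Q t1 - Zm - c * (h * Zm) - 1" using e1 by simp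
    finally have "e1 * t2 \<le> Q t1 - Zm - c * (h * Zm) - 1" .
    moreover have "t2 \<le> t1" by (simp add: t2_def)
    ultimately show False using Q[of t2] Qu[of t2] t1 by linarith
  qed
  then have "\<And>s. s \<le> T \<Longrightarrow> (w has_real_derivative 0) (at s)" using wz by metis
  then show ?thesis
    using DERIV_nonneg_imp_nondecreasing[OF t, of w] DERIV_nonpos_imp_nonincreasing[OF t, of w] by fastforce
qed

text \<open>\<open>G\<close> extends g to the whole line, because candidate fronts are not known to
  be positive until late. \<open>G'lin\<close> records the C^2 smoothness at 0, and
  \<open>window\<close> is the form in which exponential stability of \<open>K\<close> enters.
  Positivity of \<open>psi\<close> is an assumption here and is derived before the locale is
  instantiated.\<close>

locale delay_front =
  fixes G G' :: "real \<Rightarrow> real" and h K lam p :: real and psi :: "real \<Rightarrow> real"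
  assumes h: "h > 0" and K: "K > 0"
    and dG: "\<And>x. (G has_real_derivative G' x) (at x)" and G'c: "continuous_on UNIV G'"
    and G0: "G 0 = 0" and GK: "G K = K" and Gnn: "\<And>x. x \<ge> 0 \<Longrightarrow> G x \<ge> 0" and p1: "p > 1"
    and G'lin: "\<exists>C r. r > 0 \<and> (\<forall>x. \<bar>x\<bar> < r \<longrightarrow> \<bar>G' x - p\<bar> \<le> C * \<bar>x\<bar>)"
    and psi: "\<And>t. (psi has_real_derivative (- psi t + G (psi (t - h)))) (at t)"
    and psi_pos: "\<And>t. psi t > 0" and psi_0: "(psi \<longlongrightarrow> 0) at_bot" and psi_K: "(psi \<longlongrightarrow> K) at_top"
    and lam: "lam > 0" and lam_root: "1 + lam = p * exp (- lam * h)"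
    and window: "\<exists>\<eta>>0. \<exists>n\<ge>1. \<exists>C\<ge>0. delay_window h (G' K) \<eta> n C"
begin

lemma psi_cont: "continuous_on UNIV psi"
  using psi DERIV_isCont by (auto simp: continuous_on_eq_continuous_at)

lemma G_cont: "continuous_on UNIV G"
  using dG DERIV_isCont by (auto simp: continuous_on_eq_continuous_at)

lemma psi_bounded: "\<exists>M>0. \<forall>t. psi t \<le> M"
proof -
  from order_tendstoD(2)[OF psi_0, of 1] obtain a where a: "\<And>t. t \<le> a \<Longrightarrow> psi t < 1"
    by (auto simp: eventually_at_bot_linorder)
  from order_tendstoD(2)[OF psi_K, of "K + 1"] obtain b where b: "\<And>t. t \<ge> b \<Longrightarrow> psi t < K + 1"
    by (auto simp: eventually_at_top_linorder)
  have "compact (psi ` {a..b})" by (intro compact_continuous_image continuous_on_subset[OF psi_cont]) auto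
  from compact_imp_bounded[OF this] obtain B where B: "\<forall>y\<in>psi ` {a..b}. norm y \<le> B"
    unfolding bounded_iff by blast
  have "psi t \<le> Max {1, K + 1, B}" for t
  proof (cases "t \<le> a \<or> t \<ge> b")
    case True then show ?thesis using a[of t] b[of t] by (auto simp: le_max_iff_disj less_imp_le)
  next
    case False
    then have "norm (psi t) \<le> B" using B by auto
    then show ?thesis by (auto simp: le_max_iff_disj)
  qed
  then show ?thesis by (intro exI[of _ "Max {1, K + 1, B}"]) (auto simp: less_max_iff_disj)
qed

lemma G'_bounded: "\<exists>B\<ge>0. \<forall>x. \<bar>x\<bar> \<le> R \<longrightarrow> \<bar>G' x\<bar> \<le> B"
proof -
  have "compact (G' ` {-R..R})" by (intro compact_continuous_image continuous_on_subset[OF G'c]) auto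
  from compact_imp_bounded[OF this] obtain B where B: "\<forall>y\<in>G' ` {-R..R}. norm y \<le> B"
    unfolding bounded_iff by blast
  show ?thesis
  proof (intro exI[of _ "max B 0"] conjI allI impI)
    fix x assume "\<bar>x\<bar> \<le> R"
    then have "norm (G' x) \<le> B" using B by (auto simp: abs_le_iff)
    then show "\<bar>G' x\<bar> \<le> max B 0" by simp
  qed simp
qed

lemma G'_near_0: "\<exists>C\<ge>0. \<forall>x. \<bar>x\<bar> \<le> R \<longrightarrow> \<bar>G' x - p\<bar> \<le> C * \<bar>x\<bar>"
proof -
  from G'lin obtain C r where r: "r > 0" and C: "\<And>x. \<bar>x\<bar> < r \<Longrightarrow> \<bar>G' x - p\<bar> \<le> C * \<bar>x\<bar>" by blast
  from G'_bounded obtain B where B: "B \<ge> 0" "\<And>x. \<bar>x\<bar> \<le> R \<Longrightarrow> \<bar>G' x\<bar> \<le> B" by blast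
  let ?C = "max C ((B + p) / r)"
  have C0: "?C \<ge> 0" using B r p1 by (simp add: le_max_iff_disj)
  have "\<bar>G' x - p\<bar> \<le> ?C * \<bar>x\<bar>" if x: "\<bar>x\<bar> \<le> R" for x
  proof (cases "\<bar>x\<bar> < r")
    case True
    have "C * \<bar>x\<bar> \<le> ?C * \<bar>x\<bar>" by (intro mult_right_mono) auto
    then show ?thesis using C[OF True] by linarith
  next
    case False
    have "\<bar>G' x - p\<bar> \<le> (B + p) / r * r" using B(2)[OF x] p1 r by simp
    also have "\<dots> \<le> ?C * \<bar>x\<bar>" using False r C0 by (intro mult_mono) auto
    finally show ?thesis .
  qed
  with C0 show ?thesis by blast
qed

lemma G_lipschitz:
  assumes "\<And>x. \<bar>x\<bar> \<le> R \<Longrightarrow> \<bar>G' x\<bar> \<le> B" and "\<bar>x\<bar> \<le> R" "\<bar>y\<bar> \<le> R"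
  shows "\<bar>G x - G y\<bar> \<le> B * \<bar>x - y\<bar>"
proof -
  obtain z where z: "min x y \<le> z" "z \<le> max x y" "G x - G y = G' z * (x - y)" using mvt_between[OF dG] by blast
  then have "\<bar>z\<bar> \<le> R" using assms by (auto simp: min_def max_def split: if_splits)
  then show ?thesis using assms(1) z(3) by (auto simp: abs_mult intro!: mult_right_mono)
qed

lemma G_quadratic:
  assumes C: "\<And>x. \<bar>x\<bar> \<le> R \<Longrightarrow> \<bar>G' x - p\<bar> \<le> C * \<bar>x\<bar>" "C \<ge> 0" and x: "\<bar>x\<bar> \<le> R"
  shows "\<bar>G x - p * x\<bar> \<le> C * x\<^sup>2"
proof -
  obtain z where z: "min x 0 \<le> z" "z \<le> max x 0" "G x - G 0 = G' z * (x - 0)" using mvt_between[OF dG] by blast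
  then have zx: "\<bar>z\<bar> \<le> \<bar>x\<bar>" by (auto simp: min_def max_def split: if_splits)
  have "\<bar>G x - p * x\<bar> = \<bar>G' z - p\<bar> * \<bar>x\<bar>" using z(3) G0 by (simp add: abs_mult[symmetric] left_diff_distrib)
  also have "\<dots> \<le> C * \<bar>z\<bar> * \<bar>x\<bar>" using C(1)[of z] zx x by (intro mult_right_mono) auto
  also have "\<dots> \<le> C * \<bar>x\<bar> * \<bar>x\<bar>" using zx C(2) by (intro mult_right_mono mult_left_mono) auto
  finally show ?thesis by (simp add: power2_eq_square mult.assoc)
qed

text \<open>\<open>exp t * psi t\<close> is nondecreasing since \<open>G\<close> is nonnegative on
  positive values. This Harnack type inequality bounds delayed values by the present one.\<close>

lemma psi_backward: "s \<ge> 0 \<Longrightarrow> psi (t - s) \<le> exp s * psi t"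
proof -
  assume s: "s \<ge> 0"
  have "exp (t - s) * psi (t - s) \<le> exp t * psi t"
  proof (rule DERIV_nonneg_mono[where f = "\<lambda>x. exp x * psi x" and f' = "\<lambda>x. exp x * G (psi (x - h))"])
    show "((\<lambda>x. exp x * psi x) has_real_derivative exp x * G (psi (x - h))) (at x)" for x
      by (auto intro!: derivative_eq_intros psi simp: algebra_simps)
    show "exp x * G (psi (x - h)) \<ge> 0" for x using Gnn[OF less_imp_le[OF psi_pos]] by simp
  qed (use s in simp)
  then have "exp (- (t - s)) * (exp (t - s) * psi (t - s)) \<le> exp (- (t - s)) * (exp t * psi t)" by (intro mult_left_mono) auto
  then show ?thesis by (simp add: mult.assoc[symmetric] exp_add[symmetric])
qed

text \<open>With v = psi exp(-lam t), the quantity \<open>l\<close>, the value of \<open>v\<close>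
  plus a weighted integral of \<open>v\<close> over a delay, is conserved by the linear equation
  because \<open>lam\<close> is a characteristic root. For the nonlinear equation its logarithmic
  derivative is at most a multiple of psi(t - h), so \<open>ln l\<close> stays bounded once psi is
  integrable at minus infinity. Integrability comes from the functional \<open>V\<close>, whose
  derivative dominates psi.\<close>

lemma psi_exponential_bounds:
  "\<exists>T c1 c2. c1 > 0 \<and> (\<forall>t\<le>T. c1 * exp (lam * t) \<le> psi t \<and> psi t \<le> c2 * exp (lam * t))"
proof -
  obtain M where M: "M > 0" "\<And>t. psi t \<le> M" using psi_bounded by blast
  obtain C where C: "C \<ge> 0" "\<And>x. \<bar>x\<bar> \<le> M \<Longrightarrow> \<bar>G' x - p\<bar> \<le> C * \<bar>x\<bar>" using G'_near_0 by blast
  have R: "\<bar>G (psi t) - p * psi t\<bar> \<le> C * (psi t)\<^sup>2" for t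
    using G_quadratic[OF C(2,1)] M(2) psi_pos[of t] by simp
  \<comment> \<open>Any number strictly between 1 and \<open>p\<close> serves the purpose: near 0
    the nonlinearity exceeds q x, and q > 1 makes \<open>V\<close> increase at a rate proportional
    to psi.\<close>
  define q where "q = (1 + p) / 2"
  have q: "q > 1" using p1 by (simp add: q_def)
  have "((\<lambda>t. C * psi t) \<longlongrightarrow> C * 0) at_bot" by (intro tendsto_intros psi_0)
  then have "\<forall>\<^sub>F t in at_bot. C * psi t < (p - 1) / 2" using p1 by (intro order_tendstoD) auto
  then obtain T where T: "\<And>t. t \<le> T \<Longrightarrow> C * psi t < (p - 1) / 2" by (auto simp: eventually_at_bot_linorder)
  have Gq: "G (psi (t - h)) \<ge> q * psi (t - h)" if "t \<le> T" for t
  proof -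
    have "C * (psi (t - h))\<^sup>2 = (C * psi (t - h)) * psi (t - h)" by (simp add: power2_eq_square)
    also have "\<dots> \<le> (p - 1) / 2 * psi (t - h)"
      using T[of "t - h"] that h psi_pos[of "t - h"] by (intro mult_right_mono) auto
    finally have "p * psi (t - h) - G (psi (t - h)) \<le> (p - 1) / 2 * psi (t - h)" using R[of "t - h"] by (simp add: abs_le_iff)
    then show ?thesis by (simp add: q_def field_simps)
  qed
  obtain U where U: "\<And>t. (U has_real_derivative psi t) (at t)" using antiderivative_exists[OF psi_cont] by blast
  define V where "V t = psi t + q * (U t - U (t - h))" for t
  have Vd: "(V has_real_derivative (- psi t + G (psi (t - h)) + q * (psi t - psi (t - h)))) (at t)" for t
    unfolding V_def[abs_def] by (auto intro!: derivative_eq_intros psi DERIV_delay[where h = h, OF U] U)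
  have Umono: "U (t - h) \<le> U t" for t
    by (rule DERIV_nonneg_mono[OF U]) (use h less_imp_le[OF psi_pos] in auto)
  have V0: "V t \<ge> 0" for t unfolding V_def using psi_pos[of t] Umono[of t] q by (intro add_nonneg_nonneg) auto
  define c where "c = 1 + lam"
  define v where "v t = psi t * exp (- lam * t)" for t
  have vpos: "v t > 0" for t using psi_pos by (simp add: v_def)
  have v_d: "(v has_real_derivative (c * (v (t - h) - v t) + exp (- lam * t) * (G (psi (t - h)) - p * psi (t - h)))) (at t)" for t
  proof -
    have "c * v (t - h) = (p * exp (- lam * h)) * (psi (t - h) * exp (- lam * (t - h)))"
      using lam_root by (simp add: c_def v_def)
    also have "\<dots> = exp (- lam * t) * (p * psi (t - h))"
    proof -
      have e: "exp (- lam * t) = exp (- lam * h) * exp (- lam * (t - h))"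
        by (simp add: exp_add[symmetric] algebra_simps)
      show ?thesis unfolding e by (simp only: mult_ac)
    qed
    finally have e: "c * v (t - h) = exp (- lam * t) * (p * psi (t - h))" .
    show ?thesis unfolding right_diff_distrib e unfolding v_def[abs_def] c_def
      by (auto intro!: derivative_eq_intros psi simp: algebra_simps)
  qed
  have vc: "continuous_on UNIV v" using v_d DERIV_isCont by (auto simp: continuous_on_eq_continuous_at)
  obtain W where W: "\<And>t. (W has_real_derivative v t) (at t)" using antiderivative_exists[OF vc] by blast
  have Wmono: "W (t - h) \<le> W t" for t
    by (rule DERIV_nonneg_mono[OF W]) (use h less_imp_le[OF vpos] in auto)
  define l where "l t = v t + c * (W t - W (t - h))" for t
  have ld: "(l has_real_derivative exp (- lam * t) * (G (psi (t - h)) - p * psi (t - h))) (at t)" for t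
    unfolding l_def[abs_def] by (auto intro!: derivative_eq_intros v_d DERIV_delay[where h = h, OF W] W simp: algebra_simps)
  have vl: "v t \<le> l t" for t using Wmono[of t] lam by (simp add: l_def c_def)
  have lpos: "l t > 0" for t using vl vpos less_le_trans by blast
  define C2 where "C2 = C * exp h / (q - 1)"
  have C20: "C2 \<ge> 0" using C q by (simp add: C2_def)
  define V' where "V' t = - psi t + G (psi (t - h)) + q * (psi t - psi (t - h))" for t
  have V'ge: "V' t \<ge> (q - 1) * psi t" if "t \<le> T" for t using Gq[OF that] by (simp add: V'_def algebra_simps)
  have l'bd: "\<bar>exp (- lam * t) * (G (psi (t - h)) - p * psi (t - h))\<bar> \<le> C2 * V' (t - h) * l t" if "t \<le> T" for t
  proof -
    have "\<bar>exp (- lam * t) * (G (psi (t - h)) - p * psi (t - h))\<bar> \<le> exp (- lam * t) * (C * (psi (t - h))\<^sup>2)"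
      unfolding abs_mult using R[of "t - h"] by (intro mult_mono) auto
    also have "\<dots> = C * psi (t - h) * (exp (- lam * t) * psi (t - h))" by (simp add: power2_eq_square)
    also have "\<dots> \<le> C * psi (t - h) * (exp (- lam * t) * (exp h * psi t))"
      using psi_backward[of h t] h C(1) psi_pos[of "t - h"] by (intro mult_left_mono) auto
    also have "\<dots> = (C * exp h) * psi (t - h) * v t" by (simp add: v_def)
    also have "\<dots> = C2 * ((q - 1) * psi (t - h)) * v t" using q by (simp add: C2_def)
    also have "\<dots> \<le> C2 * V' (t - h) * l t"
    proof (rule mult_mono)
      show "C2 * ((q - 1) * psi (t - h)) \<le> C2 * V' (t - h)" using V'ge[of "t - h"] that h C20 by (intro mult_left_mono) auto
      have "V' (t - h) \<ge> 0" using V'ge[of "t - h"] that h q psi_pos[of "t - h"]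
        by (smt (verit) mult_nonneg_nonneg)
      then show "0 \<le> C2 * V' (t - h)" using C20 by simp
    qed (use vl vpos[of t] in auto)
    finally show ?thesis .
  qed
  have Vh: "((\<lambda>t. V (t - h)) has_real_derivative V' (t - h)) (at t)" for t
    unfolding V'_def by (rule DERIV_delay[where h = h, OF Vd])
  \<comment> \<open>Instead of integrating, \<open>ln l\<close> is corrected by \<plusminus> C2 V(t
    - h), whose derivative dominates that of \<open>ln l\<close>; monotonicity of the two corrected
    functions gives the upper and the lower bound, \<open>V\<close> being nonnegative.\<close>
  have up: "ln (l t) + C2 * V (t - h) \<le> ln (l T) + C2 * V (T - h)" if "t \<le> T" for t
  proof (rule DERIV_nonneg_imp_nondecreasing[OF that], intro exI conjI)
    fix s assume s: "s \<le> T"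
    show "((\<lambda>t. ln (l t) + C2 * V (t - h)) has_real_derivative
        (inverse (l s) * (exp (- lam * s) * (G (psi (s - h)) - p * psi (s - h))) + C2 * V' (s - h))) (at s)"
      by (auto intro!: derivative_eq_intros ld Vh lpos simp: field_simps)
    have "- (exp (- lam * s) * (G (psi (s - h)) - p * psi (s - h))) \<le> C2 * V' (s - h) * l s"
      using l'bd[OF s] by (simp add: abs_le_iff)
    then have "inverse (l s) * (- (exp (- lam * s) * (G (psi (s - h)) - p * psi (s - h)))) \<le> inverse (l s) * (C2 * V' (s - h) * l s)"
      using lpos[of s] by (intro mult_left_mono) auto
    also have "\<dots> = C2 * V' (s - h)" using lpos[of s] by simp
    finally show "0 \<le> inverse (l s) * (exp (- lam * s) * (G (psi (s - h)) - p * psi (s - h))) + C2 * V' (s - h)" by simp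
  qed
  have lo: "ln (l T) - C2 * V (T - h) \<le> ln (l t) - C2 * V (t - h)" if "t \<le> T" for t
  proof (rule DERIV_nonpos_imp_nonincreasing[OF that], intro exI conjI)
    fix s assume s: "s \<le> T"
    show "((\<lambda>t. ln (l t) - C2 * V (t - h)) has_real_derivative
        (inverse (l s) * (exp (- lam * s) * (G (psi (s - h)) - p * psi (s - h))) - C2 * V' (s - h))) (at s)"
      by (auto intro!: derivative_eq_intros ld Vh lpos simp: field_simps)
    have "(exp (- lam * s) * (G (psi (s - h)) - p * psi (s - h))) \<le> C2 * V' (s - h) * l s"
      using l'bd[OF s] by (simp add: abs_le_iff)
    then have "inverse (l s) * (exp (- lam * s) * (G (psi (s - h)) - p * psi (s - h))) \<le> inverse (l s) * (C2 * V' (s - h) * l s)"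
      using lpos[of s] by (intro mult_left_mono) auto
    also have "\<dots> = C2 * V' (s - h)" using lpos[of s] by simp
    finally show "inverse (l s) * (exp (- lam * s) * (G (psi (s - h)) - p * psi (s - h))) - C2 * V' (s - h) \<le> 0" by simp
  qed
  define c2 where "c2 = exp (ln (l T) + C2 * V (T - h))"
  define c0 where "c0 = exp (ln (l T) - C2 * V (T - h))"
  \<comment> \<open>By \<open>psi_backward\<close> the values of \<open>v\<close> over one delay are
    at most exp(h + lam h) times the present one, so \<open>l\<close> is comparable to
    \<open>v\<close> and the lower bound passes from \<open>l\<close> to \<open>v\<close>.\<close>
  define k where "k = 1 + c * (h * exp (h + lam * h))"
  have k: "k > 0" unfolding k_def c_def using lam h by (intro add_pos_nonneg mult_nonneg_nonneg) auto
  have CV: "C2 * V t \<ge> 0" for t using C20 V0 by simp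
  have "(c0 / k) * exp (lam * t) \<le> psi t \<and> psi t \<le> c2 * exp (lam * t)" if t: "t \<le> T" for t
  proof -
    have "ln (l t) \<le> ln (l T) + C2 * V (T - h)" using up[OF t] CV[of "t - h"] by linarith
    then have l2: "l t \<le> c2" using lpos[of t] unfolding c2_def by (metis exp_le_cancel_iff exp_ln)
    have "ln (l T) - C2 * V (T - h) \<le> ln (l t)" using lo[OF t] CV[of "t - h"] by linarith
    then have l1: "c0 \<le> l t" using lpos[of t] unfolding c0_def by (metis exp_le_cancel_iff exp_ln)
    have pv: "psi t = v t * exp (lam * t)" by (simp add: v_def exp_minus)
    obtain s where s: "min t (t - h) \<le> s" "s \<le> max t (t - h)" "W t - W (t - h) = v s * (t - (t - h))"
      using mvt_between[OF W] by blast
    have st: "s \<le> t" "t - s \<le> h" using s h by auto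
    have "v s \<le> exp (h + lam * h) * v t"
    proof -
      have "psi s \<le> exp (t - s) * psi t" using psi_backward[of "t - s" t] st by simp
      also have "\<dots> \<le> exp h * psi t" using st psi_pos[of t] by (intro mult_right_mono) auto
      finally have 1: "psi s \<le> exp h * psi t" .
      have "lam * (t - s) \<le> lam * h" using st lam by (intro mult_left_mono) auto
      then have 2: "exp (- lam * s) \<le> exp (lam * h - lam * t)" by (simp add: algebra_simps)
      have "v s \<le> (exp h * psi t) * exp (lam * h - lam * t)"
        unfolding v_def using 1 2 psi_pos[of t] psi_pos[of s] by (intro mult_mono) auto
      also have "\<dots> = exp (h + lam * h) * v t" by (simp add: v_def exp_add exp_diff exp_minus divide_inverse)
      finally show ?thesis .
    qed
    then have "W t - W (t - h) \<le> h * (exp (h + lam * h) * v t)" using s(3) h by (simp add: mult.commute)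
    then have "c * (W t - W (t - h)) \<le> c * (h * (exp (h + lam * h) * v t))" using lam by (intro mult_left_mono) (auto simp: c_def)
    then have "l t \<le> k * v t" unfolding l_def k_def by (simp add: algebra_simps)
    then have "c0 / k \<le> v t" using l1 k by (simp add: pos_divide_le_eq mult.commute)
    then show ?thesis unfolding pv using l2 vl[of t] by (intro conjI mult_right_mono) auto
  qed
  moreover have "c0 / k > 0" using k by (simp add: c0_def)
  ultimately show ?thesis by blast
qed

text \<open>The quadratic remainder of \<open>G\<close> along psi is a forcing of order exp(2 lam
  t); a solution \<open>y\<close> of the linear equation of that order absorbs it. What is left,
  multiplied by exp(-lam t), is a solution of w' = (1 + lam)(w(t - h) - w) bounded near minus
  infinity, hence a constant \<open>A\<close>, and the lower exponential bound makes
  \<open>A\<close> positive.\<close>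

lemma psi_asymptotics:
  "\<exists>A C. A > 0 \<and> C \<ge> 0 \<and> (\<forall>t. psi t \<le> C * exp (lam * t) \<and> \<bar>psi t - A * exp (lam * t)\<bar> \<le> C * exp (2 * lam * t))"
proof -
  obtain T c1 c2 where c1: "c1 > 0" and c12: "\<And>t. t \<le> T \<Longrightarrow> c1 * exp (lam * t) \<le> psi t \<and> psi t \<le> c2 * exp (lam * t)"
    using psi_exponential_bounds by blast
  obtain M where M: "M > 0" "\<And>t. psi t \<le> M" using psi_bounded by blast
  obtain C where C: "C \<ge> 0" "\<And>x. \<bar>x\<bar> \<le> M \<Longrightarrow> \<bar>G' x - p\<bar> \<le> C * \<bar>x\<bar>" using G'_near_0 by blast
  define c where "c = max c2 (M * exp (- lam * T))"
  have c0: "c > 0" using M by (simp add: c_def less_max_iff_disj)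
  have pc: "psi t \<le> c * exp (lam * t)" for t
  proof (cases "t \<le> T")
    case True
    have "c2 * exp (lam * t) \<le> c * exp (lam * t)" by (intro mult_right_mono) (auto simp: c_def)
    then show ?thesis using c12[OF True] by linarith
  next
    case False
    have "psi t \<le> M * 1" using M by simp
    also have "\<dots> \<le> M * exp (- lam * T + lam * t)" using False lam M by (intro mult_left_mono) (auto simp: mult_left_mono)
    also have "\<dots> = M * exp (- lam * T) * exp (lam * t)" by (simp only: exp_add mult.assoc)
    also have "\<dots> \<le> c * exp (lam * t)" by (intro mult_right_mono) (auto simp: c_def)
    finally show ?thesis .
  qed
  define f where "f t = G (psi (t - h)) - p * psi (t - h)" for t
  have f: "\<bar>f t\<bar> \<le> C * c\<^sup>2 * exp (2 * lam * t)" for t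
  proof -
    have "\<bar>f t\<bar> \<le> C * (psi (t - h))\<^sup>2" unfolding f_def
      using G_quadratic[OF C(2,1)] M(2) psi_pos[of "t - h"] by simp
    also have "psi (t - h) \<le> c * exp (lam * t)"
    proof -
      have "c * exp (lam * (t - h)) \<le> c * exp (lam * t)" using lam h c0 by (intro mult_left_mono) auto
      then show ?thesis using pc[of "t - h"] by linarith
    qed
    then have "C * (psi (t - h))\<^sup>2 \<le> C * (c * exp (lam * t))\<^sup>2"
      using C(1) psi_pos[of "t - h"] by (intro mult_left_mono power_mono) auto
    also have "\<dots> = C * c\<^sup>2 * exp (2 * lam * t)"
      by (simp add: power_mult_distrib power2_eq_square exp_add[symmetric])
    finally show ?thesis .
  qed
  have fc: "continuous_on UNIV f" unfolding f_def
    by (intro continuous_intros continuous_on_compose2[OF G_cont] continuous_on_compose2[OF psi_cont]) auto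
  have q: "p * exp (- (2 * lam) * h) < 1 + 2 * lam"
  proof -
    have "p * exp (- (2 * lam) * h) = (1 + lam) * exp (- lam * h)"
      unfolding lam_root by (simp add: exp_add[symmetric])
    also have "\<dots> \<le> (1 + lam) * 1" using lam h by (intro mult_left_mono) auto
    finally show ?thesis using lam by simp
  qed
  obtain y C' where y: "\<And>t. (y has_real_derivative (- y t + (p * y (t - h) + f t))) (at t)"
    and C': "\<And>t. t \<le> 0 \<Longrightarrow> \<bar>y t\<bar> \<le> C' * exp (2 * lam * t)"
    using linear_delay_exists[where b = "\<lambda>_. p" and B = p and T = 0 and pb = p and \<nu> = "2 * lam" and h = h and f = f and D = "C * c\<^sup>2", OF _ _ _ q]
      lam h p1 fc f by auto
  define w where "w t = (psi t - y t) * exp (- lam * t)" for t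
  define k where "k = 1 + lam"
  have w: "(w has_real_derivative k * (w (t - h) - w t)) (at t)" for t
  proof -
    have "k * w (t - h) = (p * exp (- lam * h)) * ((psi (t - h) - y (t - h)) * exp (- lam * (t - h)))"
      using lam_root by (simp add: k_def w_def)
    also have "\<dots> = exp (- lam * t) * (p * (psi (t - h) - y (t - h)))"
    proof -
      have e: "exp (- lam * t) = exp (- lam * h) * exp (- lam * (t - h))"
        by (simp add: exp_add[symmetric] algebra_simps)
      show ?thesis unfolding e by (simp only: mult_ac)
    qed
    finally have e: "k * w (t - h) = exp (- lam * t) * (p * (psi (t - h) - y (t - h)))" .
    show ?thesis unfolding right_diff_distrib e unfolding w_def[abs_def] k_def
      by (auto intro!: derivative_eq_intros psi y simp: algebra_simps f_def)
  qed
  have C'0: "C' \<ge> 0" using C'[of 0] by simp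
  have yb: "\<bar>y t\<bar> * exp (- lam * t) \<le> C' * exp (lam * t)" if "t \<le> 0" for t
  proof -
    have "\<bar>y t\<bar> * exp (- lam * t) \<le> C' * exp (2 * lam * t) * exp (- lam * t)" using C'[OF that] by (intro mult_right_mono) auto
    also have "\<dots> = C' * exp (lam * t)" by (simp add: exp_add[symmetric])
    finally show ?thesis .
  qed
  have wB: "\<bar>w t\<bar> \<le> c + C'" if "t \<le> 0" for t
  proof -
    have "\<bar>w t\<bar> = \<bar>psi t - y t\<bar> * exp (- lam * t)" by (simp add: w_def abs_mult)
    also have "\<dots> \<le> (psi t + \<bar>y t\<bar>) * exp (- lam * t)" using psi_pos[of t] by (intro mult_right_mono) auto
    also have "\<dots> \<le> c + C' * exp (lam * t)"
    proof -
      have "psi t * exp (- lam * t) \<le> c * exp (lam * t) * exp (- lam * t)" using pc[of t] by (intro mult_right_mono) auto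
      also have "\<dots> = c" by (simp add: mult.assoc exp_add[symmetric])
      finally show ?thesis using yb[OF that] unfolding distrib_right by linarith
    qed
    also have "\<dots> \<le> c + C'" using that lam C'0 by (intro add_left_mono mult_left_le) (auto simp: mult_nonneg_nonpos)
    finally show ?thesis .
  qed
  define A where "A = w 0"
  have wA: "w t = A" if "t \<le> 0" for t
    unfolding A_def by (rule bounded_backward_solution_constant[OF _ h w wB that]) (use lam in \<open>auto simp: k_def\<close>)
  have pA: "psi t = A * exp (lam * t) + y t" if "t \<le> 0" for t
  proof -
    have "(psi t - y t) * exp (- lam * t) * exp (lam * t) = A * exp (lam * t)" using wA[OF that] by (simp add: w_def)
    then show ?thesis by (simp add: mult.assoc exp_add[symmetric])
  qed
  have "c1 \<le> A"
  proof -
    have "((\<lambda>t. A + C' * exp (lam * t)) \<longlongrightarrow> A + C' * 0) at_bot"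
    proof (intro tendsto_intros)
      have "filterlim (\<lambda>s. lam * s) at_bot at_bot"
        using lam by (intro filterlim_tendsto_pos_mult_at_bot[OF tendsto_const]) (auto intro: filterlim_ident)
      then show "((\<lambda>s. exp (lam * s)) \<longlongrightarrow> 0) at_bot" by (rule filterlim_compose[OF exp_at_bot])
    qed
    then have "((\<lambda>t. A + C' * exp (lam * t)) \<longlongrightarrow> A) at_bot" by simp
    moreover have "\<forall>\<^sub>F t in at_bot. c1 \<le> A + C' * exp (lam * t)"
      using eventually_le_at_bot[of "min 0 T"]
    proof eventually_elim
      case (elim t)
      have "c1 * exp (lam * t) \<le> psi t" using c12 elim by auto
      also have "\<dots> \<le> A * exp (lam * t) + C' * exp (2 * lam * t)" using pA[of t] C'[of t] elim by auto
      also have "\<dots> = (A + C' * exp (lam * t)) * exp (lam * t)" by (simp add: distrib_right exp_add[symmetric])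
      finally show ?case by simp
    qed
    ultimately show ?thesis by (rule tendsto_lowerbound) auto
  qed
  then have A: "A > 0" using c1 by linarith
  define D where "D = max (c + A) C'"
  have cD: "c \<le> D" "c + A \<le> D" "C' \<le> D" "0 \<le> D" using A c0 by (auto simp: D_def)
  have "psi t \<le> D * exp (lam * t) \<and> \<bar>psi t - A * exp (lam * t)\<bar> \<le> D * exp (2 * lam * t)" for t
  proof
    have "c * exp (lam * t) \<le> D * exp (lam * t)" using cD by (intro mult_right_mono) auto
    then show "psi t \<le> D * exp (lam * t)" using pc[of t] by linarith
    show "\<bar>psi t - A * exp (lam * t)\<bar> \<le> D * exp (2 * lam * t)"
    proof (cases "t \<le> 0")
      case True
      have "C' * exp (2 * lam * t) \<le> D * exp (2 * lam * t)" using cD by (intro mult_right_mono) auto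
      then show ?thesis using pA[OF True] C'[OF True] by linarith
    next
      case False
      have "\<bar>psi t - A * exp (lam * t)\<bar> \<le> psi t + A * exp (lam * t)" using psi_pos[of t] A
        by (smt (verit) exp_gt_zero mult_pos_pos)
      also have "\<dots> \<le> (c + A) * exp (lam * t)" using pc[of t] by (simp add: distrib_right)
      also have "\<dots> \<le> D * exp (2 * lam * t)" using cD False lam by (intro mult_mono) auto
      finally show ?thesis .
    qed
  qed
  with A cD show ?thesis by blast
qed

end

section \<open>The linearization along the front\<close>

context delay_front begin

definition b :: "real \<Rightarrow> real" where "b t = G' (psi (t - h))"

definition psi' :: "real \<Rightarrow> real" where "psi' t = - psi t + G (psi (t - h))"

text \<open>\<open>m1\<close> is the size of the front and \<open>m2\<close> that of the
  corrections. The minimum with 1 lets a single weight express decay at minus infinity and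
  boundedness at plus infinity.\<close>

definition m1 :: "real \<Rightarrow> real" where "m1 t = min (exp (lam * t)) 1"

definition m2 :: "real \<Rightarrow> real" where "m2 t = min (exp (2 * lam * t)) 1"

lemma m1_pos: "m1 t > 0" and m2_pos: "m2 t > 0" and m1_le_1: "m1 t \<le> 1" and m2_le_1: "m2 t \<le> 1"
  and m1_le_exp: "m1 t \<le> exp (lam * t)" and m2_le_exp: "m2 t \<le> exp (2 * lam * t)"
  by (auto simp: m1_def m2_def)

lemma m2_le_m1: "m2 t \<le> m1 t"
proof (cases "t \<le> 0")
  case True
  then have "2 * lam * t \<le> lam * t" using lam by (simp add: mult_le_cancel_right)
  then show ?thesis by (auto simp: m1_def m2_def)
next
  case False
  then have "exp (lam * t) \<ge> 1" using lam by simp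
  then show ?thesis by (auto simp: m1_def m2_def)
qed

lemma m1_square: "(m1 t)\<^sup>2 = m2 t"
proof (cases "t \<le> 0")
  case True
  then have "lam * t \<le> 0" "2 * lam * t \<le> 0" using lam by (auto simp: mult_nonneg_nonpos)
  then show ?thesis by (simp add: m1_def m2_def min_absorb1 power2_eq_square exp_add[symmetric])
next
  case False
  then have "lam * t \<ge> 0" "2 * lam * t \<ge> 0" using lam by auto
  then show ?thesis by (simp add: m1_def m2_def min_absorb2)
qed

lemma m1_mono: "s \<le> t \<Longrightarrow> m1 s \<le> m1 t"
  unfolding m1_def using lam by (intro min.mono) auto

lemma m2_mono: "s \<le> t \<Longrightarrow> m2 s \<le> m2 t"
  unfolding m2_def using lam by (intro min.mono) auto

lemma psi_deriv: "(psi has_real_derivative psi' t) (at t)"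
  using psi by (simp add: psi'_def)

lemma psi'_cont: "continuous_on UNIV psi'"
  unfolding psi'_def by (intro continuous_intros continuous_on_compose2[OF G_cont] continuous_on_compose2[OF psi_cont]) auto

lemma b_cont: "continuous_on UNIV b"
  unfolding b_def by (intro continuous_on_compose2[OF G'c] continuous_on_compose2[OF psi_cont] continuous_intros) auto

text \<open>The asymptotics of the derivative are read off the equation: A exp(lam t) solves the
  linearization at 0 exactly, so only terms of order exp(2 lam t) remain.\<close>

lemma psi_weights:
  "\<exists>A M. A > 0 \<and> M > 0 \<and> (\<forall>t. psi t \<le> M * m1 t \<and> \<bar>psi' t\<bar> \<le> M * m1 t \<and>
     \<bar>psi t - A * exp (lam * t)\<bar> \<le> M * exp (2 * lam * t) \<and>
     \<bar>psi' t - A * lam * exp (lam * t)\<bar> \<le> M * exp (2 * lam * t))"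
proof -
  obtain A C where A: "A > 0" and C: "C \<ge> 0" and e1: "\<And>t. psi t \<le> C * exp (lam * t)"
    and e2: "\<And>t. \<bar>psi t - A * exp (lam * t)\<bar> \<le> C * exp (2 * lam * t)" using psi_asymptotics by blast
  obtain N where N: "N > 0" "\<And>t. psi t \<le> N" using psi_bounded by blast
  obtain B where B: "B \<ge> 0" "\<And>x. \<bar>x\<bar> \<le> N \<Longrightarrow> \<bar>G' x\<bar> \<le> B" using G'_bounded by blast
  obtain Q where Q: "Q \<ge> 0" "\<And>x. \<bar>x\<bar> \<le> N \<Longrightarrow> \<bar>G' x - p\<bar> \<le> Q * \<bar>x\<bar>" using G'_near_0 by blast
  define M1 where "M1 = max C N"
  have M1: "M1 > 0" "C \<le> M1" "N \<le> M1" using N by (auto simp: M1_def)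
  have pw1: "psi t \<le> M1 * m1 t" for t
  proof -
    have "psi t \<le> M1 * exp (lam * t)" using e1[of t] mult_right_mono[OF M1(2) exp_ge_zero[of "lam * t"]] by linarith
    moreover have "psi t \<le> M1 * 1" using N(2)[of t] M1 by simp
    ultimately show ?thesis by (simp add: m1_def min_def)
  qed
  have psih: "psi (t - h) \<le> M1 * m1 t" for t
  proof -
    have "m1 (t - h) \<le> m1 t" using h by (intro m1_mono) simp
    then have "M1 * m1 (t - h) \<le> M1 * m1 t" using M1 by (intro mult_left_mono) auto
    then show ?thesis using pw1[of "t - h"] by linarith
  qed
  have p2: "\<bar>psi' t\<bar> \<le> M1 * (1 + B) * m1 t" for t
  proof -
    have "\<bar>G (psi (t - h)) - G 0\<bar> \<le> B * \<bar>psi (t - h) - 0\<bar>"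
      by (rule G_lipschitz[where R = N]) (use B N psi_pos[of "t - h"] in auto)
    then have "\<bar>G (psi (t - h))\<bar> \<le> B * psi (t - h)" using G0 psi_pos[of "t - h"] by simp
    also have "\<dots> \<le> B * (M1 * m1 t)" using psih B by (intro mult_left_mono) auto
    finally have "\<bar>psi' t\<bar> \<le> M1 * m1 t + B * (M1 * m1 t)" unfolding psi'_def using pw1[of t] psi_pos[of t] by linarith
    then show ?thesis by (simp add: algebra_simps)
  qed
  define M4 where "M4 = C + p * C + Q * C\<^sup>2"
  have p4: "\<bar>psi' t - A * lam * exp (lam * t)\<bar> \<le> M4 * exp (2 * lam * t)" for t
  proof -
    have le: "exp (2 * lam * (t - h)) \<le> exp (2 * lam * t)" using lam h by simp
    have ex: "p * exp (lam * (t - h)) = (1 + lam) * exp (lam * t)"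
      unfolding lam_root by (simp add: right_diff_distrib exp_diff exp_minus divide_inverse)
    have "psi' t - A * lam * exp (lam * t) = - (psi t - A * exp (lam * t)) + p * (psi (t - h) - A * exp (lam * (t - h)))
        + (G (psi (t - h)) - p * psi (t - h))"
      using arg_cong[OF ex, of "\<lambda>x. A * x"] by (simp add: psi'_def algebra_simps)
    moreover have "\<bar>p * (psi (t - h) - A * exp (lam * (t - h)))\<bar> \<le> p * (C * exp (2 * lam * t))"
    proof -
      have "C * exp (2 * lam * (t - h)) \<le> C * exp (2 * lam * t)" using C le by (rule mult_left_mono[rotated])
      then show ?thesis unfolding abs_mult using e2[of "t - h"] p1 by (intro mult_mono) auto
    qed
    moreover have "\<bar>G (psi (t - h)) - p * psi (t - h)\<bar> \<le> Q * (C\<^sup>2 * exp (2 * lam * t))"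
    proof -
      have "\<bar>G (psi (t - h)) - p * psi (t - h)\<bar> \<le> Q * (psi (t - h))\<^sup>2"
        by (rule G_quadratic[OF Q(2,1)]) (use N psi_pos[of "t - h"] in auto)
      also have "(psi (t - h))\<^sup>2 \<le> (C * exp (lam * (t - h)))\<^sup>2" using e1 psi_pos[of "t - h"] by (intro power_mono) auto
      also have "\<dots> = C\<^sup>2 * exp (2 * lam * (t - h))" by (simp add: power_mult_distrib power2_eq_square exp_add[symmetric])
      also have "\<dots> \<le> C\<^sup>2 * exp (2 * lam * t)" using le by (intro mult_left_mono) auto
      finally show ?thesis using Q(1) by (auto intro: mult_left_mono)
    qed
    ultimately have "\<bar>psi' t - A * lam * exp (lam * t)\<bar> \<le> C * exp (2 * lam * t) + p * (C * exp (2 * lam * t)) + Q * (C\<^sup>2 * exp (2 * lam * t))"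
      using e2[of t] by linarith
    then show ?thesis by (simp add: M4_def algebra_simps)
  qed
  define M where "M = max (M1 * (1 + B)) M4"
  have "M1 * 1 \<le> M1 * (1 + B)" using M1 B by (intro mult_left_mono) auto
  then have M: "M1 * (1 + B) \<le> M" "M4 \<le> M" "M1 \<le> M" by (auto simp: M_def)
  then have "C \<le> M" "M > 0" using M1 by auto
  show ?thesis
  proof (rule exI[of _ A], rule exI[of _ M], intro conjI allI A \<open>M > 0\<close>)
    fix t
    show "psi t \<le> M * m1 t" using pw1[of t] mult_right_mono[OF M(3) less_imp_le[OF m1_pos[of t]]] by linarith
    show "\<bar>psi' t\<bar> \<le> M * m1 t" using p2[of t] mult_right_mono[OF M(1) less_imp_le[OF m1_pos[of t]]] by linarith
    show "\<bar>psi t - A * exp (lam * t)\<bar> \<le> M * exp (2 * lam * t)"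
      using e2[of t] mult_right_mono[OF \<open>C \<le> M\<close> exp_ge_zero[of "2 * lam * t"]] by linarith
    show "\<bar>psi' t - A * lam * exp (lam * t)\<bar> \<le> M * exp (2 * lam * t)"
      using p4[of t] mult_right_mono[OF M(2) exp_ge_zero[of "2 * lam * t"]] by linarith
  qed
qed

text \<open>Existence at the rate 2 lam and the a priori bound are combined into one operator.
  Instead of linearity the last clause records the a priori bound for a difference, the form in
  which the contraction uses it.\<close>

lemma linear_inverse:
  "\<exists>L\<ge>1. \<exists>Li.
    (\<forall>f D. continuous_on UNIV f \<and> (\<forall>t. \<bar>f t\<bar> \<le> D * m2 t) \<longrightarrow>
       (\<forall>t. (Li f has_real_derivative (- Li f t + (b t * Li f (t - h) + f t))) (at t)) \<and>
       (\<forall>t. \<bar>Li f t\<bar> \<le> L * D * m2 t) \<and> ((f \<longlongrightarrow> 0) at_top \<longrightarrow> (Li f \<longlongrightarrow> 0) at_top)) \<and>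
    (\<forall>f1 f2 D1 D2 D. continuous_on UNIV f1 \<and> (\<forall>t. \<bar>f1 t\<bar> \<le> D1 * m2 t) \<longrightarrow>
       continuous_on UNIV f2 \<and> (\<forall>t. \<bar>f2 t\<bar> \<le> D2 * m2 t) \<longrightarrow> (\<forall>t. \<bar>f1 t - f2 t\<bar> \<le> D * m2 t) \<longrightarrow>
       (\<forall>t. \<bar>Li f1 t - Li f2 t\<bar> \<le> L * D * m2 t))"
proof -
  obtain \<eta> n C where \<eta>: "\<eta> > 0" and n: "n \<ge> 1" and C: "C \<ge> 0" and W: "delay_window h (G' K) \<eta> n C"
    using window by blast
  obtain N where N: "N > 0" "\<And>t. psi t \<le> N" using psi_bounded by blast
  obtain B where B: "B \<ge> 0" "\<And>x. \<bar>x\<bar> \<le> N \<Longrightarrow> \<bar>G' x\<bar> \<le> B" using G'_bounded by blast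
  have bB: "\<bar>b t\<bar> \<le> B" for t unfolding b_def using B(2)[of "psi (t - h)"] N psi_pos[of "t - h"] by auto
  obtain Q where Q: "Q \<ge> 0" "\<And>x. \<bar>x\<bar> \<le> N \<Longrightarrow> \<bar>G' x - p\<bar> \<le> Q * \<bar>x\<bar>" using G'_near_0 by blast
  have "((\<lambda>t. Q * psi t) \<longlongrightarrow> Q * 0) at_bot" by (intro tendsto_intros psi_0)
  then have "\<forall>\<^sub>F t in at_bot. Q * psi t < lam" using lam by (intro order_tendstoD) auto
  then obtain T where T: "\<And>t. t \<le> T \<Longrightarrow> Q * psi t < lam" by (auto simp: eventually_at_bot_linorder)
  have pb: "\<bar>b t\<bar> \<le> p + lam" if "t \<le> T" for t
  proof -
    have "\<bar>b t - p\<bar> \<le> Q * psi (t - h)" unfolding b_def using Q(2)[of "psi (t - h)"] N psi_pos[of "t - h"] by auto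
    then show ?thesis using T[of "t - h"] that h p1 by auto
  qed
  \<comment> \<open>At the rate 2 lam the coefficient \<open>p\<close> leaves a margin: p exp(-2 lam
    h) = (1 + lam) exp(-lam h) < 1 + lam. The remaining \<open>lam\<close> pays for the deviation of
    \<open>b\<close> from \<open>p\<close> to the left of \<open>T\<close>.\<close>
  have q: "(p + lam) * exp (- (2 * lam) * h) < 1 + 2 * lam"
  proof -
    have "p * exp (- (2 * lam) * h) = (1 + lam) * exp (- lam * h)"
      unfolding lam_root by (simp add: exp_add[symmetric])
    also have "\<dots> < (1 + lam) * 1" using lam h by (intro mult_strict_left_mono) auto
    finally have 1: "p * exp (- (2 * lam) * h) < 1 + lam" by simp
    have "lam * exp (- (2 * lam) * h) \<le> lam * 1" using lam h by (intro mult_left_mono) auto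
    then show ?thesis using 1 by (simp add: distrib_right)
  qed
  have "(b \<longlongrightarrow> G' K) at_top"
  proof -
    have "filterlim (\<lambda>t. t - h) at_top at_top"
      by (rule filterlim_at_top_mono[OF filterlim_tendsto_add_at_top[OF tendsto_const[of "-h"] filterlim_ident]]) auto
    then have "((\<lambda>t. psi (t - h)) \<longlongrightarrow> K) at_top" by (rule filterlim_compose[OF psi_K])
    moreover have "isCont G' K" using G'c by (simp add: continuous_on_eq_continuous_at)
    ultimately show ?thesis unfolding b_def by (intro isCont_tendsto_compose[of K G'])
  qed
  from tendstoD[OF this \<eta>] obtain t0 where "\<And>t. t \<ge> t0 \<Longrightarrow> \<bar>b t - G' K\<bar> < \<eta>"
    by (auto simp: eventually_at_top_linorder dist_real_def)
  then have t0: "\<And>t. t \<ge> t0 \<Longrightarrow> \<bar>b t - G' K\<bar> \<le> \<eta>" by (simp add: less_imp_le)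
  have lam2: "2 * lam > 0" using lam by simp
  from linear_delay_apriori[where b = b and T = T and ?t0.0 = t0, OF W n C bB pb q lam2 h t0] obtain L0 where L0: "L0 \<ge> 0"
    and ap0: "\<forall>w f D C'. (\<forall>t. (w has_real_derivative (- w t + (b t * w (t - h) + f t))) (at t)) \<longrightarrow>
      (\<forall>t\<le>T. \<bar>w t\<bar> \<le> C' * exp (2 * lam * t)) \<longrightarrow> (\<forall>t. \<bar>f t\<bar> \<le> D * m2 t) \<longrightarrow> (\<forall>t. \<bar>w t\<bar> \<le> L0 * D * m2 t)"
    unfolding m2_def[symmetric] by blast
  have ap: "\<bar>w t\<bar> \<le> L0 * D * m2 t" if "\<And>t. (w has_real_derivative (- w t + (b t * w (t - h) + f t))) (at t)"
      "\<And>t. t \<le> T \<Longrightarrow> \<bar>w t\<bar> \<le> C' * exp (2 * lam * t)" "\<And>t. \<bar>f t\<bar> \<le> D * m2 t" for w f D C' t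
    using ap0[rule_format, of w f C' D t] that by blast
  \<comment> \<open>The decay at minus infinity is part of the choice: it excludes adding
    homogeneous solutions such as psi', which is only of order exp(lam t).\<close>
  define Li where "Li f = (SOME w. (\<forall>t. (w has_real_derivative (- w t + (b t * w (t - h) + f t))) (at t)) \<and>
    (\<exists>C. \<forall>t\<le>T. \<bar>w t\<bar> \<le> C * exp (2 * lam * t)))" for f
  have Li: "(\<forall>t. (Li f has_real_derivative (- Li f t + (b t * Li f (t - h) + f t))) (at t)) \<and>
    (\<exists>C. \<forall>t\<le>T. \<bar>Li f t\<bar> \<le> C * exp (2 * lam * t))" if f: "continuous_on UNIV f" "\<And>t. \<bar>f t\<bar> \<le> D * m2 t" for f D
  proof -
    have "0 \<le> D * m2 0" using f(2)[of 0] by linarith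
    then have D: "D \<ge> 0" by (simp add: m2_def)
    have "\<bar>f t\<bar> \<le> D * exp (2 * lam * t)" for t using f(2)[of t] mult_left_mono[OF m2_le_exp D, of t] by linarith
    from linear_delay_exists[OF b_cont bB pb q lam2 h f(1) this]
    have "\<exists>w. (\<forall>t. (w has_real_derivative (- w t + (b t * w (t - h) + f t))) (at t)) \<and>
      (\<exists>C. \<forall>t\<le>T. \<bar>w t\<bar> \<le> C * exp (2 * lam * t))" by blast
    from someI_ex[OF this] show ?thesis unfolding Li_def .
  qed
  define L where "L = max L0 1"
  have L: "L0 \<le> L" "L \<ge> 1" by (auto simp: L_def)
  have up: "L0 * D * m2 t \<le> L * D * m2 t" if "D \<ge> 0" for D t
    using L that m2_pos[of t] by (intro mult_right_mono) auto
  have Dpos: "D \<ge> 0" if "\<And>t. \<bar>f t\<bar> \<le> D * m2 t" for f D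
  proof -
    have "0 \<le> D * m2 0" using that[of 0] by linarith
    then show ?thesis by (simp add: m2_def)
  qed
  show ?thesis
  proof (rule exI[of _ L], rule conjI[OF L(2)], rule exI[of _ Li], intro conjI allI impI)
    fix f D t assume f: "continuous_on UNIV f \<and> (\<forall>t. \<bar>f t\<bar> \<le> D * m2 t)"
    then have f': "continuous_on UNIV f" "\<And>t. \<bar>f t\<bar> \<le> D * m2 t" by auto
    have d: "(Li f has_real_derivative - Li f t + (b t * Li f (t - h) + f t)) (at t)" for t
      using Li[OF f'] by blast
    show "(Li f has_real_derivative - Li f t + (b t * Li f (t - h) + f t)) (at t)" by (rule d)
    from Li[OF f'] obtain C' where C': "\<And>t. t \<le> T \<Longrightarrow> \<bar>Li f t\<bar> \<le> C' * exp (2 * lam * t)" by blast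
    have bd: "\<bar>Li f t\<bar> \<le> L * D * m2 t" for t using ap[OF d C' f'(2), of t] up[OF Dpos[OF f'(2)], of t] by linarith
    show "\<bar>Li f t\<bar> \<le> L * D * m2 t" by (rule bd)
    assume lim: "(f \<longlongrightarrow> 0) at_top"
    show "(Li f \<longlongrightarrow> 0) at_top"
    proof (rule linear_delay_tendsto_0[OF W n h C d t0 lim])
      fix t
      have "L * D * m2 t \<le> L * D * 1" using m2_le_1 L Dpos[OF f'(2)] by (intro mult_left_mono) auto
      then show "\<bar>Li f t\<bar> \<le> L * D" using bd[of t] by simp
    qed
  next
    fix f1 f2 D1 D2 D t
    assume "continuous_on UNIV f1 \<and> (\<forall>t. \<bar>f1 t\<bar> \<le> D1 * m2 t)" "continuous_on UNIV f2 \<and> (\<forall>t. \<bar>f2 t\<bar> \<le> D2 * m2 t)"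
    then have f1: "continuous_on UNIV f1" "\<And>t. \<bar>f1 t\<bar> \<le> D1 * m2 t" and f2: "continuous_on UNIV f2" "\<And>t. \<bar>f2 t\<bar> \<le> D2 * m2 t" by auto
    assume D: "\<forall>t. \<bar>f1 t - f2 t\<bar> \<le> D * m2 t"
    from Li[OF f1] obtain C1 where d1: "\<And>t. (Li f1 has_real_derivative - Li f1 t + (b t * Li f1 (t - h) + f1 t)) (at t)"
      and C1: "\<And>t. t \<le> T \<Longrightarrow> \<bar>Li f1 t\<bar> \<le> C1 * exp (2 * lam * t)" by blast
    from Li[OF f2] obtain C2 where d2: "\<And>t. (Li f2 has_real_derivative - Li f2 t + (b t * Li f2 (t - h) + f2 t)) (at t)"
      and C2: "\<And>t. t \<le> T \<Longrightarrow> \<bar>Li f2 t\<bar> \<le> C2 * exp (2 * lam * t)" by blast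
    have "\<bar>Li f1 t - Li f2 t\<bar> \<le> L0 * D * m2 t"
    proof (rule ap[where f = "\<lambda>t. f1 t - f2 t" and C' = "C1 + C2"])
      show "((\<lambda>t. Li f1 t - Li f2 t) has_real_derivative - (Li f1 t - Li f2 t) + (b t * (Li f1 (t - h) - Li f2 (t - h)) + (f1 t - f2 t))) (at t)" for t
        by (rule DERIV_cong[OF DERIV_diff[OF d1 d2]]) (simp add: algebra_simps)
      show "\<bar>Li f1 t - Li f2 t\<bar> \<le> (C1 + C2) * exp (2 * lam * t)" if "t \<le> T" for t
        using C1[OF that] C2[OF that] by (simp add: distrib_right)
    qed (use D in auto)
    then show "\<bar>Li f1 t - Li f2 t\<bar> \<le> L * D * m2 t" using up[OF Dpos, of "\<lambda>t. f1 t - f2 t" D t] D by fastforce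
  qed
qed

end

section \<open>The rescaled equation\<close>

context delay_front begin

text \<open>Admissible data of the rescaled equation \<open>ka X' = - X + shifted_avg (G X)\<close>; the last condition says that
  \<open>lam\<close> is still a root of its characteristic equation at \<open>0\<close>.\<close>
definition admissible :: "real \<Rightarrow> real \<Rightarrow> real \<Rightarrow> bool" where
  "admissible c th ka \<longleftrightarrow> c \<ge> 0 \<and> th \<ge> 0 \<and> 8 * lam * th \<le> 1 \<and> ka \<ge> 1 \<and>
     ka * lam + 1 = p * exp (- lam * (c * h)) / (1 - th * lam)"

text \<open>In the rescaled time the delay \<open>h\<close> becomes \<open>c * h\<close> and the
  averaging length \<theta> becomes \<theta> c, which is the argument \<open>th\<close>.\<close>

definition shifted_avg :: "real \<Rightarrow> real \<Rightarrow> (real \<Rightarrow> real) \<Rightarrow> real \<Rightarrow> real" where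
  "shifted_avg c th Y t = avg th Y (t - c * h)"

end

text \<open>The constants are fixed on |x| \<le> M + L, a range containing psi + Li f for all
  forcings in the unit ball, so that none of them depends on the parameters or on the
  candidate.\<close>

locale front_bounds = delay_front +
  fixes A M B Q L :: real and Li :: "(real \<Rightarrow> real) \<Rightarrow> real \<Rightarrow> real"
  assumes A: "A > 0" and M: "M > 0"
    and psi_M: "\<And>t. psi t \<le> M * m1 t" and psi'_M: "\<And>t. \<bar>psi' t\<bar> \<le> M * m1 t"
    and psi_A: "\<And>t. \<bar>psi t - A * exp (lam * t)\<bar> \<le> M * exp (2 * lam * t)"
    and psi'_A: "\<And>t. \<bar>psi' t - A * lam * exp (lam * t)\<bar> \<le> M * exp (2 * lam * t)"
    and L: "L \<ge> 1"
    and B: "B \<ge> 0" "\<And>x. \<bar>x\<bar> \<le> M + L \<Longrightarrow> \<bar>G' x\<bar> \<le> B"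
    and Q: "Q \<ge> 0" "\<And>x. \<bar>x\<bar> \<le> M + L \<Longrightarrow> \<bar>G' x - p\<bar> \<le> Q * \<bar>x\<bar>"
    and Li: "\<And>f D t. continuous_on UNIV f \<Longrightarrow> (\<And>t. \<bar>f t\<bar> \<le> D * m2 t) \<Longrightarrow>
       (Li f has_real_derivative (- Li f t + (b t * Li f (t - h) + f t))) (at t)"
      "\<And>f D t. continuous_on UNIV f \<Longrightarrow> (\<And>t. \<bar>f t\<bar> \<le> D * m2 t) \<Longrightarrow> \<bar>Li f t\<bar> \<le> L * D * m2 t"
      "\<And>f D. continuous_on UNIV f \<Longrightarrow> (\<And>t. \<bar>f t\<bar> \<le> D * m2 t) \<Longrightarrow> (f \<longlongrightarrow> 0) at_top \<Longrightarrow> (Li f \<longlongrightarrow> 0) at_top"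
      "\<And>f1 f2 D1 D2 D t. continuous_on UNIV f1 \<Longrightarrow> (\<And>t. \<bar>f1 t\<bar> \<le> D1 * m2 t) \<Longrightarrow>
       continuous_on UNIV f2 \<Longrightarrow> (\<And>t. \<bar>f2 t\<bar> \<le> D2 * m2 t) \<Longrightarrow> (\<And>t. \<bar>f1 t - f2 t\<bar> \<le> D * m2 t) \<Longrightarrow>
       \<bar>Li f1 t - Li f2 t\<bar> \<le> L * D * m2 t"
begin

definition "R = M + L"
text \<open>The bound for \<open>Li'\<close>: \<open>L\<close> for the solution,
  \<open>B * L\<close> for the delayed term, 1 for the forcing.\<close>

definition "L2 = L + B * L + 1"
definition "Li' f t = - Li f t + (b t * Li f (t - h) + f t)"

text \<open>The weights that survive forward averaging: since 8 lam th \<le> 1, growth of at most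
  exp(2 lam x) costs a factor exp(u / 4) under the kernel exp(-u). Monotonicity takes care of the
  delay, which only moves the argument back.\<close>

definition weight :: "(real \<Rightarrow> real) \<Rightarrow> bool" where
  "weight m \<longleftrightarrow> (\<forall>s. m s \<ge> 0) \<and> (\<forall>s t. s \<le> t \<longrightarrow> m s \<le> m t) \<and> (\<forall>s. \<forall>x\<ge>0. m (s + x) \<le> m s * exp (2 * lam * x))"

section \<open>Weights and estimates for shifted averages\<close>

lemma shifted_avg_base [simp]: "shifted_avg 1 0 Y t = Y (t - h)"
  by (simp add: shifted_avg_def)

lemma admissible_base: "admissible 1 0 1"
  using lam_root by (simp add: admissible_def)

lemma L2: "L2 \<ge> 1" "L2 \<ge> L"
  using L B by (auto simp: L2_def add_increasing)

lemma R: "R > 0" "M \<le> R" "L \<le> R"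
  using M L by (auto simp: R_def)

lemma b_B: "\<bar>b t\<bar> \<le> B"
proof -
  have "psi (t - h) \<le> M * 1" using psi_M[of "t - h"] mult_left_mono[OF m1_le_1[of "t - h"] less_imp_le[OF M]] by linarith
  then show ?thesis unfolding b_def using psi_pos[of "t - h"] L by (intro B) auto
qed

lemma weight_1: "weight (\<lambda>_. 1)"
  using lam by (auto simp: weight_def)

lemma weight_exp: "0 \<le> a \<Longrightarrow> a \<le> 2 * lam \<Longrightarrow> weight (\<lambda>t. exp (a * t))"
  by (auto simp: weight_def mult_left_mono distrib_left exp_add mult_right_mono)

lemma weight_m2: "weight m2"
  unfolding weight_def
proof (intro conjI allI impI)
  fix s x :: real assume x: "0 \<le> x"
  have e: "exp (2 * lam * x) \<ge> 1" using lam x by simp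
  show "m2 (s + x) \<le> m2 s * exp (2 * lam * x)"
  proof (cases "exp (2 * lam * s) \<le> 1")
    case True
    then have "m2 s * exp (2 * lam * x) = exp (2 * lam * (s + x))"
      by (simp add: m2_def exp_add[symmetric] distrib_left)
    then show ?thesis using m2_le_exp by simp
  next
    case False
    then have ms: "m2 s = 1" by (simp add: m2_def)
    show ?thesis unfolding ms using m2_le_1[of "s + x"] e by linarith
  qed
qed (use less_imp_le[OF m2_pos] m2_mono in auto)

lemma weight_le:
  assumes "weight m" "a \<le> t + u / (8 * lam)" "u \<ge> 0"
  shows "m a \<le> m t * exp (u / 4)"
proof -
  have "m a \<le> m (t + u / (8 * lam))" using assms by (auto simp: weight_def)
  also have "\<dots> \<le> m t * exp (2 * lam * (u / (8 * lam)))"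
  proof -
    have "u / (8 * lam) \<ge> 0" using assms lam by simp
    then show ?thesis using assms(1) unfolding weight_def by blast
  qed
  also have "2 * lam * (u / (8 * lam)) = u / 4" using lam by simp
  finally show ?thesis .
qed

lemma admissible_shift_le:
  assumes "admissible c th ka" "u \<ge> 0"
  shows "t - c * h + th * u \<le> t + u / (8 * lam)"
proof -
  have "8 * lam * th * u \<le> 1 * u" using assms by (intro mult_right_mono) (auto simp: admissible_def)
  then have "th * u \<le> u / (8 * lam)" using lam by (simp add: field_simps)
  moreover have "c * h \<ge> 0" using assms h by (simp add: admissible_def)
  ultimately show ?thesis by linarith
qed

lemma shifted_avg_pointwise:
  assumes "weight m" "admissible c th ka" "\<And>s. \<bar>Y s\<bar> \<le> C * m s" "C \<ge> 0" "u \<ge> 0"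
  shows "\<bar>Y (t - c * h + th * u)\<bar> \<le> C * m t * exp (1 / 4 * u)"
proof -
  have "m (t - c * h + th * u) \<le> m t * exp (u / 4)" by (rule weight_le[OF assms(1) admissible_shift_le[OF assms(2,5)] assms(5)])
  from mult_left_mono[OF this assms(4)] show ?thesis using assms(3)[of "t - c * h + th * u"] by (simp add: mult.assoc)
qed

lemma shifted_avg_integrable:
  assumes "weight m" "admissible c th ka" "continuous_on UNIV Y" "\<And>s. \<bar>Y s\<bar> \<le> C * m s" "C \<ge> 0"
  shows "(\<lambda>u. exp (- u) * Y (t - c * h + th * u)) integrable_on {0..}"
  by (rule avg_integrable[OF assms(3) shifted_avg_pointwise[OF assms(1,2,4,5)]]) auto

lemma shifted_avg_bound:
  assumes "weight m" "admissible c th ka" "continuous_on UNIV Y" "\<And>s. \<bar>Y s\<bar> \<le> C * m s" "C \<ge> 0"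
  shows "\<bar>shifted_avg c th Y t\<bar> \<le> 2 * C * m t"
proof -
  have "\<bar>avg th Y (t - c * h)\<bar> \<le> C * m t / (1 - 1 / 4)"
    by (rule avg_bound[OF assms(3) shifted_avg_pointwise[OF assms(1,2,4,5)]]) auto
  moreover have "C * m t \<ge> 0" using assms by (auto simp: weight_def)
  ultimately show ?thesis by (simp add: shifted_avg_def)
qed

lemma shifted_avg_diff:
  assumes "admissible c th ka" "weight m" "continuous_on UNIV Y" "\<And>s. \<bar>Y s\<bar> \<le> C * m s" "C \<ge> 0"
    and "weight m'" "continuous_on UNIV Z" "\<And>s. \<bar>Z s\<bar> \<le> C' * m' s" "C' \<ge> 0"
  shows "shifted_avg c th (\<lambda>s. Y s - Z s) t = shifted_avg c th Y t - shifted_avg c th Z t"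
  unfolding shifted_avg_def avg_def right_diff_distrib
  by (rule integral_diff[OF shifted_avg_integrable[OF assms(2,1,3,4,5)] shifted_avg_integrable[OF assms(6,1,7,8,9)]])

text \<open>Changing the parameters moves the argument by at most (h + u)(|c - c1| + |th - th1|), so
  what is averaged is the modulus of continuity of \<open>Y\<close>. The term \<open>E\<close>
  admits functions that are Lipschitz only up to a remainder, as happens for differences of
  \<open>G\<close> when \<open>G'\<close> is merely continuous. The weight \<open>m0\<close> is
  there for integrability and may differ from \<open>m\<close>.\<close>

lemma shifted_avg_param:
  assumes m: "weight m" and admissible: "admissible c th ka" "admissible c1 th1 ka1" and Y: "continuous_on UNIV Y"
    and m0: "weight m0" and C0: "\<And>s. \<bar>Y s\<bar> \<le> C0 * m0 s" "C0 \<ge> 0"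
    and d: "\<And>a b. \<bar>Y a - Y b\<bar> \<le> (C * \<bar>a - b\<bar> + E) * m (max a b)" and CE: "C \<ge> 0" "E \<ge> 0"
  shows "\<bar>shifted_avg c th Y t - shifted_avg c1 th1 Y t\<bar> \<le> 2 * (C * (h + 4) * (\<bar>c - c1\<bar> + \<bar>th - th1\<bar>) + E) * m t"
proof -
  define \<delta> where "\<delta> = \<bar>c - c1\<bar> + \<bar>th - th1\<bar>"
  have \<delta>0: "\<delta> \<ge> 0" by (simp add: \<delta>_def)
  define W where "W = (C * (h + 4) * \<delta> + E) * m t"
  have i1: "(\<lambda>u. exp (- u) * Y (t - c * h + th * u)) integrable_on {0..}"
    by (rule shifted_avg_integrable[OF m0 admissible(1) Y C0])
  have i2: "(\<lambda>u. exp (- u) * Y (t - c1 * h + th1 * u)) integrable_on {0..}"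
    by (rule shifted_avg_integrable[OF m0 admissible(2) Y C0])
  have pt: "\<bar>Y (t - c * h + th * u) - Y (t - c1 * h + th1 * u)\<bar> \<le> W * exp (1 / 2 * u)" if u: "u \<ge> 0" for u
  proof -
    let ?a = "t - c * h + th * u" and ?b = "t - c1 * h + th1 * u"
    have mm: "m (max ?a ?b) \<le> m t * exp (u / 4)"
      by (rule weight_le[OF m _ u]) (use admissible_shift_le[OF admissible(1) u, of t] admissible_shift_le[OF admissible(2) u, of t] in simp)
    \<comment> \<open>The factor u is traded for 4 exp(u / 4); with another exp(u / 4) from the
      weight the integrand is at most W exp(- u / 2), whose integral accounts for the 2 in the
      statement.\<close>
    have e1: "1 \<le> exp (u / 4)" "u \<le> 4 * exp (u / 4)" 
    proof -
      have "1 + u / 4 \<le> exp (u / 4)" by (rule exp_ge_add_one_self)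
      with u show "1 \<le> exp (u / 4)" "u \<le> 4 * exp (u / 4)" by linarith+
    qed
    have "?a - ?b = (c1 - c) * h + (th - th1) * u" by (simp add: algebra_simps)
    then have "\<bar>?a - ?b\<bar> \<le> \<bar>(c1 - c) * h\<bar> + \<bar>(th - th1) * u\<bar>" by linarith
    also have "\<dots> = \<bar>c - c1\<bar> * h + \<bar>th - th1\<bar> * u" using h u by (simp add: abs_mult abs_minus_commute)
    also have "\<dots> \<le> \<delta> * h + \<delta> * u" using h u by (intro add_mono mult_right_mono) (auto simp: \<delta>_def)
    also have "\<dots> \<le> \<delta> * (h * exp (u / 4)) + \<delta> * (4 * exp (u / 4))"
    proof -
      have "h * 1 \<le> h * exp (u / 4)" using e1 h by (intro mult_left_mono) auto
      then show ?thesis using e1 \<delta>0 by (intro add_mono mult_left_mono) auto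
    qed
    also have "\<dots> = (h + 4) * \<delta> * exp (u / 4)" by (simp add: algebra_simps)
    finally have ab: "\<bar>?a - ?b\<bar> \<le> (h + 4) * \<delta> * exp (u / 4)" .
    have "C * \<bar>?a - ?b\<bar> + E \<le> C * ((h + 4) * \<delta> * exp (u / 4)) + E * exp (u / 4)"
    proof (rule add_mono)
      show "C * \<bar>?a - ?b\<bar> \<le> C * ((h + 4) * \<delta> * exp (u / 4))" using ab CE by (intro mult_left_mono) auto
      show "E \<le> E * exp (u / 4)" using mult_left_mono[OF e1(1) CE(2)] by simp
    qed
    also have "\<dots> = (C * (h + 4) * \<delta> + E) * exp (u / 4)" by (simp add: algebra_simps)
    finally have ce: "C * \<bar>?a - ?b\<bar> + E \<le> (C * (h + 4) * \<delta> + E) * exp (u / 4)" .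
    have "\<bar>Y ?a - Y ?b\<bar> \<le> (C * \<bar>?a - ?b\<bar> + E) * m (max ?a ?b)" by (rule d)
    also have "\<dots> \<le> ((C * (h + 4) * \<delta> + E) * exp (u / 4)) * (m t * exp (u / 4))"
      using ce mm CE \<delta>0 h m by (intro mult_mono) (auto simp: weight_def)
    also have "\<dots> = W * (exp (u / 4) * exp (u / 4))" by (simp add: W_def mult_ac)
    also have "exp (u / 4) * exp (u / 4) = exp (1 / 2 * u)" by (simp add: exp_add[symmetric])
    finally show ?thesis .
  qed
  have w: "((\<lambda>u. exp (- u) * (W * exp (1 / 2 * u))) has_integral W / (1 - 1 / 2)) {0..}"
    by (rule weighted_exp_integral) simp
  have "norm (integral {0..} (\<lambda>u. exp (- u) * Y (t - c * h + th * u) - exp (- u) * Y (t - c1 * h + th1 * u)))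
      \<le> integral {0..} (\<lambda>u. exp (- u) * (W * exp (1 / 2 * u)))"
  proof (rule integral_norm_bound_integral[OF integrable_diff[OF i1 i2] has_integral_integrable[OF w]])
    fix u :: real assume "u \<in> {0..}"
    then have u: "u \<ge> 0" by simp
    have "norm (exp (- u) * Y (t - c * h + th * u) - exp (- u) * Y (t - c1 * h + th1 * u))
        = exp (- u) * \<bar>Y (t - c * h + th * u) - Y (t - c1 * h + th1 * u)\<bar>"
      unfolding right_diff_distrib[symmetric] by (simp add: abs_mult)
    also have "\<dots> \<le> exp (- u) * (W * exp (1 / 2 * u))" using pt[OF u] by (intro mult_left_mono) auto
    finally show "norm (exp (- u) * Y (t - c * h + th * u) - exp (- u) * Y (t - c1 * h + th1 * u)) \<le> exp (- u) * (W * exp (1 / 2 * u))" .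
  qed
  then show ?thesis
    unfolding shifted_avg_def avg_def integral_diff[OF i1 i2] integral_unique[OF w]
    by (simp add: W_def \<delta>_def algebra_simps)
qed

section \<open>Corrections parametrized by their forcing\<close>

lemma Li_deriv:
  assumes "continuous_on UNIV f" "\<And>t. \<bar>f t\<bar> \<le> D * m2 t"
  shows "(Li f has_real_derivative Li' f t) (at t)"
  unfolding Li'_def by (rule Li(1)[OF assms])

text \<open>The derivative is estimated from the equation itself, so a bound on the forcings
  controls it without any further regularity.\<close>

lemma Li'_diff:
  assumes f1: "continuous_on UNIV f1" "\<And>t. \<bar>f1 t\<bar> \<le> D1 * m2 t"
    and f2: "continuous_on UNIV f2" "\<And>t. \<bar>f2 t\<bar> \<le> D2 * m2 t" and d: "\<And>t. \<bar>f1 t - f2 t\<bar> \<le> D * m2 t"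
  shows "\<bar>Li' f1 t - Li' f2 t\<bar> \<le> L2 * D * m2 t"
proof -
  have "0 \<le> D * m2 0" using d[of 0] by linarith
  then have D: "D \<ge> 0" using m2_pos[of 0] by (simp add: zero_le_mult_iff)
  note dd = Li(4)[OF f1 f2 d]
  have "L * D * m2 (t - h) \<le> L * D * m2 t" using m2_mono[of "t - h" t] h L D by (intro mult_left_mono) auto
  then have "\<bar>Li f1 (t - h) - Li f2 (t - h)\<bar> \<le> L * D * m2 t" using dd[of "t - h"] by linarith
  then have "\<bar>b t * (Li f1 (t - h) - Li f2 (t - h))\<bar> \<le> B * (L * D * m2 t)"
    unfolding abs_mult using b_B[of t] B(1) by (intro mult_mono) auto
  moreover have "Li' f1 t - Li' f2 t = - (Li f1 t - Li f2 t) + b t * (Li f1 (t - h) - Li f2 (t - h)) + (f1 t - f2 t)"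
    by (simp add: Li'_def algebra_simps)
  ultimately have "\<bar>Li' f1 t - Li' f2 t\<bar> \<le> L * D * m2 t + B * (L * D * m2 t) + D * m2 t" using dd[of t] d[of t] by linarith
  then show ?thesis by (simp add: L2_def algebra_simps)
qed

lemma Li_0: "Li (\<lambda>_. 0) t = 0"
  using Li(2)[of "\<lambda>_. 0" 0 t] by simp

lemma Li'_bound:
  assumes f: "continuous_on UNIV f" "\<And>t. \<bar>f t\<bar> \<le> D * m2 t"
  shows "\<bar>Li' f t\<bar> \<le> L2 * D * m2 t"
  using Li'_diff[OF f, of "\<lambda>_. 0" 0 D t] f(2) by (simp add: Li'_def Li_0)

definition ball :: "(real \<Rightarrow> real) \<Rightarrow> bool" where
  "ball f \<longleftrightarrow> continuous_on UNIV f \<and> (\<forall>t. \<bar>f t\<bar> \<le> 1 * m2 t)"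

text \<open>The candidate front belonging to the forcing \<open>f\<close>. Parametrizing by
  \<open>f\<close> rather than by the correction makes every candidate differentiable with a
  derivative \<open>X'\<close> controlled by the same norm, and gives all candidates the same
  leading term A exp(lam t) at minus infinity.\<close>

definition X :: "(real \<Rightarrow> real) \<Rightarrow> real \<Rightarrow> real" where "X f t = psi t + Li f t"
definition X' :: "(real \<Rightarrow> real) \<Rightarrow> real \<Rightarrow> real" where "X' f t = psi' t + Li' f t"

lemma ballD: assumes "ball f" shows "continuous_on UNIV f" "\<And>t. \<bar>f t\<bar> \<le> 1 * m2 t"
  using assms by (auto simp: ball_def)

lemma X_deriv: "ball f \<Longrightarrow> (X f has_real_derivative X' f t) (at t)"
  unfolding X_def[abs_def] X'_def by (intro DERIV_add psi_deriv Li_deriv[OF ballD]) auto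

lemma X_cont: "ball f \<Longrightarrow> continuous_on UNIV (X f)"
  unfolding continuous_on_eq_continuous_at[OF open_UNIV] by (blast intro: DERIV_isCont[OF X_deriv])

lemma X_bound: "ball f \<Longrightarrow> \<bar>X f t\<bar> \<le> R * m1 t"
proof -
  assume f: "ball f"
  have "L * m2 t \<le> L * m1 t" using m2_le_m1 L by (intro mult_left_mono) auto
  then show ?thesis using Li(2)[OF ballD[OF f], of t] psi_M[of t] psi_pos[of t]
    by (simp add: X_def R_def distrib_right)
qed

lemma X_R: "ball f \<Longrightarrow> \<bar>X f t\<bar> \<le> M + L"
proof -
  assume f: "ball f"
  have "R * m1 t \<le> R * 1" using R m1_le_1 by (intro mult_left_mono) auto
  then show ?thesis using X_bound[OF f, of t] by (simp add: R_def)
qed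

lemma X'_bound: "ball f \<Longrightarrow> \<bar>X' f t\<bar> \<le> (M + L2) * m1 t"
proof -
  assume f: "ball f"
  have "L2 * m2 t \<le> L2 * m1 t" using m2_le_m1 L2 by (intro mult_left_mono) auto
  then show ?thesis using Li'_bound[OF ballD[OF f], of t] psi'_M[of t]
    by (simp add: X'_def distrib_right)
qed

lemma X_A: "ball f \<Longrightarrow> \<bar>X f t - A * exp (lam * t)\<bar> \<le> (M + L) * exp (2 * lam * t)"
proof -
  assume f: "ball f"
  have "L * m2 t \<le> L * exp (2 * lam * t)" using m2_le_exp L by (intro mult_left_mono) auto
  then show ?thesis using Li(2)[OF ballD[OF f], of t] psi_A[of t]
    by (simp add: X_def distrib_right)
qed

lemma X'_A: "ball f \<Longrightarrow> \<bar>X' f t - A * lam * exp (lam * t)\<bar> \<le> (M + L2) * exp (2 * lam * t)"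
proof -
  assume f: "ball f"
  have "L2 * m2 t \<le> L2 * exp (2 * lam * t)" using m2_le_exp L2 by (intro mult_left_mono) auto
  then show ?thesis using Li'_bound[OF ballD[OF f], of t] psi'_A[of t]
    by (simp add: X'_def distrib_right)
qed

lemma G_lip_R: "\<bar>x\<bar> \<le> M + L \<Longrightarrow> \<bar>y\<bar> \<le> M + L \<Longrightarrow> \<bar>G x - G y\<bar> \<le> B * \<bar>x - y\<bar>"
  by (rule G_lipschitz[OF B(2)])

lemma G_bound_R: "\<bar>x\<bar> \<le> M + L \<Longrightarrow> \<bar>G x\<bar> \<le> B * \<bar>x\<bar>"
  using G_lip_R[of x 0] M L by (simp add: G0)

lemma lipschitz_weight:
  fixes f f' :: "real \<Rightarrow> real"
  assumes "\<And>t. (f has_real_derivative f' t) (at t)" "\<And>t. \<bar>f' t\<bar> \<le> C * m t" "weight m" "C \<ge> 0"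
  shows "\<bar>f x - f y\<bar> \<le> C * \<bar>x - y\<bar> * m (max x y)"
proof -
  obtain z where z: "min x y \<le> z" "z \<le> max x y" "f x - f y = f' z * (x - y)" using mvt_between[OF assms(1)] by blast
  have "C * m z \<le> C * m (max x y)" using assms(3,4) z(2) by (intro mult_left_mono) (auto simp: weight_def)
  then have "\<bar>f' z\<bar> * \<bar>x - y\<bar> \<le> (C * m (max x y)) * \<bar>x - y\<bar>"
    using assms(2)[of z] by (intro mult_right_mono) auto
  then show ?thesis using z(3) by (simp add: abs_mult mult_ac)
qed

lemma GX_deriv: "ball f \<Longrightarrow> ((\<lambda>t. G (X f t)) has_real_derivative G' (X f t) * X' f t) (at t)"
  by (rule DERIV_chain2[OF dG X_deriv])

lemma GX_cont: "ball f \<Longrightarrow> continuous_on UNIV (\<lambda>t. G (X f t))"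
  by (intro continuous_on_compose2[OF G_cont] X_cont) auto

text \<open>\<open>N f = f\<close> says that \<open>X' f\<close> equals (average - X) / ka, because
  the equation for \<open>Li f\<close> reads f = Li' + Li - b Li(t - h). At the base parameters the
  linear part cancels, and \<open>N f\<close> is the nonlinear remainder of \<open>G\<close> along
  psi.\<close>

definition N :: "real \<Rightarrow> real \<Rightarrow> real \<Rightarrow> (real \<Rightarrow> real) \<Rightarrow> real \<Rightarrow> real" where
  "N c th ka f t = Li f t - b t * Li f (t - h) - psi' t + (shifted_avg c th (\<lambda>s. G (X f s)) t - X f t) / ka"

text \<open>Subtracting \<open>p A exp(lam t)\<close>, on which both rescaled equations agree exactly, exhibits the decay
  \<open>exp(2 lam t)\<close> at minus infinity of the effect of changing the parameters.\<close>
lemma N_param: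
  "\<exists>C\<ge>0. \<forall>f c th ka c1 th1 ka1 t. ball f \<longrightarrow> admissible c th ka \<longrightarrow> admissible c1 th1 ka1 \<longrightarrow>
    \<bar>N c th ka f t - N c1 th1 ka1 f t\<bar> \<le> C * (\<bar>c - c1\<bar> + \<bar>th - th1\<bar> + \<bar>ka - ka1\<bar>) * m2 t"
proof -
  define C1 where "C1 = B * (M + L2)"
  define C2 where "C2 = 2 * (C1 * (h + 4)) + (2 * (B * R) + R)"
  define Q1 where "Q1 = Q * R\<^sup>2 + p * R"
  define Q2 where "Q2 = Q * R * (M + L2) + p * (M + L2)"
  define C3 where "C3 = 2 * (Q2 * (h + 4)) + (2 * Q1 + R)"
  have nn: "C1 \<ge> 0" "Q1 \<ge> 0" "Q2 \<ge> 0" unfolding C1_def Q1_def Q2_def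
    using B(1) M L2 Q(1) R(1) p1 by (auto intro!: add_nonneg_nonneg mult_nonneg_nonneg)
  have nn2: "C2 \<ge> 0" "C3 \<ge> 0" unfolding C2_def C3_def
    using nn B(1) R(1) h by (auto intro!: add_nonneg_nonneg mult_nonneg_nonneg)
  have main: "\<bar>N c th ka f t - N c1 th1 ka1 f t\<bar> \<le> max C2 C3 * (\<bar>c - c1\<bar> + \<bar>th - th1\<bar> + \<bar>ka - ka1\<bar>) * m2 t"
    if f: "ball f" and admissible: "admissible c th ka" and ok1: "admissible c1 th1 ka1" for f c th ka c1 th1 ka1 t
  proof -
    define \<delta> where "\<delta> = \<bar>c - c1\<bar> + \<bar>th - th1\<bar> + \<bar>ka - ka1\<bar>"
    have \<delta>: "\<delta> \<ge> 0" "\<bar>c - c1\<bar> + \<bar>th - th1\<bar> \<le> \<delta>" "\<bar>ka - ka1\<bar> \<le> \<delta>" by (auto simp: \<delta>_def)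
    let ?Y = "\<lambda>s. G (X f s)"
    have ka: "ka \<ge> 1" "ka1 \<ge> 1" using admissible ok1 by (auto simp: admissible_def)
    have kad: "\<bar>1 / ka - 1 / ka1\<bar> \<le> \<delta>"
    proof -
      have "1 / ka - 1 / ka1 = (ka1 - ka) / (ka * ka1)" using ka by (simp add: field_simps)
      then have "\<bar>1 / ka - 1 / ka1\<bar> = \<bar>ka - ka1\<bar> / (ka * ka1)" using ka by (simp add: abs_minus_commute)
      also have "\<dots> \<le> \<bar>ka - ka1\<bar> / 1"
      proof (rule divide_left_mono)
        show "1 \<le> ka * ka1" using mult_mono[of 1 ka 1 ka1] ka by simp
      qed (use ka in auto)
      finally show ?thesis using \<delta> by simp
    qed
    have split: "\<bar>(S - x) / ka - (S1 - x) / ka1\<bar> \<le> \<bar>S - S1\<bar> + \<delta> * \<bar>S1 - x\<bar>" for S S1 x :: real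
    proof -
      have "(S - x) / ka - (S1 - x) / ka1 = (S - S1) / ka + (1 / ka - 1 / ka1) * (S1 - x)"
        using ka by (simp add: field_simps)
      moreover have "\<bar>(S - S1) / ka\<bar> \<le> \<bar>S - S1\<bar>" using ka by (simp add: divide_le_eq mult_le_cancel_left1)
      moreover have "\<bar>(1 / ka - 1 / ka1) * (S1 - x)\<bar> \<le> \<delta> * \<bar>S1 - x\<bar>"
        unfolding abs_mult using kad by (intro mult_right_mono) auto
      ultimately show ?thesis by linarith
    qed
    have Nd: "N c th ka f t - N c1 th1 ka1 f t = (shifted_avg c th ?Y t - X f t) / ka - (shifted_avg c1 th1 ?Y t - X f t) / ka1"
      by (simp add: N_def)
    have m1R: "R * m1 s \<le> R" for s using m1_le_1[of s] R by (simp add: mult_left_le)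
    have YB: "\<bar>?Y s\<bar> \<le> B * R * 1" for s
    proof -
      have "\<bar>?Y s\<bar> \<le> B * \<bar>X f s\<bar>" by (rule G_bound_R[OF X_R[OF f]])
      also have "\<dots> \<le> B * R" using X_bound[OF f, of s] m1R[of s] B(1) by (intro mult_left_mono) auto
      finally show ?thesis by simp
    qed
    have BR: "B * R \<ge> 0" using B R by simp
    \<comment> \<open>This bound carries no decay and is the better one for positive times;
      \<open>two\<close> below decays at minus infinity, and the minimum of both is a multiple of
      \<open>m2\<close>.\<close>
    have one: "\<bar>N c th ka f t - N c1 th1 ka1 f t\<bar> \<le> C2 * \<delta> * 1"
    proof -
      have "\<bar>shifted_avg c th ?Y t - shifted_avg c1 th1 ?Y t\<bar> \<le> 2 * (C1 * (h + 4) * (\<bar>c - c1\<bar> + \<bar>th - th1\<bar>) + 0) * 1"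
      proof (rule shifted_avg_param[OF weight_1 admissible ok1 GX_cont[OF f] weight_1 YB BR _ nn(1)])
        fix a b
        have "\<bar>?Y a - ?Y b\<bar> \<le> C1 * \<bar>a - b\<bar> * 1"
        proof (rule lipschitz_weight[OF GX_deriv[OF f] _ weight_1 nn(1)])
          fix t
          have "\<bar>X' f t\<bar> \<le> (M + L2) * 1"
            using X'_bound[OF f, of t] mult_left_mono[OF m1_le_1[of t], of "M + L2"] M L2 by linarith
          then show "\<bar>G' (X f t) * X' f t\<bar> \<le> C1 * 1"
            unfolding abs_mult C1_def using B(2)[OF X_R[OF f, of t]] B(1) by (auto intro!: mult_mono)
        qed
        then show "\<bar>?Y a - ?Y b\<bar> \<le> (C1 * \<bar>a - b\<bar> + 0) * 1" by simp
      qed auto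
      also have "\<dots> \<le> 2 * (C1 * (h + 4) * \<delta>)" using \<delta> nn h by (auto intro!: mult_left_mono)
      finally have 1: "\<bar>shifted_avg c th ?Y t - shifted_avg c1 th1 ?Y t\<bar> \<le> 2 * (C1 * (h + 4)) * \<delta>" by simp
      have "\<bar>shifted_avg c1 th1 ?Y t\<bar> \<le> 2 * (B * R) * 1" by (rule shifted_avg_bound[OF weight_1 ok1 GX_cont[OF f] YB BR])
      then have "\<bar>shifted_avg c1 th1 ?Y t - X f t\<bar> \<le> 2 * (B * R) + R" using X_bound[OF f, of t] m1R[of t] by linarith
      then have "\<delta> * \<bar>shifted_avg c1 th1 ?Y t - X f t\<bar> \<le> \<delta> * (2 * (B * R) + R)" using \<delta> by (intro mult_left_mono) auto
      then show ?thesis unfolding Nd using split[of "shifted_avg c th ?Y t" "X f t" "shifted_avg c1 th1 ?Y t"] 1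
        by (simp add: C2_def algebra_simps)
    qed
    let ?e = "\<lambda>s. p * A * exp (lam * s)"
    let ?Q = "\<lambda>s. G (X f s) - p * A * exp (lam * s)"
    have Qc: "continuous_on UNIV ?Q" by (intro continuous_intros GX_cont f)
    have ec: "continuous_on UNIV ?e" by (intro continuous_intros)
    have X2: "(X f s)\<^sup>2 \<le> R\<^sup>2 * exp (2 * lam * s)" for s
    proof -
      have "(X f s)\<^sup>2 \<le> (R * m1 s)\<^sup>2" using X_bound[OF f, of s] abs_le_square_iff[of "X f s" "R * m1 s"] by simp
      also have "\<dots> = R\<^sup>2 * m2 s" by (simp add: power_mult_distrib m1_square)
      also have "\<dots> \<le> R\<^sup>2 * exp (2 * lam * s)" using m2_le_exp by (intro mult_left_mono) auto
      finally show ?thesis .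
    qed
    have Q1b: "\<bar>?Q s\<bar> \<le> Q1 * exp (2 * lam * s)" for s
    proof -
      have "\<bar>G (X f s) - p * X f s\<bar> \<le> Q * (X f s)\<^sup>2" by (rule G_quadratic[OF Q(2,1) X_R[OF f]])
      also have "\<dots> \<le> Q * (R\<^sup>2 * exp (2 * lam * s))" using X2 Q(1) by (intro mult_left_mono) auto
      finally have 1: "\<bar>G (X f s) - p * X f s\<bar> \<le> Q * (R\<^sup>2 * exp (2 * lam * s))" .
      have 2: "\<bar>p * (X f s - A * exp (lam * s))\<bar> \<le> p * (R * exp (2 * lam * s))"
        unfolding abs_mult using X_A[OF f, of s] p1 by (intro mult_mono) (auto simp: R_def)
      have "?Q s = (G (X f s) - p * X f s) + p * (X f s - A * exp (lam * s))" by (simp add: algebra_simps)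
      then have "\<bar>?Q s\<bar> \<le> Q * (R\<^sup>2 * exp (2 * lam * s)) + p * (R * exp (2 * lam * s))" using 1 2 by linarith
      then show ?thesis by (simp add: Q1_def algebra_simps)
    qed
    have wte: "weight (\<lambda>t. exp (2 * lam * t))" and wte1: "weight (\<lambda>t. exp (lam * t))" using lam by (auto intro!: weight_exp)
    have Qd: "(?Q has_real_derivative (G' (X f s) * X' f s - p * A * lam * exp (lam * s))) (at s)" for s
      by (auto intro!: derivative_eq_intros GX_deriv[OF f])
    have Q2b: "\<bar>G' (X f s) * X' f s - p * A * lam * exp (lam * s)\<bar> \<le> Q2 * exp (2 * lam * s)" for s
    proof -
      have "\<bar>G' (X f s) - p\<bar> \<le> Q * (R * m1 s)"
        using Q(2)[OF X_R[OF f, of s]] mult_left_mono[OF X_bound[OF f, of s] Q(1)] by linarith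
      then have "\<bar>(G' (X f s) - p) * X' f s\<bar> \<le> Q * (R * m1 s) * ((M + L2) * m1 s)"
        unfolding abs_mult using X'_bound[OF f, of s] Q(1) R m1_pos[of s] by (intro mult_mono) auto
      also have "\<dots> = Q * R * (M + L2) * m2 s" by (simp add: m1_square[symmetric] power2_eq_square)
      also have "\<dots> \<le> Q * R * (M + L2) * exp (2 * lam * s)"
        using m2_le_exp Q(1) R M L2 by (intro mult_left_mono) auto
      finally have 1: "\<bar>(G' (X f s) - p) * X' f s\<bar> \<le> Q * R * (M + L2) * exp (2 * lam * s)" .
      have 2: "\<bar>p * (X' f s - A * lam * exp (lam * s))\<bar> \<le> p * ((M + L2) * exp (2 * lam * s))"
        unfolding abs_mult using X'_A[OF f, of s] p1 by (intro mult_mono) auto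
      have "G' (X f s) * X' f s - p * A * lam * exp (lam * s) = (G' (X f s) - p) * X' f s + p * (X' f s - A * lam * exp (lam * s))"
        by (simp add: algebra_simps)
      moreover have "Q2 * exp (2 * lam * s) = Q * R * (M + L2) * exp (2 * lam * s) + p * ((M + L2) * exp (2 * lam * s))"
        by (simp add: Q2_def algebra_simps)
      ultimately show ?thesis using 1 2 by linarith
    qed
    \<comment> \<open>Admissibility is used here: the average of p A exp(lam s) is (ka lam + 1) A
      exp(lam t). After subtracting A exp(lam t) and dividing by \<open>ka\<close> what remains is
      lam A exp(lam t), free of the parameters, so it cancels in the difference.\<close>
    have ShY: "shifted_avg c th ?Y t = shifted_avg c th ?Q t + (ka * lam + 1) * (A * exp (lam * t))" if admissible: "admissible c th ka" for c th ka
    proof -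
      have "shifted_avg c th (\<lambda>s. ?Y s - ?e s) t = shifted_avg c th ?Y t - shifted_avg c th ?e t"
        by (rule shifted_avg_diff[OF admissible weight_1 GX_cont[OF f] YB BR wte1 ec, where C' = "p * A"]) (use p1 A in \<open>auto simp: abs_mult\<close>)
      moreover have "shifted_avg c th ?e t = (ka * lam + 1) * (A * exp (lam * t))"
      proof -
        have "8 * (th * lam) \<le> 1" using admissible by (simp add: admissible_def mult_ac)
        then have "th * lam < 1" by linarith
        from avg_exp[OF this, of "t - c * h"] have "avg th (\<lambda>s. exp (lam * s)) (t - c * h) = exp (lam * (t - c * h)) / (1 - th * lam)" .
        moreover have "avg th ?e (t - c * h) = p * A * avg th (\<lambda>s. exp (lam * s)) (t - c * h)"
          unfolding avg_def mult.left_commute[of "exp (- _)"] by (simp add: mult.assoc)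
        ultimately have "shifted_avg c th ?e t = p * A * (exp (lam * (t - c * h)) / (1 - th * lam))" by (simp add: shifted_avg_def)
        also have "exp (lam * (t - c * h)) = exp (- lam * (c * h)) * exp (lam * t)" by (simp add: exp_add[symmetric] algebra_simps)
        also have "p * A * (exp (- lam * (c * h)) * exp (lam * t) / (1 - th * lam)) = (p * exp (- lam * (c * h)) / (1 - th * lam)) * (A * exp (lam * t))"
          by simp
        also have "p * exp (- lam * (c * h)) / (1 - th * lam) = ka * lam + 1" using admissible by (simp add: admissible_def)
        finally show ?thesis .
      qed
      ultimately show ?thesis by simp
    qed
    have two: "\<bar>N c th ka f t - N c1 th1 ka1 f t\<bar> \<le> C3 * \<delta> * exp (2 * lam * t)"
    proof -
      define x where "x = X f t - A * exp (lam * t)"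
      have xe: "\<bar>x\<bar> \<le> R * exp (2 * lam * t)" unfolding x_def R_def by (rule X_A[OF f])
      have z: "(shifted_avg c th ?Y t - X f t) / ka = (shifted_avg c th ?Q t - x) / ka + lam * (A * exp (lam * t))" if "admissible c th ka" for c th ka
      proof -
        have "ka \<ge> 1" using that by (auto simp: admissible_def)
        moreover have "shifted_avg c th ?Y t - X f t = (shifted_avg c th ?Q t - x) + ka * (lam * (A * exp (lam * t)))"
          unfolding ShY[OF that] x_def by (simp add: algebra_simps)
        ultimately show ?thesis by (simp add: add_divide_distrib)
      qed
      have "\<bar>shifted_avg c th ?Q t - shifted_avg c1 th1 ?Q t\<bar> \<le> 2 * (Q2 * (h + 4) * (\<bar>c - c1\<bar> + \<bar>th - th1\<bar>) + 0) * exp (2 * lam * t)"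
      proof (rule shifted_avg_param[OF wte admissible ok1 Qc wte Q1b nn(2) _ nn(3)])
        fix a b
        show "\<bar>?Q a - ?Q b\<bar> \<le> (Q2 * \<bar>a - b\<bar> + 0) * exp (2 * lam * max a b)"
          using lipschitz_weight[OF Qd Q2b wte nn(3), of a b] by simp
      qed auto
      also have "\<dots> \<le> 2 * (Q2 * (h + 4)) * \<delta> * exp (2 * lam * t)" using \<delta> nn h by (auto intro!: mult_right_mono mult_left_mono)
      finally have 1: "\<bar>shifted_avg c th ?Q t - shifted_avg c1 th1 ?Q t\<bar> \<le> 2 * (Q2 * (h + 4)) * \<delta> * exp (2 * lam * t)" .
      have "\<bar>shifted_avg c1 th1 ?Q t\<bar> \<le> 2 * Q1 * exp (2 * lam * t)" by (rule shifted_avg_bound[OF wte ok1 Qc Q1b nn(2)])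
      then have "\<bar>shifted_avg c1 th1 ?Q t - x\<bar> \<le> (2 * Q1 + R) * exp (2 * lam * t)" using xe by (simp add: distrib_right)
      then have "\<delta> * \<bar>shifted_avg c1 th1 ?Q t - x\<bar> \<le> \<delta> * ((2 * Q1 + R) * exp (2 * lam * t))" using \<delta> by (intro mult_left_mono) auto
      then show ?thesis unfolding Nd z[OF admissible] z[OF ok1] using split[of "shifted_avg c th ?Q t" x "shifted_avg c1 th1 ?Q t"] 1
        by (simp add: C3_def algebra_simps)
    qed
    have "C2 * \<delta> * 1 \<le> max C2 C3 * \<delta> * 1" "C3 * \<delta> * exp (2 * lam * t) \<le> max C2 C3 * \<delta> * exp (2 * lam * t)"
      using \<delta> by (auto intro!: mult_right_mono)
    then have "\<bar>N c th ka f t - N c1 th1 ka1 f t\<bar> \<le> max C2 C3 * \<delta> * m2 t"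
      using one two by (simp add: m2_def min_def)
    then show ?thesis by (simp add: \<delta>_def)
  qed
  show ?thesis by (intro exI[of _ "max C2 C3"] conjI allI impI main) (use nn2 in auto)
qed

text \<open>The difference is split into the effect of \<open>ka\<close>, the effect of
  \<open>c\<close> and \<open>th\<close>, and the linearization error at the base parameters. The
  last is small because candidates are uniformly close to psi and \<open>G'\<close> is uniformly
  continuous on their range; the first two because the parameters are near the base. As
  \<open>G'\<close> has only a modulus of continuity, the middle term also keeps a multiple of
  \<eta> that does not vanish with the parameters.\<close>

lemma N_contraction:
  "\<exists>\<rho>>0. \<exists>s0>0. \<rho> \<le> 1 \<and> (\<forall>f1 f2 D c th ka t. continuous_on UNIV f1 \<longrightarrow> (\<forall>t. \<bar>f1 t\<bar> \<le> \<rho> * m2 t) \<longrightarrow>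
    continuous_on UNIV f2 \<longrightarrow> (\<forall>t. \<bar>f2 t\<bar> \<le> \<rho> * m2 t) \<longrightarrow> (\<forall>t. \<bar>f1 t - f2 t\<bar> \<le> D * m2 t) \<longrightarrow>
    admissible c th ka \<longrightarrow> \<bar>c - 1\<bar> + \<bar>th\<bar> + \<bar>ka - 1\<bar> \<le> s0 \<longrightarrow>
    \<bar>N c th ka f1 t - N c th ka f2 t\<bar> \<le> 1 / 2 * D * m2 t)"
proof -
  \<comment> \<open>The remainder enters six times through the averages and once through the
    linearization error, each time as \<eta> L; the seven together make 1/4, and the parameter
    effects, bounded by s0 S, make the other 1/4.\<close>
  define \<eta> where "\<eta> = 1 / (28 * L)"
  have \<eta>: "\<eta> > 0" "7 * (\<eta> * L) = 1 / 4" using L by (auto simp: \<eta>_def)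
  have "uniformly_continuous_on {-(M + L)..M + L} G'"
    by (intro compact_uniformly_continuous continuous_on_subset[OF G'c]) auto
  then obtain \<delta> where \<delta>: "\<delta> > 0"
    and uc: "\<And>x y. x \<in> {-(M + L)..M + L} \<Longrightarrow> y \<in> {-(M + L)..M + L} \<Longrightarrow> \<bar>y - x\<bar> < \<delta> \<Longrightarrow> \<bar>G' y - G' x\<bar> < \<eta>"
    unfolding uniformly_continuous_on_def dist_real_def using \<eta>(1) by meson
  have near: "\<bar>G' x - G' y\<bar> \<le> \<eta>" if "\<bar>x\<bar> \<le> M + L" "\<bar>y\<bar> \<le> M + L" "\<bar>x - y\<bar> < \<delta>" for x y
    using uc[of y x] that by (auto simp: abs_le_iff)
  \<comment> \<open>Uniform continuity in Lipschitz form: beyond distance \<delta> the trivial bound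
    2 B is dominated by a multiple of the distance, and below it the error is at most
    \<eta>.\<close>
  define Cd where "Cd = 2 * B / \<delta>"
  have Cd0: "Cd \<ge> 0" using B(1) \<delta> by (simp add: Cd_def)
  have far: "\<bar>G' x - G' y\<bar> \<le> \<eta> + Cd * \<bar>x - y\<bar>" if "\<bar>x\<bar> \<le> M + L" "\<bar>y\<bar> \<le> M + L" for x y
  proof (cases "\<bar>x - y\<bar> < \<delta>")
    case True
    have "0 \<le> Cd * \<bar>x - y\<bar>" using Cd0 by simp
    then show ?thesis using near[OF that True] by linarith
  next
    case False
    have "\<bar>G' x - G' y\<bar> \<le> 2 * B" using B(2)[OF that(1)] B(2)[OF that(2)] by linarith
    also have "\<dots> = Cd * \<delta>" using \<delta> by (simp add: Cd_def)
    also have "\<dots> \<le> Cd * \<bar>x - y\<bar>" using False Cd0 by (intro mult_left_mono) auto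
    finally show ?thesis using \<eta> by linarith
  qed
  \<comment> \<open>The radius keeps |Li f| below \<delta>, so mean value points between two
    candidates stay \<delta>-close to psi.\<close>
  define \<rho> where "\<rho> = min 1 (\<delta> / (2 * L))"
  have \<rho>: "\<rho> > 0" "\<rho> \<le> 1" using \<delta> L by (auto simp: \<rho>_def)
  have L\<rho>: "L * \<rho> < \<delta>"
  proof -
    have "L * \<rho> \<le> L * (\<delta> / (2 * L))" using L by (intro mult_left_mono) (auto simp: \<rho>_def)
    also have "\<dots> = \<delta> / 2" using L by simp
    finally show ?thesis using \<delta> by simp
  qed
  define C where "C = B * L2 + Cd * M * L"
  have C0: "C \<ge> 0" using B(1) L2 Cd0 M L by (simp add: C_def)
  define S where "S = L + 2 * B * L + 2 * C * (h + 4)"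
  have S: "S \<ge> 1" unfolding S_def using L B(1) C0 h by (simp add: add_increasing2)
  define s0 where "s0 = 1 / (4 * S)"
  have s0: "s0 > 0" "s0 * S = 1 / 4" using S by (auto simp: s0_def)
  have "\<bar>N c th ka f1 t - N c th ka f2 t\<bar> \<le> 1 / 2 * D * m2 t"
    if f1: "continuous_on UNIV f1" "\<And>t. \<bar>f1 t\<bar> \<le> \<rho> * m2 t" and f2: "continuous_on UNIV f2" "\<And>t. \<bar>f2 t\<bar> \<le> \<rho> * m2 t"
      and d: "\<And>t. \<bar>f1 t - f2 t\<bar> \<le> D * m2 t" and admissible: "admissible c th ka" and small: "\<bar>c - 1\<bar> + \<bar>th\<bar> + \<bar>ka - 1\<bar> \<le> s0"
    for f1 f2 D c th ka t
  proof -
    have "0 \<le> D * m2 0" using d[of 0] by linarith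
    then have D: "D \<ge> 0" using m2_pos[of 0] by (simp add: zero_le_mult_iff)
    have bl: "ball f" if "continuous_on UNIV f" "\<And>t. \<bar>f t\<bar> \<le> \<rho> * m2 t" for f
      unfolding ball_def
    proof (intro conjI allI that)
      fix t
      have "\<rho> * m2 t \<le> 1 * m2 t" using \<rho> m2_pos[of t] by (intro mult_right_mono) auto
      then show "\<bar>f t\<bar> \<le> 1 * m2 t" using that(2)[of t] by linarith
    qed
    note b1 = bl[OF f1] and b2 = bl[OF f2]
    define dw where "dw s = Li f1 s - Li f2 s" for s
    define dG where "dG s = G (X f1 s) - G (X f2 s)" for s
    have dw: "\<bar>dw s\<bar> \<le> L * D * m2 s" for s unfolding dw_def by (rule Li(4)[OF f1 f2 d])
    have dwd: "(dw has_real_derivative (Li' f1 s - Li' f2 s)) (at s)" for s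
      unfolding dw_def[abs_def] by (intro DERIV_diff Li_deriv[OF f1] Li_deriv[OF f2])
    have dw': "\<bar>Li' f1 s - Li' f2 s\<bar> \<le> L2 * D * m2 s" for s by (rule Li'_diff[OF f1 f2 d])
    have Lsmall: "\<bar>Li f s\<bar> < \<delta>" if "continuous_on UNIV f" "\<And>t. \<bar>f t\<bar> \<le> \<rho> * m2 t" for f s
    proof -
      have "L * \<rho> * m2 s \<le> L * \<rho> * 1" using m2_le_1 L \<rho> by (intro mult_left_mono) auto
      then show ?thesis using Li(2)[OF that, of s] L\<rho> by simp
    qed
    have "\<exists>z. \<bar>z\<bar> \<le> M + L \<and> \<bar>z - psi s\<bar> < \<delta> \<and> dG s = G' z * dw s" for s
    proof -
      obtain z where z: "min (X f1 s) (X f2 s) \<le> z" "z \<le> max (X f1 s) (X f2 s)"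
          "G (X f1 s) - G (X f2 s) = G' z * (X f1 s - X f2 s)"
        using mvt_between[OF dG] by blast
      have "\<bar>z\<bar> \<le> M + L" using z(1,2) X_R[OF b1, of s] X_R[OF b2, of s] by linarith
      moreover have "\<bar>z - psi s\<bar> < \<delta>" using z(1,2) Lsmall[OF f1, of s] Lsmall[OF f2, of s] unfolding X_def by linarith
      moreover have "X f1 s - X f2 s = dw s" by (simp add: X_def dw_def)
      ultimately show ?thesis using z(3) by (auto simp: dG_def)
    qed
    \<comment> \<open>\<xi> need not be continuous: only its range and its closeness to psi are
      used, and continuity of \<open>dG\<close> is known independently.\<close>
    then obtain \<xi> where \<xi>: "\<And>s. \<bar>\<xi> s\<bar> \<le> M + L" "\<And>s. \<bar>\<xi> s - psi s\<bar> < \<delta>" "\<And>s. dG s = G' (\<xi> s) * dw s" by metis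
    have psiR: "\<bar>psi s\<bar> \<le> M + L" for s
    proof -
      have "M * m1 s \<le> M * 1" using m1_le_1 M by (intro mult_left_mono) auto
      then show ?thesis using psi_M[of s] psi_pos[of s] L by simp
    qed
    have \<xi>\<eta>: "\<bar>G' (\<xi> s) - G' (psi s)\<bar> \<le> \<eta>" for s by (rule near[OF \<xi>(1) psiR \<xi>(2)])
    have LD: "L * D \<ge> 0" using L D by simp
    have dGb: "\<bar>dG s\<bar> \<le> B * (L * D) * m2 s" for s
    proof -
      have "\<bar>dG s\<bar> \<le> B * (L * D * m2 s)" unfolding \<xi>(3) abs_mult using B(2)[OF \<xi>(1)] dw B(1) by (intro mult_mono) auto
      then show ?thesis by (simp add: mult.assoc)
    qed
    have BLD: "B * (L * D) \<ge> 0" using B(1) LD by simp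
    have dGc: "continuous_on UNIV dG" unfolding dG_def by (intro continuous_intros GX_cont b1 b2)
    \<comment> \<open>In the product G'(\<xi>) dw the factor \<open>dw\<close> is Lipschitz by the
      derivative bound, while G'(\<xi> a) - G'(\<xi> b) is compared through psi at the cost of three
      times \<eta>: once at each point and once between psi a and psi b.\<close>
    have dG_ab: "\<bar>dG a - dG b\<bar> \<le> (C * D * \<bar>a - b\<bar> + 3 * \<eta> * (L * D)) * m2 (max a b)" for a b
    proof -
      define m where "m = m2 (max a b)"
      have m: "m \<ge> 0" "m2 b \<le> m" unfolding m_def using m2_pos less_imp_le m2_mono by auto
      have "\<bar>dw a - dw b\<bar> \<le> L2 * D * \<bar>a - b\<bar> * m" unfolding m_def
        by (rule lipschitz_weight[OF dwd dw' weight_m2]) (use L2 D in auto)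
      then have 1: "\<bar>G' (\<xi> a) * (dw a - dw b)\<bar> \<le> B * (L2 * D * \<bar>a - b\<bar> * m)"
        unfolding abs_mult using B(2)[OF \<xi>(1)] B(1) by (intro mult_mono) auto
      have pab: "\<bar>psi a - psi b\<bar> \<le> M * \<bar>a - b\<bar>"
      proof -
        have "\<bar>psi' t\<bar> \<le> M * 1" for t using psi'_M[of t] mult_left_mono[OF m1_le_1[of t] less_imp_le[OF M]] by linarith
        from lipschitz_weight[OF psi_deriv this weight_1 less_imp_le[OF M]] show ?thesis by simp
      qed
      have "\<bar>G' (psi a) - G' (psi b)\<bar> \<le> \<eta> + Cd * (M * \<bar>a - b\<bar>)"
        using far[OF psiR psiR, of a b] mult_left_mono[OF pab Cd0] by linarith
      then have "\<bar>G' (\<xi> a) - G' (\<xi> b)\<bar> \<le> 3 * \<eta> + Cd * (M * \<bar>a - b\<bar>)" using \<xi>\<eta>[of a] \<xi>\<eta>[of b] by linarith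
      moreover have "\<bar>dw b\<bar> \<le> L * D * m" using dw[of b] mult_left_mono[OF m(2) LD] by linarith
      ultimately have 2: "\<bar>(G' (\<xi> a) - G' (\<xi> b)) * dw b\<bar> \<le> (3 * \<eta> + Cd * (M * \<bar>a - b\<bar>)) * (L * D * m)"
        unfolding abs_mult using \<eta> Cd0 M by (intro mult_mono) auto
      have "dG a - dG b = G' (\<xi> a) * (dw a - dw b) + (G' (\<xi> a) - G' (\<xi> b)) * dw b" by (simp add: \<xi>(3) algebra_simps)
      then have "\<bar>dG a - dG b\<bar> \<le> B * (L2 * D * \<bar>a - b\<bar> * m) + (3 * \<eta> + Cd * (M * \<bar>a - b\<bar>)) * (L * D * m)" using 1 2 by linarith
      also have "\<dots> = (C * D * \<bar>a - b\<bar> + 3 * \<eta> * (L * D)) * m" by (simp add: C_def algebra_simps)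
      finally show ?thesis by (simp add: m_def)
    qed
    have ka: "ka \<ge> 1" using admissible by (simp add: admissible_def)
    define \<sigma> where "\<sigma> = \<bar>c - 1\<bar> + \<bar>th\<bar> + \<bar>ka - 1\<bar>"
    have \<sigma>: "\<sigma> \<ge> 0" "\<sigma> \<le> s0" "\<bar>c - 1\<bar> + \<bar>th - 0\<bar> \<le> \<sigma>" using small by (auto simp: \<sigma>_def)
    have kaa: "\<bar>1 - 1 / ka\<bar> \<le> \<sigma>"
    proof -
      have "1 - 1 / ka = (ka - 1) / ka" using ka by (simp add: field_simps)
      moreover have "(ka - 1) / ka \<le> (ka - 1) / 1" using ka by (intro divide_left_mono) auto
      moreover have "(ka - 1) / ka \<ge> 0" using ka by simp
      ultimately show ?thesis by (simp add: \<sigma>_def)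
    qed
    have t1: "\<bar>(1 - 1 / ka) * (dw t - shifted_avg c th dG t)\<bar> \<le> \<sigma> * ((L + 2 * B * L) * D * m2 t)"
    proof -
      have "\<bar>shifted_avg c th dG t\<bar> \<le> 2 * (B * (L * D)) * m2 t" by (rule shifted_avg_bound[OF weight_m2 admissible dGc dGb BLD])
      then have "\<bar>dw t - shifted_avg c th dG t\<bar> \<le> (L + 2 * B * L) * D * m2 t" using dw[of t] by (simp add: algebra_simps)
      then show ?thesis unfolding abs_mult using kaa \<sigma> by (intro mult_mono) auto
    qed
    have t2: "\<bar>shifted_avg c th dG t - dG (t - h)\<bar> \<le> \<sigma> * (2 * C * (h + 4) * D * m2 t) + 6 * (\<eta> * L) * D * m2 t"
    proof -
      have "\<bar>shifted_avg c th dG t - shifted_avg 1 0 dG t\<bar> \<le> 2 * (C * D * (h + 4) * (\<bar>c - 1\<bar> + \<bar>th - 0\<bar>) + 3 * \<eta> * (L * D)) * m2 t"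
        by (rule shifted_avg_param[OF weight_m2 admissible admissible_base dGc weight_m2 dGb BLD dG_ab]) (use C0 D \<eta> L in auto)
      also have "\<dots> \<le> 2 * (C * D * (h + 4) * \<sigma> + 3 * \<eta> * (L * D)) * m2 t"
        using \<sigma> C0 D h m2_pos[of t] by (intro mult_right_mono mult_left_mono add_right_mono) auto
      also have "\<dots> = \<sigma> * (2 * C * (h + 4) * D * m2 t) + 6 * (\<eta> * L) * D * m2 t" by (simp add: algebra_simps)
      finally show ?thesis by simp
    qed
    have t3: "\<bar>dG (t - h) - b t * dw (t - h)\<bar> \<le> (\<eta> * L) * D * m2 t"
    proof -
      have "dG (t - h) - b t * dw (t - h) = (G' (\<xi> (t - h)) - G' (psi (t - h))) * dw (t - h)" by (simp add: \<xi>(3) b_def algebra_simps)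
      then have "\<bar>dG (t - h) - b t * dw (t - h)\<bar> \<le> \<eta> * (L * D * m2 (t - h))"
        using \<xi>\<eta>[of "t - h"] dw[of "t - h"] \<eta> by (auto simp: abs_mult intro!: mult_mono)
      also have "\<dots> \<le> \<eta> * (L * D * m2 t)" using m2_mono[of "t - h" t] h LD \<eta> by (intro mult_left_mono) auto
      finally show ?thesis by (simp add: mult.assoc)
    qed
    have ShdG: "shifted_avg c th dG t = shifted_avg c th (\<lambda>s. G (X f1 s)) t - shifted_avg c th (\<lambda>s. G (X f2 s)) t"
    proof -
      have BR: "\<bar>G (X f s)\<bar> \<le> B * (M + L) * 1" if "ball f" for f s
      proof -
        have "B * \<bar>X f s\<bar> \<le> B * (M + L)" using X_R[OF that] B(1) by (intro mult_left_mono) auto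
        then show ?thesis using G_bound_R[OF X_R[OF that], of s] by simp
      qed
      show ?thesis unfolding dG_def
        by (rule shifted_avg_diff[OF admissible weight_1 GX_cont[OF b1] BR[OF b1] _ weight_1 GX_cont[OF b2] BR[OF b2]]) (use B(1) M L in auto)
    qed
    have "N c th ka f1 t - N c th ka f2 t = (1 - 1 / ka) * (dw t - shifted_avg c th dG t) + (shifted_avg c th dG t - dG (t - h)) + (dG (t - h) - b t * dw (t - h))"
      unfolding ShdG N_def X_def dw_def using ka by (simp add: field_simps)
    then have "\<bar>N c th ka f1 t - N c th ka f2 t\<bar> \<le> \<sigma> * ((L + 2 * B * L) * D * m2 t) + (\<sigma> * (2 * C * (h + 4) * D * m2 t) + 6 * (\<eta> * L) * D * m2 t) + (\<eta> * L) * D * m2 t"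
      using t1 t2 t3 by linarith
    also have "\<dots> = \<sigma> * S * (D * m2 t) + 7 * (\<eta> * L) * (D * m2 t)" by (simp add: S_def algebra_simps)
    also have "\<dots> \<le> s0 * S * (D * m2 t) + 7 * (\<eta> * L) * (D * m2 t)"
      using \<sigma> S D m2_pos[of t] by (intro add_right_mono mult_right_mono) auto
    also have "\<dots> = 1 / 2 * D * m2 t" unfolding s0 \<eta>(2) by simp
    finally show ?thesis .
  qed
  then show ?thesis using \<rho> s0 by blast
qed

section \<open>Fixed points of N and their dependence on the parameters\<close>

lemma shifted_avg_cont:
  assumes Y: "continuous_on UNIV Y" and bd: "\<And>s. \<bar>Y s\<bar> \<le> C"
  shows "continuous_on UNIV (shifted_avg c th Y)"
proof (cases "th = 0")
  case True
  then show ?thesis unfolding shifted_avg_def[abs_def] by (auto intro!: continuous_intros continuous_on_compose2[OF Y])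
next
  case False
  have "(avg th Y has_real_derivative (avg th Y t - Y t) / th) (at t)" for t
    by (rule avg_derivative[OF Y False, of 0]) (use bd in auto)
  then have "continuous_on UNIV (avg th Y)"
    unfolding continuous_on_eq_continuous_at[OF open_UNIV] by (blast intro: DERIV_isCont)
  then show ?thesis unfolding shifted_avg_def[abs_def] by (rule continuous_on_compose2) (auto intro!: continuous_intros)
qed

lemma GX_bound: "ball f \<Longrightarrow> \<bar>G (X f s)\<bar> \<le> B * (M + L)"
proof -
  assume f: "ball f"
  have "B * \<bar>X f s\<bar> \<le> B * (M + L)" using X_R[OF f] B(1) by (intro mult_left_mono) auto
  then show ?thesis using G_bound_R[OF X_R[OF f], of s] by simp
qed

lemma Li_cont: "ball f \<Longrightarrow> continuous_on UNIV (Li f)"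
  using DERIV_isCont[OF Li_deriv[OF ballD]] by (auto simp: continuous_on_eq_continuous_at)

lemma N_cont:
  assumes f: "ball f" and ka: "ka \<noteq> 0"
  shows "continuous_on UNIV (N c th ka f)"
  unfolding N_def[abs_def]
  by (intro continuous_intros Li_cont[OF f] b_cont psi'_cont X_cont[OF f] continuous_on_compose2[OF Li_cont[OF f]]
    shifted_avg_cont[OF GX_cont[OF f] GX_bound[OF f]]) (use ka in auto)

lemma filterlim_shift: "filterlim (\<lambda>t::real. t - a) at_top at_top"
  by (rule filterlim_at_top_mono[OF filterlim_tendsto_add_at_top[OF tendsto_const[of "-a"] filterlim_ident]]) auto

lemma X_tendsto:
  assumes "ball f" "(f \<longlongrightarrow> 0) at_top"
  shows "(X f \<longlongrightarrow> K) at_top"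
  using tendsto_add[OF psi_K Li(3)[OF ballD[OF assms(1)] assms(2)]] by (simp add: X_def[abs_def])

text \<open>The stationary values cancel because \<open>G K = K\<close>. Convergence of the forcing
  to 0 has to be part of the invariant set, since the fronts must reach \<open>K\<close> and the
  weight alone gives only boundedness.\<close>

lemma N_tendsto:
  assumes f: "ball f" and lim: "(f \<longlongrightarrow> 0) at_top" and admissible: "admissible c th ka"
  shows "(N c th ka f \<longlongrightarrow> 0) at_top"
proof -
  have X: "(X f \<longlongrightarrow> K) at_top" by (rule X_tendsto[OF f lim])
  have Gt: "((\<lambda>t. G (y t)) \<longlongrightarrow> K) at_top" if "(y \<longlongrightarrow> K) at_top" for y :: "real \<Rightarrow> real"
    using isCont_tendsto_compose[OF DERIV_isCont[OF dG] that] by (simp add: GK)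
  have th: "th \<ge> 0" and ka: "ka \<noteq> 0" using admissible by (auto simp: admissible_def)
  have "(avg th (\<lambda>s. G (X f s)) \<longlongrightarrow> K) at_top"
    by (rule avg_tendsto_at_top[OF GX_cont[OF f] Gt[OF X] th GX_bound[OF f]])
  from filterlim_compose[OF this filterlim_shift[of "c * h"]]
  have S: "(shifted_avg c th (\<lambda>s. G (X f s)) \<longlongrightarrow> K) at_top" by (simp add: shifted_avg_def[abs_def])
  have w: "(Li f \<longlongrightarrow> 0) at_top" by (rule Li(3)[OF ballD[OF f] lim])
  have bw: "((\<lambda>t. b t * Li f (t - h)) \<longlongrightarrow> 0) at_top"
  proof (rule Lim_null_comparison)
    show "\<forall>\<^sub>F t in at_top. norm (b t * Li f (t - h)) \<le> B * \<bar>Li f (t - h)\<bar>"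
      using b_B by (intro always_eventually) (auto simp: abs_mult intro!: mult_right_mono)
    have "((\<lambda>t. Li f (t - h)) \<longlongrightarrow> 0) at_top" by (rule filterlim_compose[OF w filterlim_shift])
    then show "((\<lambda>t. B * \<bar>Li f (t - h)\<bar>) \<longlongrightarrow> 0) at_top" by (intro tendsto_mult_right_zero tendsto_rabs_zero)
  qed
  have "((\<lambda>t. psi (t - h)) \<longlongrightarrow> K) at_top" by (rule filterlim_compose[OF psi_K filterlim_shift])
  then have p: "(psi' \<longlongrightarrow> - K + K) at_top" unfolding psi'_def[abs_def] by (intro tendsto_intros psi_K Gt)
  have "((\<lambda>t. Li f t - b t * Li f (t - h) - psi' t + (shifted_avg c th (\<lambda>s. G (X f s)) t - X f t) / ka) \<longlongrightarrow> 0 - 0 - (- K + K) + (K - K) / ka) at_top"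
    by (intro tendsto_intros w bw p S X ka)
  then show ?thesis by (simp add: N_def[abs_def])
qed

lemma N_base_0: "N 1 0 1 (\<lambda>_. 0) t = 0"
  by (simp add: N_def Li_0 X_def psi'_def)

text \<open>Subtracting two fixed point equations improves a bound D to D / 2 plus a multiple of the
  parameter distance, and \<open>self_improving_bound\<close> turns this into Lipschitz dependence.
  At equal parameters the same estimate is uniqueness, which is why the chosen \<open>F\<close>
  vanishes at the base parameters.\<close>

lemma fixed_points:
  "\<exists>s0>0. \<exists>C\<ge>0. \<exists>F. F 1 0 1 = (\<lambda>_. 0) \<and> (\<forall>c th ka. admissible c th ka \<longrightarrow> \<bar>c - 1\<bar> + \<bar>th\<bar> + \<bar>ka - 1\<bar> \<le> s0 \<longrightarrow>
     ball (F c th ka) \<and> (F c th ka \<longlongrightarrow> 0) at_top \<and> (\<forall>t. N c th ka (F c th ka) t = F c th ka t) \<and>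
     (\<forall>c1 th1 ka1. admissible c1 th1 ka1 \<longrightarrow> \<bar>c1 - 1\<bar> + \<bar>th1\<bar> + \<bar>ka1 - 1\<bar> \<le> s0 \<longrightarrow>
       (\<forall>t. \<bar>F c th ka t - F c1 th1 ka1 t\<bar> \<le> C * (\<bar>c - c1\<bar> + \<bar>th - th1\<bar> + \<bar>ka - ka1\<bar>) * m2 t)))"
proof -
  obtain \<rho> s1 where \<rho>: "\<rho> > 0" "\<rho> \<le> 1" and s1: "s1 > 0"
    and contr: "\<And>f1 f2 D c th ka t. continuous_on UNIV f1 \<Longrightarrow> (\<forall>t. \<bar>f1 t\<bar> \<le> \<rho> * m2 t) \<Longrightarrow>
    continuous_on UNIV f2 \<Longrightarrow> (\<forall>t. \<bar>f2 t\<bar> \<le> \<rho> * m2 t) \<Longrightarrow> (\<forall>t. \<bar>f1 t - f2 t\<bar> \<le> D * m2 t) \<Longrightarrow>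
    admissible c th ka \<Longrightarrow> \<bar>c - 1\<bar> + \<bar>th\<bar> + \<bar>ka - 1\<bar> \<le> s1 \<Longrightarrow>
    \<bar>N c th ka f1 t - N c th ka f2 t\<bar> \<le> 1 / 2 * D * m2 t" using N_contraction by blast
  obtain C where C: "C \<ge> 0" and par: "\<And>f c th ka c1 th1 ka1 t. ball f \<Longrightarrow> admissible c th ka \<Longrightarrow> admissible c1 th1 ka1 \<Longrightarrow>
    \<bar>N c th ka f t - N c1 th1 ka1 f t\<bar> \<le> C * (\<bar>c - c1\<bar> + \<bar>th - th1\<bar> + \<bar>ka - ka1\<bar>) * m2 t"
    using N_param by blast
  \<comment> \<open>Half of the radius \<rho> is used up by the contraction and half by
    \<open>N\<close> at the zero forcing, which is at most C s0 times the weight because it vanishes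
    at the base parameters.\<close>
  define s0 where "s0 = min s1 (\<rho> / (2 * (C + 1)))"
  have s0: "s0 > 0" "s0 \<le> s1" using s1 \<rho> C by (auto simp: s0_def)
  have Cs0: "C * s0 \<le> \<rho> / 2"
  proof -
    have "C * s0 \<le> (C + 1) * (\<rho> / (2 * (C + 1)))" using C s0 by (intro mult_mono) (auto simp: s0_def)
    also have "\<dots> = \<rho> / 2" using C by (simp add: field_simps)
    finally show ?thesis .
  qed
  define S where "S = {f. continuous_on UNIV f \<and> (\<forall>t. \<bar>f t\<bar> \<le> \<rho> * m2 t) \<and> (f \<longlongrightarrow> 0) at_top}"
  have Sball: "ball f" if "f \<in> S" for f
  proof -
    have "\<bar>f t\<bar> \<le> 1 * m2 t" for t
    proof -
      have "\<rho> * m2 t \<le> 1 * m2 t" using \<rho> m2_pos[of t] by (intro mult_right_mono) auto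
      moreover have "\<bar>f t\<bar> \<le> \<rho> * m2 t" using that by (simp add: S_def)
      ultimately show ?thesis by linarith
    qed
    then show ?thesis using that by (simp add: ball_def S_def)
  qed
  have zero: "(\<lambda>_. 0) \<in> S" using \<rho> m2_pos by (auto simp: S_def less_imp_le)
  have Sdiff: "\<bar>f t - k t\<bar> \<le> 2 * \<rho> * m2 t" if "f \<in> S" "k \<in> S" for f k t
  proof -
    have "\<bar>f t\<bar> \<le> \<rho> * m2 t" "\<bar>k t\<bar> \<le> \<rho> * m2 t" using that by (auto simp: S_def)
    then show ?thesis by linarith
  qed
  have cS: "\<bar>N c th ka f1 t - N c th ka f2 t\<bar> \<le> 1 / 2 * D * m2 t"
    if "f1 \<in> S" "f2 \<in> S" "\<forall>t. \<bar>f1 t - f2 t\<bar> \<le> D * m2 t" "admissible c th ka" "\<bar>c - 1\<bar> + \<bar>th\<bar> + \<bar>ka - 1\<bar> \<le> s0" for f1 f2 D c th ka t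
    by (rule contr) (use that s0 in \<open>auto simp: S_def\<close>)
  have ex: "\<exists>f\<in>S. \<forall>t. N c th ka f t = f t" if admissible: "admissible c th ka" and small: "\<bar>c - 1\<bar> + \<bar>th\<bar> + \<bar>ka - 1\<bar> \<le> s0" for c th ka
  proof (rule weighted_contraction_fixpoint[where M = m2 and q = "1 / 2", OF m2_pos zero])
    show "N c th ka f \<in> S" if f: "f \<in> S" for f
    proof -
      have "ka \<noteq> 0" using admissible by (auto simp: admissible_def)
      moreover have "\<bar>N c th ka f t\<bar> \<le> \<rho> * m2 t" for t
      proof -
        have "\<bar>f t - 0\<bar> \<le> \<rho> * m2 t" for t using f by (simp add: S_def)
        then have 1: "\<bar>N c th ka f t - N c th ka (\<lambda>_. 0) t\<bar> \<le> 1 / 2 * \<rho> * m2 t"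
          by (intro cS[OF f zero _ admissible small]) auto
        have "\<bar>N c th ka (\<lambda>_. 0) t - N 1 0 1 (\<lambda>_. 0) t\<bar> \<le> C * (\<bar>c - 1\<bar> + \<bar>th - 0\<bar> + \<bar>ka - 1\<bar>) * m2 t"
          by (rule par[OF Sball[OF zero] admissible admissible_base])
        also have "\<dots> \<le> C * s0 * m2 t" using small C m2_pos[of t] by (intro mult_right_mono mult_left_mono) auto
        also have "\<dots> \<le> \<rho> / 2 * m2 t" using Cs0 m2_pos[of t] by (intro mult_right_mono) auto
        finally have "\<bar>N c th ka (\<lambda>_. 0) t\<bar> \<le> \<rho> / 2 * m2 t" by (simp add: N_base_0)
        then show ?thesis using 1 by linarith
      qed
      moreover have "(N c th ka f \<longlongrightarrow> 0) at_top" using f by (intro N_tendsto Sball admissible) (auto simp: S_def)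
      ultimately show ?thesis using N_cont[OF Sball[OF f]] by (simp add: S_def)
    qed
    show "\<exists>D. \<forall>t. \<bar>f t - k t\<bar> \<le> D * m2 t" if "f \<in> S" "k \<in> S" for f k using Sdiff[OF that] by blast
    show "\<forall>t. \<bar>N c th ka f t - N c th ka k t\<bar> \<le> 1 / 2 * D * m2 t" if "f \<in> S" "k \<in> S" "\<forall>t. \<bar>f t - k t\<bar> \<le> D * m2 t" for f k D
      using cS[OF that admissible small] by blast
    show "w \<in> S" if W: "\<And>n. W n \<in> S" and E: "E \<longlonglongrightarrow> 0" and near: "\<And>n t. \<bar>W n t - w t\<bar> \<le> E n * m2 t" for W w E
    proof -
      have "continuous_on UNIV m2" unfolding m2_def by (intro continuous_intros)
      then have c: "continuous_on UNIV w"
        by (intro weighted_limit_continuous[OF _ _ E near]) (use W in \<open>auto simp: S_def\<close>)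
      have b: "\<bar>w t\<bar> \<le> \<rho> * m2 t" for t
      proof (rule tendsto_lowerbound)
        have "(\<lambda>n. (\<rho> + E n) * m2 t) \<longlonglongrightarrow> (\<rho> + 0) * m2 t" by (intro tendsto_intros E)
        then show "(\<lambda>n. (\<rho> + E n) * m2 t) \<longlonglongrightarrow> \<rho> * m2 t" by simp
        have "\<bar>w t\<bar> \<le> (\<rho> + E n) * m2 t" for n
        proof -
          have "\<bar>W n t\<bar> \<le> \<rho> * m2 t" using W[of n] by (simp add: S_def)
          then show ?thesis using near[of n t] by (simp add: distrib_right)
        qed
        then show "\<forall>\<^sub>F n in sequentially. \<bar>w t\<bar> \<le> (\<rho> + E n) * m2 t" by simp
      qed simp
      have l: "(w \<longlongrightarrow> 0) at_top"
      proof (rule tendstoI)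
        fix e :: real assume e: "e > 0"
        from order_tendstoD(2)[OF E, of "e / 2"] e obtain n where n: "E n < e / 2" by (auto simp: eventually_sequentially)
        have "(W n \<longlongrightarrow> 0) at_top" using W[of n] by (simp add: S_def)
        from tendstoD[OF this, of "e / 2"] e have "\<forall>\<^sub>F t in at_top. dist (W n t) 0 < e / 2" by simp
        then show "\<forall>\<^sub>F t in at_top. dist (w t) 0 < e"
        proof eventually_elim
          case (elim t)
          have "0 \<le> E n * m2 t" using near[of n t] by linarith
          then have "0 \<le> E n" using m2_pos[of t] by (simp add: zero_le_mult_iff)
          then have "E n * m2 t \<le> E n * 1" using m2_le_1 by (intro mult_left_mono) auto
          then show ?case using near[of n t] n elim by (simp add: dist_real_def)
        qed
      qed
      show ?thesis using c b l by (simp add: S_def)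
    qed
  qed auto
  have cmp: "\<bar>f t - f1 t\<bar> \<le> 2 * C * (\<bar>c - c1\<bar> + \<bar>th - th1\<bar> + \<bar>ka - ka1\<bar>) * m2 t"
    if admissible: "admissible c th ka" "\<bar>c - 1\<bar> + \<bar>th\<bar> + \<bar>ka - 1\<bar> \<le> s0" and ok1: "admissible c1 th1 ka1" "\<bar>c1 - 1\<bar> + \<bar>th1\<bar> + \<bar>ka1 - 1\<bar> \<le> s0"
      and f: "f \<in> S" "\<And>t. N c th ka f t = f t" and f1: "f1 \<in> S" "\<And>t. N c1 th1 ka1 f1 t = f1 t" for f f1 c th ka c1 th1 ka1 t
  proof -
    let ?E = "C * (\<bar>c - c1\<bar> + \<bar>th - th1\<bar> + \<bar>ka - ka1\<bar>)"
    have "\<bar>f t - f1 t\<bar> \<le> ?E / (1 - 1 / 2) * m2 t"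
    proof (rule self_improving_bound[where S = UNIV and A = "\<lambda>t. \<bar>f t - f1 t\<bar>" and M = m2 and ?D0.0 = "2 * \<rho>"])
      show "\<bar>f x - f1 x\<bar> \<le> 2 * \<rho> * m2 x" for x by (rule Sdiff[OF f(1) f1(1)])
      fix D x assume D: "\<And>x. x \<in> UNIV \<Longrightarrow> \<bar>f x - f1 x\<bar> \<le> D * m2 x"
      have "\<bar>N c th ka f x - N c th ka f1 x\<bar> \<le> 1 / 2 * D * m2 x" by (rule cS[OF f(1) f1(1) _ admissible]) (use D in auto)
      moreover have "\<bar>N c th ka f1 x - N c1 th1 ka1 f1 x\<bar> \<le> ?E * m2 x" by (rule par[OF Sball[OF f1(1)] admissible(1) ok1(1)])
      ultimately show "\<bar>f x - f1 x\<bar> \<le> (1 / 2 * D + ?E) * m2 x" using f(2)[of x] f1(2)[of x]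
        unfolding distrib_right by linarith
    qed auto
    then show ?thesis by simp
  qed
  define F where "F c th ka = (SOME f. f \<in> S \<and> (\<forall>t. N c th ka f t = f t))" for c th ka
  have F: "F c th ka \<in> S \<and> (\<forall>t. N c th ka (F c th ka) t = F c th ka t)" if "admissible c th ka" "\<bar>c - 1\<bar> + \<bar>th\<bar> + \<bar>ka - 1\<bar> \<le> s0" for c th ka
  proof -
    from ex[OF that] have "\<exists>f. f \<in> S \<and> (\<forall>t. N c th ka f t = f t)" by blast
    from someI_ex[OF this] show ?thesis unfolding F_def .
  qed
  have F0: "F 1 0 1 = (\<lambda>_. 0)"
  proof
    fix t
    have small: "\<bar>1 - 1\<bar> + \<bar>0\<bar> + \<bar>1 - 1\<bar> \<le> s0" using s0 by simp
    have "\<bar>F 1 0 1 t - 0\<bar> \<le> 2 * C * (\<bar>1 - 1\<bar> + \<bar>0 - 0\<bar> + \<bar>1 - 1\<bar>) * m2 t"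
      by (rule cmp[OF admissible_base small admissible_base small _ _ zero]) (use F[OF admissible_base small] in \<open>auto simp: N_base_0\<close>)
    then show "F 1 0 1 t = 0" by simp
  qed
  show ?thesis
  proof (rule exI[of _ s0], rule conjI[OF s0(1)], rule exI[of _ "2 * C"], rule conjI, use C in simp, rule exI[of _ F], intro conjI allI impI F0)
    fix c th ka assume admissible: "admissible c th ka" "\<bar>c - 1\<bar> + \<bar>th\<bar> + \<bar>ka - 1\<bar> \<le> s0"
    show "ball (F c th ka)" using F[OF admissible] Sball by blast
    show "(F c th ka \<longlongrightarrow> 0) at_top" using F[OF admissible] by (simp add: S_def)
    show "N c th ka (F c th ka) t = F c th ka t" for t using F[OF admissible] by blast
    fix c1 th1 ka1 t assume ok1: "admissible c1 th1 ka1" "\<bar>c1 - 1\<bar> + \<bar>th1\<bar> + \<bar>ka1 - 1\<bar> \<le> s0"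
    show "\<bar>F c th ka t - F c1 th1 ka1 t\<bar> \<le> 2 * C * (\<bar>c - c1\<bar> + \<bar>th - th1\<bar> + \<bar>ka - ka1\<bar>) * m2 t"
      using F[OF admissible] F[OF ok1] by (intro cmp[OF admissible ok1]) auto
  qed
qed

lemma solution_family:
  "\<exists>s0>0. \<exists>C\<ge>0. \<exists>Y Y'. Y 1 0 1 = psi \<and> Y' 1 0 1 = psi' \<and> (\<forall>c th ka. admissible c th ka \<longrightarrow> \<bar>c - 1\<bar> + \<bar>th\<bar> + \<bar>ka - 1\<bar> \<le> s0 \<longrightarrow>
     (\<forall>t. (Y c th ka has_real_derivative Y' c th ka t) (at t)) \<and>
     (\<forall>t. ka * Y' c th ka t = - Y c th ka t + shifted_avg c th (\<lambda>s. G (Y c th ka s)) t) \<and>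
     (Y c th ka \<longlongrightarrow> K) at_top \<and>
     (\<forall>t. \<bar>Y c th ka t\<bar> \<le> C * m1 t \<and> \<bar>Y' c th ka t\<bar> \<le> C * m1 t \<and> \<bar>G (Y c th ka t)\<bar> \<le> C \<and>
        \<bar>Y c th ka t - A * exp (lam * t)\<bar> \<le> C * exp (2 * lam * t) \<and>
        \<bar>Y' c th ka t - A * lam * exp (lam * t)\<bar> \<le> C * exp (2 * lam * t)) \<and>
     (\<forall>c1 th1 ka1. admissible c1 th1 ka1 \<longrightarrow> \<bar>c1 - 1\<bar> + \<bar>th1\<bar> + \<bar>ka1 - 1\<bar> \<le> s0 \<longrightarrow>
       (\<forall>t. \<bar>Y c th ka t - Y c1 th1 ka1 t\<bar> \<le> C * (\<bar>c - c1\<bar> + \<bar>th - th1\<bar> + \<bar>ka - ka1\<bar>) * m2 t \<and>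
          \<bar>Y' c th ka t - Y' c1 th1 ka1 t\<bar> \<le> C * (\<bar>c - c1\<bar> + \<bar>th - th1\<bar> + \<bar>ka - ka1\<bar>) * m2 t)))"
proof -
  obtain s0 C F where s0: "s0 > 0" and C: "C \<ge> 0" and F0: "F 1 0 1 = (\<lambda>_. 0)"
    and F: "\<And>c th ka. admissible c th ka \<Longrightarrow> \<bar>c - 1\<bar> + \<bar>th\<bar> + \<bar>ka - 1\<bar> \<le> s0 \<Longrightarrow>
     ball (F c th ka) \<and> (F c th ka \<longlongrightarrow> 0) at_top \<and> (\<forall>t. N c th ka (F c th ka) t = F c th ka t)"
    and FF: "\<And>c th ka c1 th1 ka1 t. admissible c th ka \<Longrightarrow> \<bar>c - 1\<bar> + \<bar>th\<bar> + \<bar>ka - 1\<bar> \<le> s0 \<Longrightarrow>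
      admissible c1 th1 ka1 \<Longrightarrow> \<bar>c1 - 1\<bar> + \<bar>th1\<bar> + \<bar>ka1 - 1\<bar> \<le> s0 \<Longrightarrow>
      \<bar>F c th ka t - F c1 th1 ka1 t\<bar> \<le> C * (\<bar>c - c1\<bar> + \<bar>th - th1\<bar> + \<bar>ka - ka1\<bar>) * m2 t"
    using fixed_points by blast
  define C' where "C' = max (M + L2) (max (B * (M + L)) (L2 * C))"
  have C': "M + L2 \<le> C'" "B * (M + L) \<le> C'" "L2 * C \<le> C'" by (auto simp: C'_def)
  have "M + L \<le> M + L2" using L2 by simp
  then have RC: "R \<le> C'" using C' by (simp add: R_def)
  then have C'0: "C' \<ge> 0" using R by linarith
  have LC: "L * C \<le> C'" using L2 C C' mult_right_mono[of L L2 C] by linarith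
  show ?thesis
  proof (rule exI[of _ s0], rule conjI[OF s0], rule exI[of _ C'], rule conjI[OF C'0],
      rule exI[of _ "\<lambda>c th ka. X (F c th ka)"], rule exI[of _ "\<lambda>c th ka. X' (F c th ka)"], intro conjI allI impI)
    show "X (F 1 0 1) = psi" by (simp add: F0 X_def[abs_def] Li_0)
    show "X' (F 1 0 1) = psi'" by (simp add: F0 X'_def[abs_def] Li'_def Li_0)
    fix c th ka assume admissible: "admissible c th ka" "\<bar>c - 1\<bar> + \<bar>th\<bar> + \<bar>ka - 1\<bar> \<le> s0"
    let ?f = "F c th ka"
    have f: "ball ?f" "(?f \<longlongrightarrow> 0) at_top" "\<And>t. N c th ka ?f t = ?f t" using F[OF admissible] by auto
    show "(X ?f has_real_derivative X' ?f t) (at t)" for t by (rule X_deriv[OF f(1)])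
    have ka: "ka \<ge> 1" using admissible by (simp add: admissible_def)
    show "ka * X' ?f t = - X ?f t + shifted_avg c th (\<lambda>s. G (X ?f s)) t" for t
    proof -
      have "X' ?f t = (shifted_avg c th (\<lambda>s. G (X ?f s)) t - X ?f t) / ka"
        using f(3)[of t] by (simp add: X'_def Li'_def N_def)
      then show ?thesis using ka by simp
    qed
    show "(X ?f \<longlongrightarrow> K) at_top" by (rule X_tendsto[OF f(1,2)])
    show "\<bar>X ?f t\<bar> \<le> C' * m1 t" for t
      using X_bound[OF f(1), of t] mult_right_mono[OF RC less_imp_le[OF m1_pos[of t]]] by linarith
    show "\<bar>X' ?f t\<bar> \<le> C' * m1 t" for t
      using X'_bound[OF f(1), of t] mult_right_mono[OF C'(1) less_imp_le[OF m1_pos[of t]]] by linarith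
    show "\<bar>G (X ?f t)\<bar> \<le> C'" for t using GX_bound[OF f(1), of t] C' by linarith
    show "\<bar>X ?f t - A * exp (lam * t)\<bar> \<le> C' * exp (2 * lam * t)" for t
      using X_A[OF f(1), of t] mult_right_mono[OF RC[unfolded R_def] exp_ge_zero[of "2 * lam * t"]] by linarith
    show "\<bar>X' ?f t - A * lam * exp (lam * t)\<bar> \<le> C' * exp (2 * lam * t)" for t
      using X'_A[OF f(1), of t] mult_right_mono[OF C'(1) exp_ge_zero[of "2 * lam * t"]] by linarith
    fix c1 th1 ka1 assume ok1: "admissible c1 th1 ka1" "\<bar>c1 - 1\<bar> + \<bar>th1\<bar> + \<bar>ka1 - 1\<bar> \<le> s0"
    let ?f1 = "F c1 th1 ka1"
    have f1: "ball ?f1" using F[OF ok1] by auto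
    let ?d = "\<bar>c - c1\<bar> + \<bar>th - th1\<bar> + \<bar>ka - ka1\<bar>"
    have dm: "0 \<le> ?d * m2 t" for t using m2_pos[of t] by simp
    note D = FF[OF admissible ok1]
    show "\<bar>X ?f t - X ?f1 t\<bar> \<le> C' * ?d * m2 t" for t
    proof -
      have "\<bar>Li ?f t - Li ?f1 t\<bar> \<le> L * (C * ?d) * m2 t" by (rule Li(4)[OF ballD[OF f(1)] ballD[OF f1] D])
      also have "\<dots> = (L * C) * (?d * m2 t)" by simp
      also have "\<dots> \<le> C' * (?d * m2 t)" by (rule mult_right_mono[OF LC dm])
      finally show ?thesis by (simp add: X_def mult.assoc)
    qed
    show "\<bar>X' ?f t - X' ?f1 t\<bar> \<le> C' * ?d * m2 t" for t
    proof -
      have "\<bar>Li' ?f t - Li' ?f1 t\<bar> \<le> L2 * (C * ?d) * m2 t" by (rule Li'_diff[OF ballD[OF f(1)] ballD[OF f1] D])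
      also have "\<dots> = (L2 * C) * (?d * m2 t)" by simp
      also have "\<dots> \<le> C' * (?d * m2 t)" by (rule mult_right_mono[OF C'(3) dm])
      finally show ?thesis by (simp add: X'_def mult.assoc)
    qed
  qed
qed

end

section \<open>The phase condition\<close>

lemma ftc_from_minus_infinity:
  fixes F f :: "real \<Rightarrow> real"
  assumes F: "\<And>t. (F has_real_derivative f t) (at t)" and f: "continuous_on UNIV f" and lim: "(F \<longlongrightarrow> 0) at_bot"
  shows "(f has_integral F 0) {..0}"
  unfolding has_integral_alt'
proof (intro conjI allI impI)
  fix a b :: real
  have "{..0} \<inter> cbox a b = cbox a (min b 0)" by auto
  then show "(\<lambda>x. if x \<in> {..0} then f x else 0) integrable_on cbox a b"
    by (simp only: integrable_restrict_Int integrable_continuous[OF continuous_on_subset[OF f subset_UNIV]])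
next
  fix e :: real assume "e > 0"
  from tendstoD[OF lim this] obtain T where T: "\<And>t. t \<le> T \<Longrightarrow> \<bar>F t\<bar> < e" by (auto simp: eventually_at_bot_linorder)
  \<comment> \<open>An interval containing the ball of radius \<open>B\<close> contains 0 and starts
    to the left of \<open>T\<close>, where the antiderivative is already below
    \<open>e\<close>.\<close>
  define B where "B = max 1 (- T + 1)"
  have "norm (integral (cbox a b) (\<lambda>x. if x \<in> {..0} then f x else 0) - F 0) < e" if ab: "ball 0 B \<subseteq> cbox a b" for a b
  proof -
    have B: "B \<ge> 1" "B \<ge> - T + 1" by (auto simp: B_def)
    have "- (B - 1 / 2) \<in> ball 0 B" "0 \<in> ball 0 B" using B by (auto simp: dist_real_def)
    then have a: "a \<le> - (B - 1/2)" "0 \<le> b" using ab by (auto simp: subset_iff)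
    have "{..0} \<inter> cbox a b = {a..0}" using a by auto
    then have "integral (cbox a b) (\<lambda>x. if x \<in> {..0} then f x else 0) = integral {a..0} f"
      by (simp only: integral_restrict_Int)
    also have "\<dots> = F 0 - F a"
      using a B F by (intro integral_unique fundamental_theorem_of_calculus)
        (auto simp flip: has_real_derivative_iff_has_vector_derivative intro: has_field_derivative_at_within)
    finally show ?thesis using T[of a] a B by simp
  qed
  moreover have "B > 0" by (simp add: B_def)
  ultimately show "\<exists>B>0. \<forall>a b. ball 0 B \<subseteq> cbox a b \<longrightarrow>
      norm (integral (cbox a b) (\<lambda>x. if x \<in> {..0} then f x else 0) - F 0) < e" by blast
qed

lemma exp_integral_left:
  assumes "a > 0"
  shows "((\<lambda>t. C * exp (a * t)) has_integral C / a) {..0::real}"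
proof -
  have "((\<lambda>t. C * exp (a * t)) has_integral (C / a * exp (a * 0))) {..0}"
  proof (rule ftc_from_minus_infinity)
    show "((\<lambda>t. C / a * exp (a * t)) has_real_derivative C * exp (a * t)) (at t)" for t
      using assms by (auto intro!: derivative_eq_intros)
    have "filterlim (\<lambda>s. a * s) at_bot at_bot"
      using assms by (intro filterlim_tendsto_pos_mult_at_bot[OF tendsto_const]) (auto intro: filterlim_ident)
    then show "((\<lambda>t. C / a * exp (a * t)) \<longlongrightarrow> 0) at_bot"
      by (intro tendsto_mult_right_zero filterlim_compose[OF exp_at_bot])
  qed (intro continuous_intros)
  then show ?thesis by simp
qed

lemma
  fixes f :: "real \<Rightarrow> real"
  assumes f: "continuous_on UNIV f" and w: "\<And>t. t \<le> 0 \<Longrightarrow> \<bar>f t\<bar> \<le> w t" and i: "(w has_integral I) {..0}"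
  shows left_integrable: "f integrable_on {..0}" and left_integral_bound: "\<bar>integral {..0} f\<bar> \<le> I"
proof -
  show fi: "f integrable_on {..0}"
    by (rule measurable_bounded_by_integrable_imp_integrable_real
        [OF continuous_imp_measurable_on_sets_lebesgue[OF continuous_on_subset[OF f subset_UNIV]] has_integral_integrable[OF i]])
      (use w in auto)
  have "norm (integral {..0} f) \<le> integral {..0} w"
    by (rule integral_norm_bound_integral[OF fi has_integral_integrable[OF i]]) (use w in auto)
  then show "\<bar>integral {..0} f\<bar> \<le> I" using integral_unique[OF i] by simp
qed

text \<open>If 8 \<epsilon>^2 lam \<le> 1 the characteristic function has slope at most -1/2 on
  [0, 2 lam]: the quadratic term contributes at most 1/2 against -1. So it has one zero there, which
  is the least positive one, and the distance of any z to it is at most twice the value at z. Since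
  the value at lam is \<epsilon>^2 lam^2, the zero lies at most 2 \<epsilon>^2 lam^2 to the right of
  lam.\<close>

lemma lambda1_properties:
  fixes p h lam \<epsilon> :: real
  assumes p: "p > 1" and h: "h > 0" and lam: "lam > 0" and root: "1 + lam = p * exp (- lam * h)"
    and small: "8 * \<epsilon>\<^sup>2 * lam \<le> 1"
  defines "\<Lambda> \<equiv> lambda1 p h \<epsilon>"
  shows "lam \<le> \<Lambda>" "\<Lambda> \<le> 2 * lam" "\<Lambda> \<le> lam + 2 * \<epsilon>\<^sup>2 * lam\<^sup>2" "\<epsilon>\<^sup>2 * \<Lambda>\<^sup>2 - \<Lambda> - 1 + p * exp (- \<Lambda> * h) = 0"
    and "\<And>z. 0 \<le> z \<Longrightarrow> z \<le> 2 * lam \<Longrightarrow> \<bar>\<Lambda> - z\<bar> \<le> 2 * \<bar>\<epsilon>\<^sup>2 * z\<^sup>2 - z - 1 + p * exp (- z * h)\<bar>"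
proof -
  define f where "f z = \<epsilon>\<^sup>2 * z\<^sup>2 - z - 1 + p * exp (- z * h)" for z
  have fd: "(f has_real_derivative (2 * \<epsilon>\<^sup>2 * z - 1 - p * h * exp (- z * h))) (at z)" for z
    unfolding f_def[abs_def] by (auto intro!: derivative_eq_intros)
  have slope: "f z - f y \<le> - 1 / 2 * (z - y)" if "0 \<le> y" "y \<le> z" "z \<le> 2 * lam" for y z
  proof -
    obtain x where x: "min z y \<le> x" "x \<le> max z y" "f z - f y = (2 * \<epsilon>\<^sup>2 * x - 1 - p * h * exp (- x * h)) * (z - y)"
      using mvt_between[OF fd] by blast
    have "2 * \<epsilon>\<^sup>2 * x \<le> 2 * \<epsilon>\<^sup>2 * (2 * lam)" using x that by (intro mult_left_mono) auto
    also have "\<dots> \<le> 1 / 2" using small by simp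
    finally have "2 * \<epsilon>\<^sup>2 * x \<le> 1 / 2" .
    moreover have "p * h * exp (- x * h) \<ge> 0" using p h by simp
    ultimately have "2 * \<epsilon>\<^sup>2 * x - 1 - p * h * exp (- x * h) \<le> - 1 / 2" by linarith
    from mult_right_mono[OF this, of "z - y"] that x(3) show ?thesis by simp
  qed
  define z1 where "z1 = lam + 2 * \<epsilon>\<^sup>2 * lam\<^sup>2"
  have "2 * \<epsilon>\<^sup>2 * lam\<^sup>2 = (2 * \<epsilon>\<^sup>2 * lam) * lam" by (simp add: power2_eq_square)
  also have "\<dots> \<le> 1 * lam" using small lam by (intro mult_right_mono) auto
  finally have z1: "lam \<le> z1" "z1 \<le> 2 * lam" by (auto simp: z1_def)
  have flam: "f lam = \<epsilon>\<^sup>2 * lam\<^sup>2" using root by (simp add: f_def)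
  have "f z1 \<le> 0" using slope[of lam z1] z1 lam flam by (simp add: z1_def)
  moreover have "f lam \<ge> 0" unfolding flam by simp
  moreover have "continuous_on {lam..z1} f" using fd DERIV_isCont by (auto intro!: continuous_at_imp_continuous_on)
  ultimately obtain z0 where z0: "lam \<le> z0" "z0 \<le> z1" "f z0 = 0" using IVT2'[of f z1 0 lam] z1 by auto
  have "\<Lambda> = z0" unfolding \<Lambda>_def lambda1_def
  proof (rule Least_equality)
    show "0 < z0 \<and> \<epsilon>\<^sup>2 * z0\<^sup>2 - z0 - 1 + p * exp (- z0 * h) = 0" using z0 lam by (auto simp: f_def)
    fix y assume y: "0 < y \<and> \<epsilon>\<^sup>2 * y\<^sup>2 - y - 1 + p * exp (- y * h) = 0"
    show "z0 \<le> y"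
    proof (rule ccontr)
      assume "\<not> z0 \<le> y"
      then have "f z0 - f y \<le> - 1 / 2 * (z0 - y)" using y z0 z1 by (intro slope) auto
      moreover have "f y = 0" using y by (simp add: f_def)
      ultimately show False using z0(3) \<open>\<not> z0 \<le> y\<close> by simp
    qed
  qed
  then show "lam \<le> \<Lambda>" "\<Lambda> \<le> 2 * lam" "\<Lambda> \<le> lam + 2 * \<epsilon>\<^sup>2 * lam\<^sup>2" "\<epsilon>\<^sup>2 * \<Lambda>\<^sup>2 - \<Lambda> - 1 + p * exp (- \<Lambda> * h) = 0"
    using z0 z1 by (auto simp: f_def z1_def)
  fix z assume z: "0 \<le> z" "z \<le> 2 * lam"
  have "\<bar>z0 - z\<bar> \<le> 2 * \<bar>f z\<bar>"
  proof (cases "z \<le> z0")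
    case True
    then show ?thesis using slope[of z z0] z z0 z1 by simp
  next
    case False
    then have "f z \<le> - 1 / 2 * (z - z0)" using slope[of z0 z] z z0 z1 lam by simp
    then have "z - z0 \<le> 2 * (- f z)" by (simp add: field_simps)
    also have "\<dots> \<le> 2 * \<bar>f z\<bar>" by (intro mult_left_mono) auto
    finally show ?thesis using False by simp
  qed
  then show "\<bar>\<Lambda> - z\<bar> \<le> 2 * \<bar>\<epsilon>\<^sup>2 * z\<^sup>2 - z - 1 + p * exp (- z * h)\<bar>"
    using \<open>\<Lambda> = z0\<close> by (simp add: f_def)
qed

context delay_front begin

text \<open>The condition c \<ge> 1, available because lambda_1 \<ge> lam, ensures that stretching
  time by \<open>c\<close> only improves exponential decay at minus infinity.\<close>

definition near_base :: "real \<Rightarrow> real \<Rightarrow> real \<Rightarrow> real \<Rightarrow> bool" where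
  "near_base s c th ka \<longleftrightarrow> admissible c th ka \<and> c \<ge> 1 \<and> \<bar>c - 1\<bar> + \<bar>th\<bar> + \<bar>ka - 1\<bar> \<le> s"

lemma near_base_base: "s \<ge> 0 \<Longrightarrow> near_base s 1 0 1"
  using lam_root by (simp add: near_base_def admissible_def)

definition is_family where
  "is_family s A C Y Y' \<longleftrightarrow> Y 1 0 1 = psi \<and> Y' 1 0 1 = psi' \<and> (\<forall>c th ka. near_base s c th ka \<longrightarrow>
     (\<forall>t. (Y c th ka has_real_derivative Y' c th ka t) (at t)) \<and>
     (\<forall>t. ka * Y' c th ka t = - Y c th ka t + shifted_avg c th (\<lambda>s. G (Y c th ka s)) t) \<and>
     (Y c th ka \<longlongrightarrow> K) at_top \<and>
     (\<forall>t. \<bar>Y c th ka t\<bar> \<le> C * m1 t \<and> \<bar>Y' c th ka t\<bar> \<le> C * m1 t \<and> \<bar>G (Y c th ka t)\<bar> \<le> C \<and>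
        \<bar>Y c th ka t - A * exp (lam * t)\<bar> \<le> C * exp (2 * lam * t) \<and>
        \<bar>Y' c th ka t - A * lam * exp (lam * t)\<bar> \<le> C * exp (2 * lam * t)) \<and>
     (\<forall>c1 th1 ka1. near_base s c1 th1 ka1 \<longrightarrow>
       (\<forall>t. \<bar>Y c th ka t - Y c1 th1 ka1 t\<bar> \<le> C * (\<bar>c - c1\<bar> + \<bar>th - th1\<bar> + \<bar>ka - ka1\<bar>) * m2 t \<and>
          \<bar>Y' c th ka t - Y' c1 th1 ka1 t\<bar> \<le> C * (\<bar>c - c1\<bar> + \<bar>th - th1\<bar> + \<bar>ka - ka1\<bar>) * m2 t)))"

lemma family_exists: "\<exists>s0>0. \<exists>A>0. \<exists>C>0. \<exists>Y Y'. is_family s0 A C Y Y'"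
proof -
  obtain A M where A: "A > 0" "M > 0" and psiw: "\<forall>t. psi t \<le> M * m1 t \<and> \<bar>psi' t\<bar> \<le> M * m1 t \<and>
     \<bar>psi t - A * exp (lam * t)\<bar> \<le> M * exp (2 * lam * t) \<and>
     \<bar>psi' t - A * lam * exp (lam * t)\<bar> \<le> M * exp (2 * lam * t)" using psi_weights by blast
  obtain L Li where L: "L \<ge> 1"
    and Li1: "\<forall>f D. continuous_on UNIV f \<and> (\<forall>t. \<bar>f t\<bar> \<le> D * m2 t) \<longrightarrow>
       (\<forall>t. (Li f has_real_derivative (- Li f t + (b t * Li f (t - h) + f t))) (at t)) \<and>
       (\<forall>t. \<bar>Li f t\<bar> \<le> L * D * m2 t) \<and> ((f \<longlongrightarrow> 0) at_top \<longrightarrow> (Li f \<longlongrightarrow> 0) at_top)"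
    and Li2: "\<forall>f1 f2 D1 D2 D. continuous_on UNIV f1 \<and> (\<forall>t. \<bar>f1 t\<bar> \<le> D1 * m2 t) \<longrightarrow>
       continuous_on UNIV f2 \<and> (\<forall>t. \<bar>f2 t\<bar> \<le> D2 * m2 t) \<longrightarrow> (\<forall>t. \<bar>f1 t - f2 t\<bar> \<le> D * m2 t) \<longrightarrow>
       (\<forall>t. \<bar>Li f1 t - Li f2 t\<bar> \<le> L * D * m2 t)"
    using linear_inverse by blast
  obtain B where B: "B \<ge> 0" "\<forall>x. \<bar>x\<bar> \<le> M + L \<longrightarrow> \<bar>G' x\<bar> \<le> B" using G'_bounded by blast
  obtain Q where Q: "Q \<ge> 0" "\<forall>x. \<bar>x\<bar> \<le> M + L \<longrightarrow> \<bar>G' x - p\<bar> \<le> Q * \<bar>x\<bar>" using G'_near_0 by blast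
  interpret front_bounds G G' h K lam p psi A M B Q L Li
  proof
    show "\<bar>Li f1 t - Li f2 t\<bar> \<le> L * D * m2 t" if "continuous_on UNIV f1" "\<And>t. \<bar>f1 t\<bar> \<le> D1 * m2 t"
      "continuous_on UNIV f2" "\<And>t. \<bar>f2 t\<bar> \<le> D2 * m2 t" "\<And>t. \<bar>f1 t - f2 t\<bar> \<le> D * m2 t" for f1 f2 D1 D2 D t
      using Li2[rule_format, of f1 D1 f2 D2 D t] that by blast
  qed (use A psiw L B Q Li1 in blast)+
  from solution_family obtain s0 C Y Y' where s0: "s0 > 0" and C: "C \<ge> 0"
    and base: "Y 1 0 1 = psi" "Y' 1 0 1 = psi'"
    and fam: "\<forall>c th ka. admissible c th ka \<longrightarrow> \<bar>c - 1\<bar> + \<bar>th\<bar> + \<bar>ka - 1\<bar> \<le> s0 \<longrightarrow>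
     (\<forall>t. (Y c th ka has_real_derivative Y' c th ka t) (at t)) \<and>
     (\<forall>t. ka * Y' c th ka t = - Y c th ka t + shifted_avg c th (\<lambda>s. G (Y c th ka s)) t) \<and>
     (Y c th ka \<longlongrightarrow> K) at_top \<and>
     (\<forall>t. \<bar>Y c th ka t\<bar> \<le> C * m1 t \<and> \<bar>Y' c th ka t\<bar> \<le> C * m1 t \<and> \<bar>G (Y c th ka t)\<bar> \<le> C \<and>
        \<bar>Y c th ka t - A * exp (lam * t)\<bar> \<le> C * exp (2 * lam * t) \<and>
        \<bar>Y' c th ka t - A * lam * exp (lam * t)\<bar> \<le> C * exp (2 * lam * t)) \<and>
     (\<forall>c1 th1 ka1. admissible c1 th1 ka1 \<longrightarrow> \<bar>c1 - 1\<bar> + \<bar>th1\<bar> + \<bar>ka1 - 1\<bar> \<le> s0 \<longrightarrow>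
       (\<forall>t. \<bar>Y c th ka t - Y c1 th1 ka1 t\<bar> \<le> C * (\<bar>c - c1\<bar> + \<bar>th - th1\<bar> + \<bar>ka - ka1\<bar>) * m2 t \<and>
          \<bar>Y' c th ka t - Y' c1 th1 ka1 t\<bar> \<le> C * (\<bar>c - c1\<bar> + \<bar>th - th1\<bar> + \<bar>ka - ka1\<bar>) * m2 t))"
    by blast
  have "is_family s0 A C Y Y'" unfolding is_family_def near_base_def
  proof (intro conjI base allI impI)
  qed (use fam in blast)+
  moreover have "C > 0"
  proof -
    have "near_base s0 1 0 1" using s0 by (intro near_base_base) simp
    then have "\<bar>psi 0\<bar> \<le> C * m1 0" using fam base unfolding near_base_def by metis
    then show ?thesis using psi_pos[of 0] C by (cases "C = 0") auto
  qed
  ultimately show ?thesis using s0 A by blast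
qed

end

locale front_family = delay_front +
  fixes s0 A C :: real and Y Y' :: "real \<Rightarrow> real \<Rightarrow> real \<Rightarrow> real \<Rightarrow> real"
  assumes s0: "s0 > 0" and A: "A > 0" and C: "C > 0" and fam: "is_family s0 A C Y Y'"
begin

lemma
  assumes "near_base s0 c th ka"
  shows Y_deriv: "(Y c th ka has_real_derivative Y' c th ka t) (at t)"
    and Y_eq: "ka * Y' c th ka t = - Y c th ka t + shifted_avg c th (\<lambda>s. G (Y c th ka s)) t"
    and Y_K: "(Y c th ka \<longlongrightarrow> K) at_top"
    and Y_m1: "\<bar>Y c th ka t\<bar> \<le> C * m1 t" and Y'_m1: "\<bar>Y' c th ka t\<bar> \<le> C * m1 t"
    and GY_C: "\<bar>G (Y c th ka t)\<bar> \<le> C"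
    and Y_A: "\<bar>Y c th ka t - A * exp (lam * t)\<bar> \<le> C * exp (2 * lam * t)"
    and Y'_A: "\<bar>Y' c th ka t - A * lam * exp (lam * t)\<bar> \<le> C * exp (2 * lam * t)"
  using fam assms unfolding is_family_def by blast+

lemma
  assumes "near_base s0 c th ka" "near_base s0 c1 th1 ka1"
  shows Y_lip: "\<bar>Y c th ka t - Y c1 th1 ka1 t\<bar> \<le> C * (\<bar>c - c1\<bar> + \<bar>th - th1\<bar> + \<bar>ka - ka1\<bar>) * m2 t"
    and Y'_lip: "\<bar>Y' c th ka t - Y' c1 th1 ka1 t\<bar> \<le> C * (\<bar>c - c1\<bar> + \<bar>th - th1\<bar> + \<bar>ka - ka1\<bar>) * m2 t"
  using fam assms unfolding is_family_def by blast+

lemma Y_base: "Y 1 0 1 = psi" "Y' 1 0 1 = psi'"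
  using fam unfolding is_family_def by blast+

lemma base_s0: "near_base s0 1 0 1"
  using s0 by (intro near_base_base) simp

lemma psi_m1: "\<bar>psi t\<bar> \<le> C * m1 t" "\<bar>psi' t\<bar> \<le> C * m1 t"
  using Y_m1[OF base_s0] Y'_m1[OF base_s0] by (auto simp: Y_base)

lemma Y_cont: "near_base s0 c th ka \<Longrightarrow> continuous_on UNIV (Y c th ka)"
  using DERIV_isCont[OF Y_deriv] by (auto simp: continuous_on_eq_continuous_at)

lemma m1_C: "C * m1 t \<le> C"
  using m1_le_1 C by (simp add: mult_left_le)

lemma Y_increment:
  assumes "near_base s0 c th ka"
  shows "\<bar>Y c th ka x - Y c th ka y\<bar> \<le> C * \<bar>x - y\<bar> * m1 (max x y)"
proof -
  obtain z where z: "min x y \<le> z" "z \<le> max x y" "Y c th ka x - Y c th ka y = Y' c th ka z * (x - y)"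
    using mvt_between[OF Y_deriv[OF assms]] by blast
  have "\<bar>Y' c th ka z\<bar> \<le> C * m1 (max x y)"
    using Y'_m1[OF assms, of z] mult_left_mono[OF m1_mono[OF z(2)] less_imp_le[OF C]] by linarith
  then have "\<bar>Y' c th ka z\<bar> * \<bar>x - y\<bar> \<le> (C * m1 (max x y)) * \<bar>x - y\<bar>" by (intro mult_right_mono) auto
  then show ?thesis using z(3) by (simp add: abs_mult mult_ac)
qed

lemma psi'_lipschitz: "\<exists>D>0. \<forall>x y. \<bar>psi' x - psi' y\<bar> \<le> D * \<bar>x - y\<bar>"
proof -
  obtain B where B: "B \<ge> 0" "\<forall>x. \<bar>x\<bar> \<le> C \<longrightarrow> \<bar>G' x\<bar> \<le> B" using G'_bounded by blast
  have bB: "\<bar>b t\<bar> \<le> B" for t unfolding b_def using B(2) psi_m1(1)[of "t - h"] m1_C[of "t - h"] by fastforce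
  have p'C: "\<bar>psi' t\<bar> \<le> C" for t using psi_m1(2)[of t] m1_C[of t] by linarith
  have d: "(psi' has_real_derivative (- psi' t + b t * psi' (t - h))) (at t)" for t
    unfolding psi'_def[abs_def] b_def
    by (auto intro!: derivative_eq_intros DERIV_chain2[OF dG] DERIV_delay[where h = h, OF psi] psi simp: algebra_simps)
  have "\<bar>psi' x - psi' y\<bar> \<le> (C + B * C) * \<bar>x - y\<bar>" for x y
  proof -
    obtain z where z: "psi' x - psi' y = (- psi' z + b z * psi' (z - h)) * (x - y)" using mvt_between[OF d] by blast
    have "\<bar>b z * psi' (z - h)\<bar> \<le> B * C" unfolding abs_mult using bB p'C B by (intro mult_mono) auto
    then have "\<bar>- psi' z + b z * psi' (z - h)\<bar> \<le> C + B * C" using p'C[of z] by linarith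
    then show ?thesis unfolding z abs_mult by (intro mult_right_mono) auto
  qed
  moreover have "C + B * C > 0" using B C by (simp add: add_pos_nonneg)
  ultimately show ?thesis by blast
qed

text \<open>The derivative of the phase integral with respect to a translation at the unperturbed
  front; its positivity is the nondegeneracy of the phase condition.\<close>

definition I where "I = integral {..0} (\<lambda>t. psi' t * psi' t)"

lemma product_integrable:
  assumes y: "continuous_on UNIV y" and D: "\<And>t. \<bar>y t\<bar> \<le> D"
  shows "(\<lambda>t. y t * psi' t) integrable_on {..0}"
proof (rule left_integrable[where w = "\<lambda>t. D * C * exp (lam * t)"])
  show "continuous_on UNIV (\<lambda>t. y t * psi' t)" by (intro continuous_intros y psi'_cont)
  show "((\<lambda>t. D * C * exp (lam * t)) has_integral (D * C / lam)) {..0}" by (rule exp_integral_left[OF lam])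
  fix t
  have "\<bar>psi' t\<bar> \<le> C * exp (lam * t)" using psi_m1(2)[of t] mult_left_mono[OF m1_le_exp[of t] less_imp_le[OF C]] by linarith
  moreover have "D \<ge> 0" using D[of 0] by linarith
  ultimately have "\<bar>y t\<bar> * \<bar>psi' t\<bar> \<le> D * (C * exp (lam * t))" using D by (intro mult_mono) auto
  then show "\<bar>y t * psi' t\<bar> \<le> D * C * exp (lam * t)" by (simp add: abs_mult mult.assoc)
qed

lemma psi_C: "\<bar>psi t\<bar> \<le> C" "\<bar>psi' t\<bar> \<le> C"
  using psi_m1[of t] m1_C[of t] by linarith+

lemma psi_psi'_integral: "((\<lambda>t. psi t * psi' t) has_integral (psi 0)\<^sup>2 / 2) {..0}"
proof (rule ftc_from_minus_infinity[where F = "\<lambda>t. (psi t)\<^sup>2 / 2"])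
  show "((\<lambda>t. (psi t)\<^sup>2 / 2) has_real_derivative psi t * psi' t) (at t)" for t
    by (auto intro!: derivative_eq_intros psi_deriv)
  show "continuous_on UNIV (\<lambda>t. psi t * psi' t)" by (intro continuous_intros psi_cont psi'_cont)
  have "((\<lambda>t. (psi t)\<^sup>2 / 2) \<longlongrightarrow> 0\<^sup>2 / 2) at_bot" by (intro tendsto_intros psi_0) auto
  then show "((\<lambda>t. (psi t)\<^sup>2 / 2) \<longlongrightarrow> 0) at_bot" by simp
qed

text \<open>The integral of psi psi' is psi(0)^2 / 2 > 0. Integrating the square of psi' - r psi
  bounds \<open>I\<close> below by r psi(0)^2 - r^2 J, and for small r the linear term wins. The J +
  1 in \<open>r\<close> keeps the quotient meaningful without knowing J > 0.\<close>

lemma I_pos: "I > 0"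
proof -
  have i1: "(\<lambda>t. psi' t * psi' t) integrable_on {..0}" by (rule product_integrable[OF psi'_cont psi_C(2)])
  have i2: "(\<lambda>t. psi t * psi t) integrable_on {..0}"
  proof (rule left_integrable[where w = "\<lambda>t. C * C * exp (lam * t)"])
    show "continuous_on UNIV (\<lambda>t. psi t * psi t)" by (intro continuous_intros psi_cont)
    show "((\<lambda>t. C * C * exp (lam * t)) has_integral (C * C / lam)) {..0}" by (rule exp_integral_left[OF lam])
    fix t
    have "\<bar>psi t\<bar> \<le> C * exp (lam * t)" using psi_m1(1)[of t] mult_left_mono[OF m1_le_exp[of t] less_imp_le[OF C]] by linarith
    then have "\<bar>psi t\<bar> * \<bar>psi t\<bar> \<le> C * (C * exp (lam * t))" using psi_C(1)[of t] C by (intro mult_mono) auto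
    then show "\<bar>psi t * psi t\<bar> \<le> C * C * exp (lam * t)" by (simp add: abs_mult mult.assoc)
  qed
  define J where "J = integral {..0} (\<lambda>t. psi t * psi t)"
  have J: "J \<ge> 0" unfolding J_def by (rule integral_nonneg[OF i2]) simp
  define r where "r = (psi 0)\<^sup>2 / (2 * (J + 1))"
  have r: "r > 0" unfolding r_def using psi_pos[of 0] J by simp
  have "r * J \<le> r * (J + 1)" using r by simp
  also have "\<dots> = (psi 0)\<^sup>2 / 2" using J by (simp add: r_def field_simps)
  finally have rJ: "r * J \<le> (psi 0)\<^sup>2 / 2" .
  have i3: "((\<lambda>t. 2 * r * (psi t * psi' t) - r\<^sup>2 * (psi t * psi t)) has_integral 2 * r * ((psi 0)\<^sup>2 / 2) - r\<^sup>2 * J) {..0}"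
    unfolding J_def by (intro has_integral_diff has_integral_mult_right psi_psi'_integral integrable_integral i2)
  have "2 * r * ((psi 0)\<^sup>2 / 2) - r\<^sup>2 * J \<le> I" unfolding I_def
  proof (rule has_integral_le[OF i3 integrable_integral[OF i1]])
    fix t
    have "0 \<le> (psi' t - r * psi t)\<^sup>2" by simp
    then show "2 * r * (psi t * psi' t) - r\<^sup>2 * (psi t * psi t) \<le> psi' t * psi' t"
      by (simp add: power2_eq_square algebra_simps)
  qed
  moreover have "r\<^sup>2 * J = r * (r * J)" by (simp add: power2_eq_square)
  moreover have "r * (r * J) \<le> r * ((psi 0)\<^sup>2 / 2)" using rJ r by (intro mult_left_mono) auto
  moreover have "r * ((psi 0)\<^sup>2 / 2) > 0" using r psi_pos[of 0] by simp
  ultimately show ?thesis by linarith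
qed

text \<open>The bound on the difference may grow like |t|, as it does when time is stretched; the
  factor psi' decays like exp(lam t), and |t| exp(lam t) \<le> (2 / lam) exp(lam t / 2).\<close>

lemma integral_comparison:
  assumes y1: "continuous_on UNIV y1" "\<And>t. \<bar>y1 t\<bar> \<le> C" and y2: "continuous_on UNIV y2" "\<And>t. \<bar>y2 t\<bar> \<le> C"
    and d: "\<And>t. t \<le> 0 \<Longrightarrow> \<bar>y1 t - y2 t - k * psi' t\<bar> \<le> E0 + E1 * \<bar>t\<bar>" and E: "E0 \<ge> 0" "E1 \<ge> 0"
  shows "\<bar>integral {..0} (\<lambda>t. y1 t * psi' t) - integral {..0} (\<lambda>t. y2 t * psi' t) - k * I\<bar> \<le> C * (E0 / lam + 4 * E1 / lam\<^sup>2)"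
proof -
  let ?f = "\<lambda>t. y1 t * psi' t - y2 t * psi' t - k * (psi' t * psi' t)"
  have eq: "integral {..0} ?f = integral {..0} (\<lambda>t. y1 t * psi' t) - integral {..0} (\<lambda>t. y2 t * psi' t) - k * I"
    unfolding I_def
    by (intro integral_unique has_integral_diff has_integral_mult_right integrable_integral
        product_integrable[OF y1] product_integrable[OF y2] product_integrable[OF psi'_cont psi_C(2)])
  have "\<bar>integral {..0} ?f\<bar> \<le> C * E0 / lam + C * E1 * (2 / lam) / (lam / 2)"
  proof (rule left_integral_bound)
    show "continuous_on UNIV ?f" by (intro continuous_intros y1 y2 psi'_cont)
    show "((\<lambda>t. C * E0 * exp (lam * t) + C * E1 * (2 / lam) * exp (lam / 2 * t)) has_integral C * E0 / lam + C * E1 * (2 / lam) / (lam / 2)) {..0}"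
      using lam by (intro has_integral_add exp_integral_left) auto
    fix t :: real assume t: "t \<le> 0"
    have p: "\<bar>psi' t\<bar> \<le> C * exp (lam * t)" using psi_m1(2)[of t] mult_left_mono[OF m1_le_exp[of t] less_imp_le[OF C]] by linarith
    have "?f t = (y1 t - y2 t - k * psi' t) * psi' t" by (simp add: algebra_simps)
    then have "\<bar>?f t\<bar> \<le> (E0 + E1 * \<bar>t\<bar>) * (C * exp (lam * t))"
      unfolding abs_mult[symmetric] using mult_mono[OF d[OF t] p] E by (simp add: abs_mult)
    also have "\<dots> = C * E0 * exp (lam * t) + C * E1 * (\<bar>t\<bar> * exp (lam * t))" by (simp add: algebra_simps)
    also have "\<bar>t\<bar> * exp (lam * t) \<le> 2 / lam * exp (lam / 2 * t)"
    proof -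
      have "1 + - lam / 2 * t \<le> exp (- lam / 2 * t)" by (rule exp_ge_add_one_self)
      then have "lam / 2 * \<bar>t\<bar> \<le> exp (- lam / 2 * t)" using t by simp
      then have "\<bar>t\<bar> \<le> 2 / lam * exp (- lam / 2 * t)" using lam by (simp add: field_simps)
      then have "\<bar>t\<bar> * exp (lam * t) \<le> 2 / lam * exp (- lam / 2 * t) * exp (lam * t)" by (intro mult_right_mono) auto
      also have "\<dots> = 2 / lam * exp (lam / 2 * t)" by (simp add: exp_add[symmetric] mult.assoc)
      finally show ?thesis .
    qed
    then have "C * E1 * (\<bar>t\<bar> * exp (lam * t)) \<le> C * E1 * (2 / lam * exp (lam / 2 * t))" using C E by (intro mult_left_mono) auto
    finally show "\<bar>?f t\<bar> \<le> C * E0 * exp (lam * t) + C * E1 * (2 / lam) * exp (lam / 2 * t)" by (simp add: mult.assoc)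
  qed
  also have "C * E0 / lam + C * E1 * (2 / lam) / (lam / 2) = C * (E0 / lam + 4 * E1 / lam\<^sup>2)"
    using lam by (simp add: power2_eq_square field_simps)
  finally show ?thesis unfolding eq .
qed

definition phase_integral where "phase_integral c th ka d = integral {..0} (\<lambda>t. Y c th ka (c * t + d) * psi' t)"

lemma Yc_cont: "near_base s0 c th ka \<Longrightarrow> continuous_on UNIV (\<lambda>t. Y c th ka (c * t + d))"
  by (intro continuous_on_compose2[OF Y_cont] continuous_intros) auto

lemma Y_C: "near_base s0 c th ka \<Longrightarrow> \<bar>Y c th ka t\<bar> \<le> C"
  using Y_m1[of c th ka t] m1_C[of t] by linarith

lemma Y_two_params:
  assumes q: "near_base s0 c th ka" and q1: "near_base s0 c1 th1 ka1"
  shows "\<bar>Y c th ka (c * t + d) - Y c1 th1 ka1 (c1 * t + d1)\<bar> \<le>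
    C * (\<bar>c - c1\<bar> + \<bar>th - th1\<bar> + \<bar>ka - ka1\<bar>) * m1 (c * t + d)
    + C * (\<bar>c - c1\<bar> * \<bar>t\<bar> + \<bar>d - d1\<bar>) * m1 (max (c * t + d) (c1 * t + d1))"
proof -
  let ?\<delta> = "\<bar>c - c1\<bar> + \<bar>th - th1\<bar> + \<bar>ka - ka1\<bar>"
  have "\<bar>Y c th ka (c * t + d) - Y c1 th1 ka1 (c * t + d)\<bar> \<le> C * ?\<delta> * m1 (c * t + d)"
  proof -
    have "C * ?\<delta> \<ge> 0" using C by simp
    from mult_left_mono[OF m2_le_m1 this] Y_lip[OF q q1, of "c * t + d"] show ?thesis by (rule order_trans[rotated])
  qed
  moreover have "\<bar>Y c1 th1 ka1 (c * t + d) - Y c1 th1 ka1 (c1 * t + d1)\<bar> \<le>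
      C * (\<bar>c - c1\<bar> * \<bar>t\<bar> + \<bar>d - d1\<bar>) * m1 (max (c * t + d) (c1 * t + d1))"
  proof -
    have "(c * t + d) - (c1 * t + d1) = (c - c1) * t + (d - d1)" by (simp add: algebra_simps)
    then have "\<bar>(c * t + d) - (c1 * t + d1)\<bar> \<le> \<bar>c - c1\<bar> * \<bar>t\<bar> + \<bar>d - d1\<bar>" by (metis abs_mult abs_triangle_ineq)
    then have "C * \<bar>(c * t + d) - (c1 * t + d1)\<bar> * m1 (max (c * t + d) (c1 * t + d1)) \<le>
        C * (\<bar>c - c1\<bar> * \<bar>t\<bar> + \<bar>d - d1\<bar>) * m1 (max (c * t + d) (c1 * t + d1))"
      using C m1_pos less_imp_le by (intro mult_right_mono mult_left_mono) auto
    then show ?thesis using Y_increment[OF q1, of "c * t + d" "c1 * t + d1"] by linarith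
  qed
  ultimately show ?thesis by linarith
qed

lemma phase_integral_params:
  assumes q: "near_base s0 c th ka" and q1: "near_base s0 c1 th1 ka1"
  shows "\<bar>phase_integral c th ka d - phase_integral c1 th1 ka1 d\<bar> \<le> C * (C / lam + 4 * C / lam\<^sup>2) * (\<bar>c - c1\<bar> + \<bar>th - th1\<bar> + \<bar>ka - ka1\<bar>)"
proof -
  define \<delta> where "\<delta> = \<bar>c - c1\<bar> + \<bar>th - th1\<bar> + \<bar>ka - ka1\<bar>"
  have \<delta>: "\<delta> \<ge> 0" "\<bar>c - c1\<bar> \<le> \<delta>" by (auto simp: \<delta>_def)
  have "\<bar>phase_integral c th ka d - phase_integral c1 th1 ka1 d - 0 * I\<bar> \<le> C * (C * \<delta> / lam + 4 * (C * \<delta>) / lam\<^sup>2)"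
    unfolding phase_integral_def
  proof (rule integral_comparison[OF Yc_cont[OF q] Y_C[OF q] Yc_cont[OF q1] Y_C[OF q1]])
    fix t :: real
    have "C * \<delta> * m1 (c * t + d) \<le> C * \<delta> * 1" using C \<delta> m1_le_1 by (intro mult_left_mono) auto
    moreover have "C * (\<bar>c - c1\<bar> * \<bar>t\<bar> + \<bar>d - d\<bar>) * m1 (max (c * t + d) (c1 * t + d)) \<le> C * (\<delta> * \<bar>t\<bar>) * 1"
      using C \<delta> m1_le_1 less_imp_le[OF m1_pos] by (intro mult_mono mult_left_mono) (auto intro!: mult_right_mono)
    ultimately show "\<bar>Y c th ka (c * t + d) - Y c1 th1 ka1 (c1 * t + d) - 0 * psi' t\<bar> \<le> C * \<delta> + C * \<delta> * \<bar>t\<bar>"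
      using Y_two_params[OF q q1, of t d d] unfolding \<delta>_def[symmetric] by (simp add: mult.assoc)
  qed (use C \<delta> in auto)
  also have "C * (C * \<delta> / lam + 4 * (C * \<delta>) / lam\<^sup>2) = C * (C / lam + 4 * C / lam\<^sup>2) * \<delta>"
    by (simp add: algebra_simps)
  finally show ?thesis by (simp add: \<delta>_def)
qed

lemma phase_integral_base: "phase_integral 1 0 1 0 = (psi 0)\<^sup>2 / 2"
  using integral_unique[OF psi_psi'_integral] by (simp add: phase_integral_def Y_base)

text \<open>An implicit function argument with only Lipschitz data: near the base the phase integral
  increases in the translation d with slope between I / 2 and 3 I / 2. The intermediate value
  theorem yields the shift, and the lower slope bound makes it unique, zero at the base and
  Lipschitz in the parameters.\<close>

lemma phase:
  "\<exists>s1>0. s1 \<le> s0 \<and> (\<exists>D\<ge>0. \<exists>dd. dd 1 0 1 = 0 \<and> (\<forall>c th ka. near_base s1 c th ka \<longrightarrow>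
     \<bar>dd c th ka\<bar> \<le> 1 \<and> phase_integral c th ka (dd c th ka) = (psi 0)\<^sup>2 / 2 \<and>
     (\<forall>c1 th1 ka1. near_base s1 c1 th1 ka1 \<longrightarrow>
        \<bar>dd c th ka - dd c1 th1 ka1\<bar> \<le> D * (\<bar>c - c1\<bar> + \<bar>th - th1\<bar> + \<bar>ka - ka1\<bar>))))"
proof -
  obtain Lp where Lp: "Lp > 0" "\<And>x y. \<bar>psi' x - psi' y\<bar> \<le> Lp * \<bar>x - y\<bar>" using psi'_lipschitz by blast
  \<comment> \<open>With |d| \<le> d0 the change of psi' under the translation costs at most I / 4
    of the slope; the deviation of the parameters, C6 s1, costs another I / 4.\<close>
  define d0 where "d0 = min 1 (I * lam / (4 * C * Lp))"
  have d0: "d0 > 0" "d0 \<le> 1" using I_pos lam C Lp by (auto simp: d0_def)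
  have "C * (Lp * d0 / lam) \<le> C * (Lp * (I * lam / (4 * C * Lp)) / lam)"
    using C Lp lam by (intro mult_left_mono divide_right_mono) (auto simp: d0_def)
  also have "\<dots> = I / 4" using C Lp lam by simp
  finally have d0I: "C * (Lp * d0 / lam) \<le> I / 4" .
  define C4 where "C4 = C * (C / lam + 4 * C / lam\<^sup>2)"
  have C4: "C4 \<ge> 0" using C lam by (simp add: C4_def)
  define C6 where "C6 = C * (C / lam + 4 * Lp / lam\<^sup>2)"
  have C6: "C6 \<ge> 0" using C lam Lp by (simp add: C6_def)
  \<comment> \<open>The last bound makes the value at d = 0 miss the target by at most I d0 / 2,
    which a shift by d0 with slope at least I / 2 can make up.\<close>
  define s1 where "s1 = Min {s0, I / (4 * (C6 + 1)), I * d0 / (2 * (C4 + 1))}"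
  have s1: "s1 > 0" "s1 \<le> s0" using s0 I_pos d0 C4 C6 by (auto simp: s1_def)
  have s1C6: "C6 * s1 \<le> I / 4"
  proof -
    have "C6 * s1 \<le> (C6 + 1) * (I / (4 * (C6 + 1)))" using C6 s1 by (intro mult_mono) (auto simp: s1_def)
    also have "\<dots> = I / 4" using C6 by (simp add: field_simps)
    finally show ?thesis .
  qed
  have s1C4: "C4 * s1 \<le> I * d0 / 2"
  proof -
    have "C4 * s1 \<le> (C4 + 1) * (I * d0 / (2 * (C4 + 1)))" using C4 s1 by (intro mult_mono) (auto simp: s1_def)
    also have "\<dots> = I * d0 / 2" using C4 by (simp add: field_simps)
    finally show ?thesis .
  qed
  have nb: "near_base s0 c th ka" if "near_base s1 c th ka" for c th ka using that s1 by (auto simp: near_base_def)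
  have incr: "\<bar>phase_integral c th ka d - phase_integral c th ka d' - (d - d') * I\<bar> \<le> \<bar>d - d'\<bar> * (I / 2)"
    if q: "near_base s1 c th ka" and d: "\<bar>d\<bar> \<le> d0" "\<bar>d'\<bar> \<le> d0" for c th ka d d'
  proof -
    note q0 = nb[OF q]
    define \<delta> where "\<delta> = \<bar>c - 1\<bar> + \<bar>th - 0\<bar> + \<bar>ka - 1\<bar>"
    have \<delta>: "0 \<le> \<delta>" "\<bar>c - 1\<bar> \<le> \<delta>" "\<delta> \<le> s1" using q by (auto simp: \<delta>_def near_base_def)
    have "\<bar>phase_integral c th ka d - phase_integral c th ka d' - (d - d') * I\<bar> \<le>
        C * (\<bar>d - d'\<bar> * (C * \<delta> + Lp * d0) / lam + 4 * (\<bar>d - d'\<bar> * (Lp * \<delta>)) / lam\<^sup>2)"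
      unfolding phase_integral_def
    proof (rule integral_comparison[OF Yc_cont[OF q0] Y_C[OF q0] Yc_cont[OF q0] Y_C[OF q0]])
      fix t :: real
      obtain z where z: "min (c * t + d) (c * t + d') \<le> z" "z \<le> max (c * t + d) (c * t + d')"
          "Y c th ka (c * t + d) - Y c th ka (c * t + d') = Y' c th ka z * ((c * t + d) - (c * t + d'))"
        using mvt_between[OF Y_deriv[OF q0]] by blast
      have "\<bar>z - c * t\<bar> \<le> d0" using z(1,2) d by linarith
      moreover have "\<bar>c * t - t\<bar> \<le> \<delta> * \<bar>t\<bar>"
      proof -
        have "c * t - t = (c - 1) * t" by (simp add: algebra_simps)
        then show ?thesis using \<delta> by (auto simp: abs_mult intro!: mult_right_mono)
      qed
      ultimately have "\<bar>z - t\<bar> \<le> d0 + \<delta> * \<bar>t\<bar>" by linarith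
      then have 1: "\<bar>psi' z - psi' t\<bar> \<le> Lp * (d0 + \<delta> * \<bar>t\<bar>)" using Lp(2)[of z t] mult_left_mono[OF _ less_imp_le[OF Lp(1)]] by (meson order_trans)
      have "C * \<delta> * m2 z \<le> C * \<delta> * 1" using C \<delta> m2_le_1 by (intro mult_left_mono) auto
      then have "\<bar>Y' c th ka z - psi' z\<bar> \<le> C * \<delta>"
        using Y'_lip[OF q0 base_s0, of z] by (simp add: Y_base \<delta>_def)
      then have "\<bar>Y' c th ka z - psi' t\<bar> \<le> (C * \<delta> + Lp * d0) + Lp * \<delta> * \<bar>t\<bar>" using 1 by (simp add: algebra_simps)
      then have "\<bar>d - d'\<bar> * \<bar>Y' c th ka z - psi' t\<bar> \<le> \<bar>d - d'\<bar> * ((C * \<delta> + Lp * d0) + Lp * \<delta> * \<bar>t\<bar>)" by (intro mult_left_mono) auto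
      moreover have "Y c th ka (c * t + d) - Y c th ka (c * t + d') - (d - d') * psi' t = (d - d') * (Y' c th ka z - psi' t)"
        unfolding z(3) by (simp add: algebra_simps)
      then have "\<bar>Y c th ka (c * t + d) - Y c th ka (c * t + d') - (d - d') * psi' t\<bar> = \<bar>d - d'\<bar> * \<bar>Y' c th ka z - psi' t\<bar>"
        by (simp only: abs_mult)
      moreover have "\<bar>d - d'\<bar> * ((C * \<delta> + Lp * d0) + Lp * \<delta> * \<bar>t\<bar>) = \<bar>d - d'\<bar> * (C * \<delta> + Lp * d0) + \<bar>d - d'\<bar> * (Lp * \<delta>) * \<bar>t\<bar>"
        by (simp add: algebra_simps)
      ultimately show "\<bar>Y c th ka (c * t + d) - Y c th ka (c * t + d') - (d - d') * psi' t\<bar> \<le>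
          \<bar>d - d'\<bar> * (C * \<delta> + Lp * d0) + \<bar>d - d'\<bar> * (Lp * \<delta>) * \<bar>t\<bar>" by linarith
    qed (use C \<delta> Lp d0 in auto)
    also have "\<dots> = \<bar>d - d'\<bar> * (C6 * \<delta> + C * (Lp * d0 / lam))"
      using lam by (simp add: C6_def field_simps power2_eq_square)
    also have "\<dots> \<le> \<bar>d - d'\<bar> * (I / 2)"
    proof (rule mult_left_mono)
      show "C6 * \<delta> + C * (Lp * d0 / lam) \<le> I / 2" using mult_left_mono[OF \<delta>(3) C6] s1C6 d0I by linarith
    qed simp
    finally show ?thesis .
  qed
  have ex: "\<exists>d. \<bar>d\<bar> \<le> d0 \<and> phase_integral c th ka d = (psi 0)\<^sup>2 / 2" if q: "near_base s1 c th ka" for c th ka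
  proof -
    have "\<bar>phase_integral c th ka 0 - phase_integral 1 0 1 0\<bar> \<le> C4 * (\<bar>c - 1\<bar> + \<bar>th - 0\<bar> + \<bar>ka - 1\<bar>)"
      unfolding C4_def by (rule phase_integral_params[OF nb[OF q] base_s0])
    also have "\<dots> \<le> C4 * s1" using q C4 by (intro mult_left_mono) (auto simp: near_base_def)
    finally have P0: "\<bar>phase_integral c th ka 0 - (psi 0)\<^sup>2 / 2\<bar> \<le> I * d0 / 2" using s1C4 by (simp add: phase_integral_base)
    have k: "I * d0 / 2 = d0 * (I / 2)" "d0 * I = 2 * (d0 * (I / 2))" by simp_all
    have "\<bar>phase_integral c th ka d0 - phase_integral c th ka 0 - d0 * I\<bar> \<le> d0 * (I / 2)" using incr[OF q, of d0 0] d0 by simp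
    then have up: "(psi 0)\<^sup>2 / 2 \<le> phase_integral c th ka d0" using P0 unfolding k abs_le_iff by linarith
    have "\<bar>phase_integral c th ka (- d0) - phase_integral c th ka 0 + d0 * I\<bar> \<le> d0 * (I / 2)" using incr[OF q, of "- d0" 0] d0 by simp
    then have lo: "phase_integral c th ka (- d0) \<le> (psi 0)\<^sup>2 / 2" using P0 unfolding k abs_le_iff by linarith
    have "continuous_on {- d0..d0} (phase_integral c th ka)"
    proof (rule continuous_onI)
      fix x e :: real assume x: "x \<in> {- d0..d0}" and e: "e > 0"
      show "\<exists>d>0. \<forall>x'\<in>{- d0..d0}. dist x' x < d \<longrightarrow> dist (phase_integral c th ka x') (phase_integral c th ka x) \<le> e"
      proof (intro exI[of _ "e / (2 * I)"] conjI ballI impI)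
        show "e / (2 * I) > 0" using e I_pos by simp
        fix x' assume x': "x' \<in> {- d0..d0}" "dist x' x < e / (2 * I)"
        have "\<bar>phase_integral c th ka x' - phase_integral c th ka x - (x' - x) * I\<bar> \<le> \<bar>x' - x\<bar> * (I / 2)" using incr[OF q, of x' x] x x' by (simp add: abs_le_iff)
        moreover have "\<bar>(x' - x) * I\<bar> = \<bar>x' - x\<bar> * I" using I_pos by (simp add: abs_mult)
        ultimately have "\<bar>phase_integral c th ka x' - phase_integral c th ka x\<bar> \<le> \<bar>x' - x\<bar> * I + \<bar>x' - x\<bar> * (I / 2)" by linarith
        also have "\<dots> \<le> \<bar>x' - x\<bar> * (2 * I)" using I_pos by (simp add: algebra_simps)
        also have "\<dots> \<le> e / (2 * I) * (2 * I)" using x'(2) I_pos by (intro mult_right_mono) (auto simp: dist_real_def)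
        also have "\<dots> = e" using I_pos by simp
        finally show "dist (phase_integral c th ka x') (phase_integral c th ka x) \<le> e" by (simp add: dist_real_def)
      qed
    qed
    moreover have "- d0 \<le> d0" using d0 by simp
    ultimately obtain d where "- d0 \<le> d" "d \<le> d0" "phase_integral c th ka d = (psi 0)\<^sup>2 / 2" using IVT'[where f = "phase_integral c th ka", OF lo up] by blast
    then show ?thesis by (intro exI[of _ d]) (auto simp: abs_le_iff)
  qed
  define dd where "dd c th ka = (SOME d. \<bar>d\<bar> \<le> d0 \<and> phase_integral c th ka d = (psi 0)\<^sup>2 / 2)" for c th ka
  have dd: "\<bar>dd c th ka\<bar> \<le> d0 \<and> phase_integral c th ka (dd c th ka) = (psi 0)\<^sup>2 / 2" if "near_base s1 c th ka" for c th ka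
    unfolding dd_def by (rule someI_ex[OF ex[OF that]])
  have lower: "\<bar>d - d'\<bar> * (I / 2) \<le> \<bar>phase_integral c th ka d - phase_integral c th ka d'\<bar>"
    if q: "near_base s1 c th ka" and d: "\<bar>d\<bar> \<le> d0" "\<bar>d'\<bar> \<le> d0" for c th ka d d'
  proof -
    have "\<bar>(d - d') * I\<bar> = \<bar>d - d'\<bar> * I" using I_pos by (simp add: abs_mult)
    moreover have "\<bar>d - d'\<bar> * I = \<bar>d - d'\<bar> * (I / 2) + \<bar>d - d'\<bar> * (I / 2)" by simp
    ultimately show ?thesis using incr[OF q d] by linarith
  qed
  have nbb: "near_base s1 1 0 1" using s1 by (intro near_base_base) simp
  have dd0: "dd 1 0 1 = 0"
  proof -
    have "\<bar>dd 1 0 1 - 0\<bar> * (I / 2) \<le> \<bar>phase_integral 1 0 1 (dd 1 0 1) - phase_integral 1 0 1 0\<bar>"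
      using dd[OF nbb] d0 by (intro lower[OF nbb]) auto
    then have "\<bar>dd 1 0 1\<bar> * (I / 2) \<le> 0" using dd[OF nbb] by (simp add: phase_integral_base)
    then show ?thesis using I_pos by (simp add: mult_le_0_iff)
  qed
  show ?thesis
  proof (rule exI[of _ s1], rule conjI[OF s1(1)], rule conjI[OF s1(2)], rule exI[of _ "2 * C4 / I"], rule conjI, use C4 I_pos in simp,
      rule exI[of _ dd], intro conjI allI impI dd0)
    fix c th ka assume q: "near_base s1 c th ka"
    show "\<bar>dd c th ka\<bar> \<le> 1" "phase_integral c th ka (dd c th ka) = (psi 0)\<^sup>2 / 2" using dd[OF q] d0 by auto
    fix c1 th1 ka1 assume q1: "near_base s1 c1 th1 ka1"
    have "\<bar>dd c th ka - dd c1 th1 ka1\<bar> * (I / 2) \<le> \<bar>phase_integral c th ka (dd c th ka) - phase_integral c th ka (dd c1 th1 ka1)\<bar>"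
      using dd[OF q] dd[OF q1] by (intro lower[OF q]) auto
    also have "\<dots> = \<bar>phase_integral c1 th1 ka1 (dd c1 th1 ka1) - phase_integral c th ka (dd c1 th1 ka1)\<bar>"
      using conjunct2[OF dd[OF q]] conjunct2[OF dd[OF q1]] by (simp only:)
    also have "\<dots> \<le> C4 * (\<bar>c1 - c\<bar> + \<bar>th1 - th\<bar> + \<bar>ka1 - ka\<bar>)" unfolding C4_def by (rule phase_integral_params[OF nb[OF q1] nb[OF q]])
    finally have "\<bar>dd c th ka - dd c1 th1 ka1\<bar> \<le> C4 * (\<bar>c1 - c\<bar> + \<bar>th1 - th\<bar> + \<bar>ka1 - ka\<bar>) / (I / 2)"
      using I_pos by (subst pos_le_divide_eq) auto
    then show "\<bar>dd c th ka - dd c1 th1 ka1\<bar> \<le> 2 * C4 / I * (\<bar>c - c1\<bar> + \<bar>th - th1\<bar> + \<bar>ka - ka1\<bar>)"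
      by (simp add: abs_minus_commute mult_ac)
  qed
qed

end

section \<open>The singularly perturbed fronts\<close>

context delay_front begin

text \<open>\<open>pt\<close> is the nonnegative root \<theta> of \<theta> + \<theta>^2 =
  \<epsilon>^2 and \<open>pc\<close> the time scale; \<open>pth\<close> and \<open>pka\<close> are
  the coefficients of the two factors 1 - \<theta> D and 1 + (1 + \<theta>) D in rescaled
  time.\<close>

definition pt :: "real \<Rightarrow> real" where "pt \<epsilon> = (sqrt (1 + 4 * \<epsilon>\<^sup>2) - 1) / 2"
definition pc :: "real \<Rightarrow> real" where "pc \<epsilon> = lambda1 p h \<epsilon> / lam"
definition pth :: "real \<Rightarrow> real" where "pth \<epsilon> = pt \<epsilon> * pc \<epsilon>"
definition pka :: "real \<Rightarrow> real" where "pka \<epsilon> = (1 + pt \<epsilon>) * pc \<epsilon>"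

lemma pt_nonneg: "pt \<epsilon> \<ge> 0"
  by (simp add: pt_def)

lemma pt_root: "pt \<epsilon> + (pt \<epsilon>)\<^sup>2 = \<epsilon>\<^sup>2"
proof -
  have "(sqrt (1 + 4 * \<epsilon>\<^sup>2))\<^sup>2 = 1 + 4 * \<epsilon>\<^sup>2" by (rule real_sqrt_pow2) (simp add: add_nonneg_nonneg)
  then show ?thesis by (simp add: pt_def power_divide power2_diff field_simps)
qed

text \<open>Multiplying out ((1 + \<theta>) z + 1)(1 - \<theta> z) = 1 + z - \<epsilon>^2 z^2 turns
  the equation for lambda_1 into the root condition of \<open>admissible\<close>. All parameters are
  Lipschitz functions of \<epsilon>^2.\<close>

lemma parameters:
  "\<exists>e1>0. \<exists>D\<ge>0. \<forall>\<epsilon>. \<bar>\<epsilon>\<bar> < e1 \<longrightarrow> admissible (pc \<epsilon>) (pth \<epsilon>) (pka \<epsilon>) \<and> pc \<epsilon> \<ge> 1 \<and>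
    (\<forall>\<epsilon>1. \<bar>\<epsilon>1\<bar> < e1 \<longrightarrow> \<bar>pc \<epsilon> - pc \<epsilon>1\<bar> + \<bar>pth \<epsilon> - pth \<epsilon>1\<bar> + \<bar>pka \<epsilon> - pka \<epsilon>1\<bar> \<le> D * \<bar>\<epsilon>\<^sup>2 - \<epsilon>1\<^sup>2\<bar>)"
proof -
  \<comment> \<open>The constant is 16 rather than 8 because lambda_1 may be as large as 2
    lam.\<close>
  define e1 where "e1 = min 1 (1 / (16 * lam))"
  have e1: "e1 > 0" using lam by (simp add: e1_def)
  have sm: "\<epsilon>\<^sup>2 \<le> 1 \<and> 16 * \<epsilon>\<^sup>2 * lam \<le> 1" if "\<bar>\<epsilon>\<bar> < e1" for \<epsilon>
  proof -
    have l: "\<bar>\<epsilon>\<bar> \<le> 1" "\<bar>\<epsilon>\<bar> \<le> 1 / (16 * lam)" using that by (auto simp: e1_def)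
    have "\<epsilon>\<^sup>2 = \<bar>\<epsilon>\<bar> * \<bar>\<epsilon>\<bar>" by (simp add: power2_eq_square)
    also have "\<dots> \<le> \<bar>\<epsilon>\<bar> * 1" using l by (intro mult_left_mono) auto
    finally have "\<epsilon>\<^sup>2 \<le> \<bar>\<epsilon>\<bar>" by simp
    then have "\<epsilon>\<^sup>2 \<le> 1" "\<epsilon>\<^sup>2 \<le> 1 / (16 * lam)" using l by linarith+
    then show ?thesis using lam by (simp add: field_simps)
  qed
  note lp = lambda1_properties[OF p1 h lam lam_root]
  have La: "lam \<le> lambda1 p h \<epsilon>" "lambda1 p h \<epsilon> \<le> 2 * lam"
      "\<epsilon>\<^sup>2 * (lambda1 p h \<epsilon>)\<^sup>2 - lambda1 p h \<epsilon> - 1 + p * exp (- lambda1 p h \<epsilon> * h) = 0"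
      "\<And>z. 0 \<le> z \<Longrightarrow> z \<le> 2 * lam \<Longrightarrow> \<bar>lambda1 p h \<epsilon> - z\<bar> \<le> 2 * \<bar>\<epsilon>\<^sup>2 * z\<^sup>2 - z - 1 + p * exp (- z * h)\<bar>"
    if "\<bar>\<epsilon>\<bar> < e1" for \<epsilon>
  proof -
    have s: "8 * \<epsilon>\<^sup>2 * lam \<le> 1" using sm[OF that] lam mult_nonneg_nonneg[of "\<epsilon>\<^sup>2" lam] by simp
    show "lam \<le> lambda1 p h \<epsilon>" by (rule lp(1)[OF s])
    show "lambda1 p h \<epsilon> \<le> 2 * lam" by (rule lp(2)[OF s])
    show "\<epsilon>\<^sup>2 * (lambda1 p h \<epsilon>)\<^sup>2 - lambda1 p h \<epsilon> - 1 + p * exp (- lambda1 p h \<epsilon> * h) = 0" by (rule lp(4)[OF s])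
    show "\<bar>lambda1 p h \<epsilon> - z\<bar> \<le> 2 * \<bar>\<epsilon>\<^sup>2 * z\<^sup>2 - z - 1 + p * exp (- z * h)\<bar>" if "0 \<le> z" "z \<le> 2 * lam" for z
      by (rule lp(5)[OF s that])
  qed
  have pc: "pc \<epsilon> \<ge> 1" "pc \<epsilon> \<le> 2" "pc \<epsilon> * lam = lambda1 p h \<epsilon>" if "\<bar>\<epsilon>\<bar> < e1" for \<epsilon>
    using La(1,2)[OF that] lam by (auto simp: pc_def field_simps)
  have pt1: "pt \<epsilon> \<le> 1" "16 * lam * pt \<epsilon> \<le> 1" if "\<bar>\<epsilon>\<bar> < e1" for \<epsilon>
  proof -
    have "pt \<epsilon> \<le> \<epsilon>\<^sup>2" using pt_root[of \<epsilon>] zero_le_power2[of "pt \<epsilon>"] by linarith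
    then have "pt \<epsilon> \<le> 1" "16 * lam * pt \<epsilon> \<le> 16 * lam * \<epsilon>\<^sup>2" using sm[OF that] lam by (auto intro!: mult_left_mono)
    then show "pt \<epsilon> \<le> 1" "16 * lam * pt \<epsilon> \<le> 1" using sm[OF that] by (auto simp: mult_ac)
  qed
  have okp: "admissible (pc \<epsilon>) (pth \<epsilon>) (pka \<epsilon>)" if e: "\<bar>\<epsilon>\<bar> < e1" for \<epsilon>
  proof -
    define La' where "La' = lambda1 p h \<epsilon>"
    have th: "pth \<epsilon> * lam = pt \<epsilon> * La'" using pc(3)[OF e] by (simp add: pth_def La'_def mult.assoc)
    have "pt \<epsilon> * La' \<le> pt \<epsilon> * (2 * lam)" using La(2)[OF e] pt_nonneg by (intro mult_left_mono) (auto simp: La'_def)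
    then have thb: "8 * (pt \<epsilon> * La') \<le> 1" using pt1[OF e] by (simp add: mult_ac)
    have ka: "pka \<epsilon> * lam = (1 + pt \<epsilon>) * La'" using pc(3)[OF e] by (simp add: pka_def La'_def mult.assoc)
    have "((1 + pt \<epsilon>) * La' + 1) * (1 - pt \<epsilon> * La') = 1 + La' - (pt \<epsilon> + (pt \<epsilon>)\<^sup>2) * La'\<^sup>2"
      by (simp add: algebra_simps power2_eq_square)
    also have "\<dots> = p * exp (- La' * h)" unfolding pt_root using La(3)[OF e] by (simp add: La'_def)
    also have "- La' * h = - lam * (pc \<epsilon> * h)" using pc(3)[OF e] by (simp add: La'_def mult_ac)
    finally have "((1 + pt \<epsilon>) * La' + 1) * (1 - pt \<epsilon> * La') = p * exp (- lam * (pc \<epsilon> * h))" .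
    moreover have "1 - pt \<epsilon> * La' > 0" using thb by simp
    ultimately have ch: "(1 + pt \<epsilon>) * La' + 1 = p * exp (- lam * (pc \<epsilon> * h)) / (1 - pt \<epsilon> * La')" by (simp add: field_simps)
    have "1 * 1 \<le> (1 + pt \<epsilon>) * pc \<epsilon>" using pc(1)[OF e] pt_nonneg[of \<epsilon>] by (intro mult_mono) auto
    then have ka1: "pka \<epsilon> \<ge> 1" by (simp add: pka_def)
    have th8: "8 * lam * pth \<epsilon> = 8 * (pth \<epsilon> * lam)" by simp
    show ?thesis unfolding admissible_def
    proof (intro conjI)
      show "0 \<le> pc \<epsilon>" using pc(1)[OF e] by simp
      then show "0 \<le> pth \<epsilon>" unfolding pth_def using pt_nonneg by simp
      show "8 * lam * pth \<epsilon> \<le> 1" unfolding th8 th by (rule thb)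
      show "1 \<le> pka \<epsilon>" by (rule ka1)
      show "pka \<epsilon> * lam + 1 = p * exp (- lam * (pc \<epsilon> * h)) / (1 - pth \<epsilon> * lam)" unfolding th ka by (rule ch)
    qed
  qed
  have lip: "\<bar>pc \<epsilon> - pc \<epsilon>1\<bar> + \<bar>pth \<epsilon> - pth \<epsilon>1\<bar> + \<bar>pka \<epsilon> - pka \<epsilon>1\<bar> \<le> (32 * lam + 4) * \<bar>\<epsilon>\<^sup>2 - \<epsilon>1\<^sup>2\<bar>"
    if e: "\<bar>\<epsilon>\<bar> < e1" and e': "\<bar>\<epsilon>1\<bar> < e1" for \<epsilon> \<epsilon>1
  proof -
    define a where "a = \<bar>\<epsilon>\<^sup>2 - \<epsilon>1\<^sup>2\<bar>"
    define L0 where "L0 = lambda1 p h \<epsilon>"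
    define L1 where "L1 = lambda1 p h \<epsilon>1"
    have L1: "lam \<le> L1" "L1 \<le> 2 * lam" using La(1,2)[OF e'] by (auto simp: L1_def)
    \<comment> \<open>The root for the second parameter is inserted into the characteristic function
      of the first; its value there is (\<epsilon>^2 - \<epsilon>1^2) L1^2.\<close>
    have "\<bar>L0 - L1\<bar> \<le> 2 * \<bar>\<epsilon>\<^sup>2 * L1\<^sup>2 - L1 - 1 + p * exp (- L1 * h)\<bar>"
      unfolding L0_def using L1 lam by (intro La(4)[OF e]) auto
    also have "\<epsilon>\<^sup>2 * L1\<^sup>2 - L1 - 1 + p * exp (- L1 * h) = (\<epsilon>\<^sup>2 - \<epsilon>1\<^sup>2) * L1\<^sup>2"
      using La(3)[OF e'] by (simp add: L1_def algebra_simps)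
    also have "2 * \<bar>(\<epsilon>\<^sup>2 - \<epsilon>1\<^sup>2) * L1\<^sup>2\<bar> = 2 * (a * L1\<^sup>2)" by (simp add: a_def abs_mult)
    also have "\<dots> \<le> 2 * (a * (2 * lam)\<^sup>2)" using L1 lam by (intro mult_left_mono power_mono) (auto simp: a_def)
    finally have "\<bar>L0 - L1\<bar> \<le> 8 * lam * a * lam" by (simp add: power2_eq_square mult_ac)
    moreover have "pc \<epsilon> - pc \<epsilon>1 = (L0 - L1) / lam" by (simp add: pc_def L0_def L1_def diff_divide_distrib)
    ultimately have c: "\<bar>pc \<epsilon> - pc \<epsilon>1\<bar> \<le> 8 * lam * a" using lam by (simp add: pos_divide_le_eq)
    have t: "\<bar>pt \<epsilon> - pt \<epsilon>1\<bar> \<le> a"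
    proof -
      have "\<epsilon>\<^sup>2 - \<epsilon>1\<^sup>2 = (pt \<epsilon> - pt \<epsilon>1) * (1 + pt \<epsilon> + pt \<epsilon>1)"
        unfolding pt_root[of \<epsilon>, symmetric] pt_root[of \<epsilon>1, symmetric] by (simp add: algebra_simps power2_eq_square)
      then have "a = \<bar>pt \<epsilon> - pt \<epsilon>1\<bar> * (1 + pt \<epsilon> + pt \<epsilon>1)"
        using pt_nonneg[of \<epsilon>] pt_nonneg[of \<epsilon>1] by (simp add: a_def abs_mult)
      moreover have "\<bar>pt \<epsilon> - pt \<epsilon>1\<bar> * 1 \<le> \<bar>pt \<epsilon> - pt \<epsilon>1\<bar> * (1 + pt \<epsilon> + pt \<epsilon>1)"
        using pt_nonneg[of \<epsilon>] pt_nonneg[of \<epsilon>1] by (intro mult_left_mono) auto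
      ultimately show ?thesis by simp
    qed
    have th: "\<bar>pth \<epsilon> - pth \<epsilon>1\<bar> \<le> 2 * a + 8 * lam * a"
    proof -
      have "pth \<epsilon> - pth \<epsilon>1 = (pt \<epsilon> - pt \<epsilon>1) * pc \<epsilon> + pt \<epsilon>1 * (pc \<epsilon> - pc \<epsilon>1)"
        by (simp add: pth_def algebra_simps)
      moreover have "\<bar>(pt \<epsilon> - pt \<epsilon>1) * pc \<epsilon>\<bar> \<le> a * 2"
        unfolding abs_mult using t pc(1,2)[OF e] by (intro mult_mono) auto
      moreover have "\<bar>pt \<epsilon>1 * (pc \<epsilon> - pc \<epsilon>1)\<bar> \<le> 1 * (8 * lam * a)"
        unfolding abs_mult using c pt1(1)[OF e'] pt_nonneg[of \<epsilon>1] by (intro mult_mono) auto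
      ultimately show ?thesis by linarith
    qed
    have "pka \<epsilon> - pka \<epsilon>1 = (pc \<epsilon> - pc \<epsilon>1) + (pth \<epsilon> - pth \<epsilon>1)" by (simp add: pka_def pth_def algebra_simps)
    then have k: "\<bar>pka \<epsilon> - pka \<epsilon>1\<bar> \<le> \<bar>pc \<epsilon> - pc \<epsilon>1\<bar> + \<bar>pth \<epsilon> - pth \<epsilon>1\<bar>" by (simp only: abs_triangle_ineq)
    have "x + y + z \<le> 2 * u + 2 * v" if "z \<le> x + y" "x \<le> u" "y \<le> v" for x y z u v :: real using that by linarith
    from this[OF k c th] have "\<bar>pc \<epsilon> - pc \<epsilon>1\<bar> + \<bar>pth \<epsilon> - pth \<epsilon>1\<bar> + \<bar>pka \<epsilon> - pka \<epsilon>1\<bar> \<le> 2 * (8 * lam * a) + 2 * (2 * a + 8 * lam * a)" .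
    also have "\<dots> = (32 * lam + 4) * a" by (simp add: algebra_simps)
    finally show ?thesis by (simp add: a_def)
  qed
  show ?thesis
    by (rule exI[of _ e1], rule conjI[OF e1], rule exI[of _ "32 * lam + 4"]) (use okp pc(1) lip lam in auto)
qed

lemma parameters_base: "pc 0 = 1" "pth 0 = 0" "pka 0 = 1"
proof -
  have "lambda1 p h 0 = lam"
    using lambda1_properties(1,3)[OF p1 h lam lam_root, of 0] lam by simp
  then show "pc 0 = 1" using lam by (simp add: pc_def)
  then show "pth 0 = 0" "pka 0 = 1" by (simp_all add: pth_def pka_def pt_def)
qed

end

context front_family begin

text \<open>Near minus infinity the leading term A exp(lam t) beats the correction for all
  parameters at once; on the remaining half-line psi is bounded below by a positive constant, and
  closeness in the sup norm suffices.\<close>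

lemma positive: "\<exists>s2>0. s2 \<le> s0 \<and> (\<forall>c th ka t. near_base s2 c th ka \<longrightarrow> Y c th ka t > 0)"
proof -
  define T where "T = ln (A / (2 * C)) / lam"
  have eT: "exp (lam * T) = A / (2 * C)" using A C lam by (simp add: T_def)
  have left: "Y c th ka t > 0" if "near_base s0 c th ka" "t \<le> T" for c th ka t
  proof -
    have "exp (lam * t) \<le> A / (2 * C)" using that(2) lam eT[symmetric] by simp
    then have "C * exp (lam * t) \<le> A / 2" using C by (simp add: field_simps)
    then have "C * exp (lam * t) * exp (lam * t) \<le> A / 2 * exp (lam * t)" by (intro mult_right_mono) auto
    then have "C * exp (2 * lam * t) \<le> A / 2 * exp (lam * t)" by (simp add: mult.assoc exp_add[symmetric])
    moreover have "A / 2 * exp (lam * t) > 0" using A by simp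
    ultimately show ?thesis using Y_A[OF that(1), of t] by linarith
  qed
  from order_tendstoD(1)[OF psi_K, of "K / 2"] K obtain b where b: "\<And>t. t \<ge> b \<Longrightarrow> psi t > K / 2"
    by (auto simp: eventually_at_top_linorder)
  define b' where "b' = max b T"
  have "compact (psi ` {T..b'})" by (intro compact_continuous_image continuous_on_subset[OF psi_cont]) auto
  moreover have "psi ` {T..b'} \<noteq> {}" by (auto simp: b'_def)
  ultimately obtain m0 where m0: "m0 \<in> psi ` {T..b'}" "\<And>y. y \<in> psi ` {T..b'} \<Longrightarrow> m0 \<le> y" using compact_attains_inf by metis
  define m where "m = min m0 (K / 2)"
  have m: "m > 0" using m0(1) psi_pos K by (auto simp: m_def)
  have mp: "m \<le> psi t" if "t \<ge> T" for t
  proof (cases "t \<le> b'")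
    case True then show ?thesis using m0(2)[of "psi t"] that by (auto simp: m_def)
  next
    case False
    then have "psi t > K / 2" by (intro b) (simp add: b'_def)
    moreover have "m \<le> K / 2" by (simp add: m_def)
    ultimately show ?thesis by linarith
  qed
  define s2 where "s2 = min s0 (m / (2 * C))"
  have s2: "s2 > 0" "s2 \<le> s0" using s0 m C by (auto simp: s2_def)
  have "Y c th ka t > 0" if q: "near_base s2 c th ka" for c th ka t
  proof -
    have q0: "near_base s0 c th ka" using q s2 by (auto simp: near_base_def)
    show ?thesis
    proof (cases "t \<le> T")
      case False
      let ?d = "\<bar>c - 1\<bar> + \<bar>th - 0\<bar> + \<bar>ka - 1\<bar>"
      have "C * ?d * m2 t \<le> C * ?d * 1" using C m2_le_1 by (intro mult_left_mono) auto
      also have "\<dots> \<le> C * (m / (2 * C)) * 1"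
        using C q by (intro mult_right_mono mult_left_mono) (auto simp: near_base_def s2_def)
      also have "\<dots> = m / 2" using C by simp
      finally show ?thesis using Y_lip[OF q0 base_s0, of t] mp[of t] False m unfolding Y_base by linarith
    qed (rule left[OF q0])
  qed
  then show ?thesis using s2 by blast
qed

section \<open>The fronts in the original time: limits, norm, equation, asymptotics\<close>

lemma affine_at_top: "filterlim (\<lambda>t::real. c * t + d) at_top at_top" if "c \<ge> 1"
  unfolding filterlim_at_top
proof
  fix Z
  show "\<forall>\<^sub>F t in at_top. Z \<le> c * t + d"
    using eventually_ge_at_top[of "(Z - d) / c"] by eventually_elim (use that in \<open>simp add: field_simps\<close>)
qed

lemma affine_at_bot: "filterlim (\<lambda>t::real. c * t + d) at_bot at_bot" if "c \<ge> 1"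
  unfolding filterlim_at_bot
proof
  fix Z
  show "\<forall>\<^sub>F t in at_bot. c * t + d \<le> Z"
    using eventually_le_at_bot[of "(Z - d) / c"] by eventually_elim (use that in \<open>simp add: field_simps\<close>)
qed

lemma Z_limits:
  assumes q: "near_base s0 c th ka"
  shows "((\<lambda>t. Y c th ka (c * t + d)) \<longlongrightarrow> K) at_top" "((\<lambda>t. Y c th ka (c * t + d)) \<longlongrightarrow> 0) at_bot"
proof -
  have c: "c \<ge> 1" using q by (simp add: near_base_def)
  show "((\<lambda>t. Y c th ka (c * t + d)) \<longlongrightarrow> K) at_top" by (rule filterlim_compose[OF Y_K[OF q] affine_at_top[OF c]])
  have "(Y c th ka \<longlongrightarrow> 0) at_bot"
  proof (rule Lim_null_comparison)
    show "\<forall>\<^sub>F t in at_bot. norm (Y c th ka t) \<le> C * exp (lam * t)"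
    proof (intro always_eventually allI)
      fix t show "norm (Y c th ka t) \<le> C * exp (lam * t)"
        using Y_m1[OF q, of t] mult_left_mono[OF m1_le_exp[of t] less_imp_le[OF C]] by simp
    qed
    have "filterlim (\<lambda>s. lam * s) at_bot at_bot"
      using lam by (intro filterlim_tendsto_pos_mult_at_bot[OF tendsto_const]) (auto intro: filterlim_ident)
    then show "((\<lambda>t. C * exp (lam * t)) \<longlongrightarrow> 0) at_bot"
      by (intro tendsto_mult_right_zero filterlim_compose[OF exp_at_bot])
  qed
  then show "((\<lambda>t. Y c th ka (c * t + d)) \<longlongrightarrow> 0) at_bot" by (rule filterlim_compose[OF _ affine_at_bot[OF c]])
qed

lemma m1_affine:
  assumes "c \<ge> 1" "\<bar>d\<bar> \<le> 1" "t \<le> 0"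
  shows "m1 (c * t + d) \<le> exp lam * exp (lam * t)"
proof -
  have "c * t \<le> 1 * t" using assms by (intro mult_right_mono_neg) auto
  then have "lam * (c * t + d) \<le> lam * (1 + t)" using assms lam by (intro mult_left_mono) auto
  then have "exp (lam * (c * t + d)) \<le> exp lam * exp (lam * t)" by (simp add: exp_add[symmetric] distrib_left)
  then show ?thesis using m1_le_exp[of "c * t + d"] by linarith
qed

lemma Z_Cmu:
  assumes q: "near_base s0 c th ka" and d: "\<bar>d\<bar> \<le> 1" and mu: "mu \<le> lam"
  shows "(\<lambda>t. Y c th ka (c * t + d)) \<in> Cmu mu"
proof -
  have c: "c \<ge> 1" using q by (simp add: near_base_def)
  have "exp (- mu * s) * \<bar>Y c th ka (c * s + d)\<bar> \<le> C * exp lam" if s: "s \<le> 0" for s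
  proof -
    have "\<bar>Y c th ka (c * s + d)\<bar> \<le> C * (exp lam * exp (lam * s))"
      using Y_m1[OF q, of "c * s + d"] mult_left_mono[OF m1_affine[OF c d s] less_imp_le[OF C]] by linarith
    then have "exp (- mu * s) * \<bar>Y c th ka (c * s + d)\<bar> \<le> exp (- mu * s) * (C * (exp lam * exp (lam * s)))"
      by (intro mult_left_mono) auto
    also have "\<dots> = C * exp lam * exp ((lam - mu) * s)" by (simp add: exp_add[symmetric] algebra_simps)
    also have "\<dots> \<le> C * exp lam * 1" using C mu s by (intro mult_left_mono) (auto simp: mult_nonneg_nonpos)
    finally show ?thesis by simp
  qed
  then show ?thesis unfolding Cmu_def using Yc_cont[OF q] Z_limits(1)[OF q] by blast
qed

text \<open>Different scales move the argument by |c - c1| |s|, so near minus infinity the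
  difference is of order |s| exp(lam s), and the weight exp(mu s) with mu < lam absorbs the factor
  |s|. For s \<ge> 0 the same growth is harmless on a bounded interval, and beyond it both arguments
  lie where the reference front is within e / 8 of \<open>K\<close>.\<close>

lemma Z_norm_continuous:
  assumes q1: "near_base s0 c1 th1 ka1" and d1: "\<bar>d1\<bar> \<le> 1" and mu: "mu < lam" and e: "e > 0"
  shows "\<exists>\<eta>>0. \<forall>c th ka d. near_base s0 c th ka \<longrightarrow> \<bar>d\<bar> \<le> 1 \<longrightarrow>
    \<bar>c - c1\<bar> + \<bar>th - th1\<bar> + \<bar>ka - ka1\<bar> < \<eta> \<longrightarrow> \<bar>d - d1\<bar> < \<eta> \<longrightarrow>
    norm_mu mu (\<lambda>s. Y c th ka (c * s + d) - Y c1 th1 ka1 (c1 * s + d1)) < e"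
proof -
  have c1: "c1 \<ge> 1" using q1 by (simp add: near_base_def)
  from tendstoD[OF Y_K[OF q1], of "e / 8"] e obtain T0 where T0: "\<And>t. t \<ge> T0 \<Longrightarrow> \<bar>Y c1 th1 ka1 t - K\<bar> < e / 8"
    by (auto simp: eventually_at_top_linorder dist_real_def)
  \<comment> \<open>The added 1 compensates the translations, which are at most 1 in size; the
    scales c, c1 \<ge> 1 only move nonnegative arguments further right.\<close>
  define T where "T = max (T0 + 1) 0"
  define W1 where "W1 = C * (1 + T + 1)"
  define W2 where "W2 = C * exp lam * (2 + 1 / (lam - mu))"
  define W where "W = 1 + C + W1 + W2"
  have nn: "W1 \<ge> 0" "W2 \<ge> 0" unfolding W1_def W2_def using C mu by (auto simp: T_def)
  have W: "W > 0" "C \<le> W" "W1 \<le> W" "W2 \<le> W" using nn C by (auto simp: W_def)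
  define \<eta> where "\<eta> = e / (4 * W)"
  have \<eta>: "\<eta> > 0" "W * \<eta> = e / 4" using e W by (auto simp: \<eta>_def)
  have "norm_mu mu (\<lambda>s. Y c th ka (c * s + d) - Y c1 th1 ka1 (c1 * s + d1)) < e"
    if q: "near_base s0 c th ka" and d: "\<bar>d\<bar> \<le> 1" and dl: "\<bar>c - c1\<bar> + \<bar>th - th1\<bar> + \<bar>ka - ka1\<bar> < \<eta>" and dd: "\<bar>d - d1\<bar> < \<eta>" for c th ka d
  proof -
    have c: "c \<ge> 1" using q by (simp add: near_base_def)
    have cc: "\<bar>c - c1\<bar> \<le> \<eta>" using dl by linarith
    let ?d = "\<bar>c - c1\<bar> + \<bar>th - th1\<bar> + \<bar>ka - ka1\<bar>"
    let ?D = "\<lambda>s. Y c th ka (c * s + d) - Y c1 th1 ka1 (c1 * s + d1)"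
    have far: "\<bar>?D s\<bar> \<le> e / 2" if s: "s \<ge> 0" for s
    proof (cases "s \<ge> T")
      case True
      have "1 * s \<le> c * s" "1 * s \<le> c1 * s" using mult_right_mono[OF c s] mult_right_mono[OF c1 s] by auto
      then have "c * s + d \<ge> T0" "c1 * s + d1 \<ge> T0" using d d1 True by (auto simp: T_def abs_le_iff)
      then have "\<bar>Y c1 th1 ka1 (c * s + d) - Y c1 th1 ka1 (c1 * s + d1)\<bar> < e / 4"
        using T0[of "c * s + d"] T0[of "c1 * s + d1"] by linarith
      moreover have "\<bar>Y c th ka (c * s + d) - Y c1 th1 ka1 (c * s + d)\<bar> \<le> C * \<eta>"
      proof -
        have "C * ?d * m2 (c * s + d) \<le> C * \<eta> * 1" using C dl m2_le_1 m2_pos less_imp_le by (intro mult_mono mult_left_mono) auto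
        then show ?thesis using Y_lip[OF q q1, of "c * s + d"] by linarith
      qed
      moreover have "C * \<eta> \<le> e / 4" using mult_right_mono[OF W(2) less_imp_le[OF \<eta>(1)]] \<eta>(2) by linarith
      ultimately show ?thesis by linarith
    next
      case False
      have "C * ?d * m1 (c * s + d) \<le> C * \<eta> * 1" using C dl m1_le_1 m1_pos less_imp_le by (intro mult_mono mult_left_mono) auto
      moreover have "C * (\<bar>c - c1\<bar> * \<bar>s\<bar> + \<bar>d - d1\<bar>) * m1 (max (c * s + d) (c1 * s + d1)) \<le> C * (\<eta> * T + \<eta>) * 1"
        using C cc dd False s m1_le_1 m1_pos less_imp_le \<eta> by (intro mult_mono mult_left_mono add_mono) (auto simp: T_def)
      ultimately have "\<bar>?D s\<bar> \<le> C * \<eta> + C * (\<eta> * T + \<eta>)" using Y_two_params[OF q q1, of s d d1] by linarith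
      also have "\<dots> = W1 * \<eta>" by (simp add: W1_def algebra_simps)
      also have "\<dots> \<le> W * \<eta>" using W \<eta> by (intro mult_right_mono) auto
      finally show ?thesis using \<eta> e by linarith
    qed
    have near: "exp (- mu * s) * \<bar>?D s\<bar> \<le> e / 2" if s: "s \<le> 0" for s
    proof -
      let ?E = "exp lam * exp (lam * s)"
      have m: "m1 (c * s + d) \<le> ?E" "m1 (max (c * s + d) (c1 * s + d1)) \<le> ?E"
        using m1_affine[OF c d s] m1_affine[OF c1 d1 s] by (auto simp: max_def)
      have "C * ?d * m1 (c * s + d) \<le> C * \<eta> * ?E" using C dl m m1_pos less_imp_le by (intro mult_mono mult_left_mono) auto
      moreover have "C * (\<bar>c - c1\<bar> * \<bar>s\<bar> + \<bar>d - d1\<bar>) * m1 (max (c * s + d) (c1 * s + d1)) \<le> C * (\<eta> * \<bar>s\<bar> + \<eta>) * ?E"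
        using C cc dd m m1_pos less_imp_le \<eta> by (intro mult_mono mult_left_mono add_mono mult_right_mono) auto
      ultimately have "\<bar>?D s\<bar> \<le> C * \<eta> * ?E + C * (\<eta> * \<bar>s\<bar> + \<eta>) * ?E" using Y_two_params[OF q q1, of s d d1] by linarith
      also have "\<dots> = C * \<eta> * exp lam * ((2 + \<bar>s\<bar>) * exp (lam * s))" by (simp add: algebra_simps)
      finally have "exp (- mu * s) * \<bar>?D s\<bar> \<le> exp (- mu * s) * (C * \<eta> * exp lam * ((2 + \<bar>s\<bar>) * exp (lam * s)))"
        by (intro mult_left_mono) auto
      also have "\<dots> = C * \<eta> * exp lam * ((2 + \<bar>s\<bar>) * exp ((lam - mu) * s))"
        by (simp add: exp_add[symmetric] algebra_simps)
      also have "(2 + \<bar>s\<bar>) * exp ((lam - mu) * s) \<le> 2 + 1 / (lam - mu)"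
      proof -
        have e1: "exp ((lam - mu) * s) \<le> 1" using s mu by (simp add: mult_nonneg_nonpos)
        have "1 + - (lam - mu) * s \<le> exp (- (lam - mu) * s)" by (rule exp_ge_add_one_self)
        moreover have "\<bar>s\<bar> = - s" using s by simp
        then have "(lam - mu) * \<bar>s\<bar> = - (lam - mu) * s" by (simp only: mult_minus_left mult_minus_right)
        ultimately have "(lam - mu) * \<bar>s\<bar> \<le> exp (- (lam - mu) * s)" by linarith
        then have "(lam - mu) * \<bar>s\<bar> * exp ((lam - mu) * s) \<le> exp (- (lam - mu) * s) * exp ((lam - mu) * s)" by (intro mult_right_mono) auto
        also have "\<dots> = 1" by (simp only: exp_add[symmetric] mult_minus_left) simp
        finally have "\<bar>s\<bar> * exp ((lam - mu) * s) \<le> 1 / (lam - mu)" using mu by (simp add: field_simps)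
        then show ?thesis using e1 unfolding distrib_right by linarith
      qed
      then have "C * \<eta> * exp lam * ((2 + \<bar>s\<bar>) * exp ((lam - mu) * s)) \<le> C * \<eta> * exp lam * (2 + 1 / (lam - mu))"
        using C \<eta> by (intro mult_left_mono) auto
      also have "\<dots> = W2 * \<eta>" by (simp add: W2_def)
      also have "\<dots> \<le> W * \<eta>" using W \<eta> by (intro mult_right_mono) auto
      finally show ?thesis using \<eta> e by linarith
    qed
    have "(SUP s\<in>{0..}. \<bar>?D s\<bar>) \<le> e / 2" by (rule cSUP_least) (use far in auto)
    moreover have "(SUP s\<in>{..0}. exp (- mu * s) * \<bar>?D s\<bar>) \<le> e / 2" by (rule cSUP_least) (use near in auto)
    ultimately show ?thesis unfolding norm_mu_def using e by simp
  qed
  with \<eta>(1) show ?thesis by blast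
qed

lemma Z_deriv:
  assumes "near_base s0 c th ka"
  shows "((\<lambda>t. Y c th ka (c * t + d)) has_real_derivative c * Y' c th ka (c * t + d)) (at t)"
proof -
  have "((\<lambda>t. Y c th ka (c * t + d)) has_real_derivative Y' c th ka (c * t + d) * c) (at t)"
    by (rule DERIV_chain2[where g = "\<lambda>t. c * t + d", OF Y_deriv[OF assms]]) (auto intro!: derivative_eq_intros)
  then show ?thesis by (simp add: mult.commute)
qed

text \<open>The factorization is run backwards: the average V satisfies \<theta> V' = V - G(Z(t -
  h)) and Z' = (V - Z) / (1 + \<theta>), and eliminating V gives the second order equation. At
  \<theta> = 0 the first relation is algebraic, and V' exists by the chain rule instead.\<close>

lemma Z_second_order:
  fixes d :: real
  assumes q: "near_base s0 c th ka" and \<theta>: "\<theta> \<ge> 0" and th: "th = \<theta> * c" and ka: "ka = (1 + \<theta>) * c"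
    and \<epsilon>: "\<epsilon>\<^sup>2 = \<theta> + \<theta>\<^sup>2"
  defines "Z \<equiv> \<lambda>t. Y c th ka (c * t + d)"
  shows "\<exists>x1 x2. \<forall>t. (Z has_real_derivative x1 t) (at t) \<and> (x1 has_real_derivative x2 t) (at t) \<and>
    \<epsilon>\<^sup>2 * x2 t - x1 t - Z t + G (Z (t - h)) = 0"
proof -
  have c: "c \<ge> 1" using q by (simp add: near_base_def)
  define F where "F s = G (Y c th ka s)" for s
  define V where "V t = shifted_avg c th F (c * t + d)" for t
  define x1 where "x1 t = (V t - Z t) / (1 + \<theta>)" for t
  have x1: "x1 t = c * Y' c th ka (c * t + d)" for t
    using Y_eq[OF q, of "c * t + d"] \<theta> unfolding x1_def V_def F_def[abs_def] Z_def ka by (simp add: field_simps)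
  have Zd: "(Z has_real_derivative x1 t) (at t)" for t unfolding x1 Z_def by (rule Z_deriv[OF q])
  have FZ: "F (c * t + d - c * h) = G (Z (t - h))" for t by (simp add: F_def Z_def algebra_simps)
  have Fd: "(F has_real_derivative G' (Y c th ka s) * Y' c th ka s) (at s)" for s
    unfolding F_def[abs_def] by (rule DERIV_chain2[OF dG Y_deriv[OF q]])
  have Fc: "continuous_on UNIV F" using DERIV_isCont[OF Fd] by (auto simp: continuous_on_eq_continuous_at)
  have "\<exists>V'. \<forall>t. (V has_real_derivative V' t) (at t) \<and> \<theta> * V' t = V t - G (Z (t - h))"
  proof (cases "\<theta> = 0")
    case True
    then have "V t = G (Z (t - h))" for t using FZ[of t] by (simp add: V_def shifted_avg_def th)
    then have Ve: "V = (\<lambda>t. G (Z (t - h)))" by auto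
    have "((\<lambda>t. G (Z (t - h))) has_real_derivative G' (Z (t - h)) * x1 (t - h)) (at t)" for t
      by (rule DERIV_chain2[OF dG DERIV_delay[where h = h, OF Zd]])
    then show ?thesis using True unfolding Ve by (intro exI[of _ "\<lambda>t. G' (Z (t - h)) * x1 (t - h)"]) auto
  next
    case False
    then have th0: "th \<noteq> 0" using c by (simp add: th)
    have ad: "(avg th F has_real_derivative (avg th F s - F s) / th) (at s)" for s
      by (rule avg_derivative[OF Fc th0, of 0]) (use GY_C[OF q] in \<open>auto simp: F_def\<close>)
    have "((\<lambda>t. avg th F (c * t + d - c * h)) has_real_derivative (avg th F (c * t + d - c * h) - F (c * t + d - c * h)) / th * c) (at t)" for t
      by (rule DERIV_chain2[where g = "\<lambda>t. c * t + d - c * h", OF ad]) (auto intro!: derivative_eq_intros)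
    then have "(V has_real_derivative (V t - G (Z (t - h))) / th * c) (at t)" for t
      unfolding V_def[abs_def] shifted_avg_def FZ[symmetric] .
    moreover have "\<theta> * ((V t - G (Z (t - h))) / th * c) = V t - G (Z (t - h))" for t
      using False c by (simp add: th)
    ultimately show ?thesis by (intro exI[of _ "\<lambda>t. (V t - G (Z (t - h))) / th * c"]) auto
  qed
  then obtain V' where V': "\<And>t. (V has_real_derivative V' t) (at t)" "\<And>t. \<theta> * V' t = V t - G (Z (t - h))" by blast
  define x2 where "x2 t = (V' t - x1 t) / (1 + \<theta>)" for t
  have x1d: "(x1 has_real_derivative x2 t) (at t)" for t
    unfolding x1_def[abs_def] x2_def by (intro DERIV_cdivide DERIV_diff V') (use Zd in \<open>simp add: x1_def\<close>)
  have "\<epsilon>\<^sup>2 * x2 t - x1 t - Z t + G (Z (t - h)) = 0" for t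
  proof -
    have t1: "(1 + \<theta>) * x1 t = V t - Z t" "(1 + \<theta>) * x2 t = V' t - x1 t" using \<theta> by (auto simp: x1_def x2_def)
    have "\<epsilon>\<^sup>2 * x2 t = \<theta> * ((1 + \<theta>) * x2 t)" unfolding \<epsilon> by (simp add: algebra_simps power2_eq_square)
    also have "\<dots> = \<theta> * V' t - \<theta> * x1 t" unfolding t1 by (simp add: algebra_simps)
    finally show ?thesis using V'(2)[of t] t1(1) by (simp add: algebra_simps)
  qed
  with Zd x1d show ?thesis by blast
qed

text \<open>The shift \<open>t0\<close> normalizes the leading coefficient: it solves A exp(lam (d -
  c t0)) = 1. The remainder, of order exp(2 lam c t), is O(exp(2 lam t)) since c \<ge> 1.\<close>

lemma Z_asymptotics:
  fixes d :: real
  assumes q: "near_base s0 c th ka"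
  defines "Z \<equiv> \<lambda>t. Y c th ka (c * t + d)"
  shows "\<exists>t0. (\<lambda>t. Z (t - t0) - exp (c * lam * t)) \<in> O[at_bot](\<lambda>t. exp (2 * lam * t)) \<and>
    (\<lambda>t. deriv Z (t - t0) - c * lam * exp (c * lam * t)) \<in> O[at_bot](\<lambda>t. exp (2 * lam * t)) \<and>
    (\<exists>z. \<forall>t\<le>z. deriv Z t > 0)"
proof -
  have c: "c \<ge> 1" using q by (simp add: near_base_def)
  have Zd: "deriv Z t = c * Y' c th ka (c * t + d)" for t
    unfolding Z_def by (rule DERIV_imp_deriv[OF Z_deriv[OF q]])
  define t0 where "t0 = (ln A + lam * d) / (c * lam)"
  define s where "s t = c * (t - t0) + d" for t
  have t0: "c * lam * t0 = ln A + lam * d" using c lam by (simp add: t0_def)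
  have Ae: "A * exp (lam * s t) = exp (c * lam * t)" for t
  proof -
    have "lam * s t = c * lam * t - c * lam * t0 + lam * d" by (simp add: s_def algebra_simps)
    also have "\<dots> = c * lam * t - ln A" unfolding t0 by simp
    finally show ?thesis using A by (simp add: exp_diff)
  qed
  define k where "k = exp (2 * lam * (d - c * t0))"
  have ke: "exp (2 * lam * s t) \<le> k * exp (2 * lam * t)" if "t \<le> 0" for t
  proof -
    have "c * t \<le> 1 * t" using c that by (intro mult_right_mono_neg) auto
    then have "2 * lam * s t \<le> 2 * lam * ((d - c * t0) + t)" using lam by (intro mult_left_mono) (auto simp: s_def algebra_simps)
    then show ?thesis by (simp add: k_def exp_add[symmetric] distrib_left)
  qed
  show ?thesis
  proof (rule exI[of _ t0], intro conjI)
    show "(\<lambda>t. Z (t - t0) - exp (c * lam * t)) \<in> O[at_bot](\<lambda>t. exp (2 * lam * t))"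
    proof (rule bigoI[where c = "C * k"])
      show "\<forall>\<^sub>F t in at_bot. norm (Z (t - t0) - exp (c * lam * t)) \<le> C * k * norm (exp (2 * lam * t))"
        using eventually_le_at_bot[of 0]
      proof eventually_elim
        case (elim t)
        have "\<bar>Z (t - t0) - exp (c * lam * t)\<bar> \<le> C * exp (2 * lam * s t)"
          using Y_A[OF q, of "s t"] unfolding Ae by (simp add: Z_def s_def)
        then show ?case using mult_left_mono[OF ke[OF elim] less_imp_le[OF C]] by simp
      qed
    qed
    show "(\<lambda>t. deriv Z (t - t0) - c * lam * exp (c * lam * t)) \<in> O[at_bot](\<lambda>t. exp (2 * lam * t))"
    proof (rule bigoI[where c = "c * C * k"])
      show "\<forall>\<^sub>F t in at_bot. norm (deriv Z (t - t0) - c * lam * exp (c * lam * t)) \<le> c * C * k * norm (exp (2 * lam * t))"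
        using eventually_le_at_bot[of 0]
      proof eventually_elim
        case (elim t)
        have "deriv Z (t - t0) - c * lam * exp (c * lam * t) = c * (Y' c th ka (s t) - A * lam * exp (lam * s t))"
          unfolding Zd Ae[symmetric] by (simp add: s_def algebra_simps)
        then have "\<bar>deriv Z (t - t0) - c * lam * exp (c * lam * t)\<bar> = c * \<bar>Y' c th ka (s t) - A * lam * exp (lam * s t)\<bar>"
          using c by (simp add: abs_mult)
        also have "\<dots> \<le> c * (C * exp (2 * lam * s t))" using Y'_A[OF q, of "s t"] c by (intro mult_left_mono) auto
        also have "\<dots> \<le> c * (C * (k * exp (2 * lam * t)))" using ke[OF elim] C c by (intro mult_left_mono) auto
        finally show ?case by (simp add: mult.assoc)
      qed
    qed
    \<comment> \<open>To the left of this point, in rescaled time, the correction is at most half of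
      the leading term A lam exp(lam s).\<close>
    define z where "z = ln (A * lam / (2 * C)) / lam"
    have ez: "exp (lam * z) = A * lam / (2 * C)" using A C lam by (simp add: z_def)
    have "deriv Z t > 0" if t: "t \<le> (z - d) / c" for t
    proof -
      define r where "r = c * t + d"
      have "r \<le> z" using t c by (simp add: r_def field_simps)
      then have "exp (lam * r) \<le> A * lam / (2 * C)" using lam ez[symmetric] by simp
      then have "C * exp (lam * r) \<le> A * lam / 2" using C by (simp add: field_simps)
      then have "C * exp (lam * r) * exp (lam * r) \<le> A * lam / 2 * exp (lam * r)" by (intro mult_right_mono) auto
      then have 1: "C * exp (2 * lam * r) \<le> (A * lam * exp (lam * r)) / 2" by (simp add: mult.assoc exp_add[symmetric])
      have "y > 0" if "\<bar>y - w\<bar> \<le> e" "e \<le> w / 2" "w > 0" for y w e :: real using that by linarith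
      from this[OF Y'_A[OF q] 1] have "Y' c th ka r > 0" using A lam by simp
      then show ?thesis unfolding Zd using c by (simp add: r_def)
    qed
    then show "\<exists>z. \<forall>t\<le>z. deriv Z t > 0" by blast
  qed
qed

lemma singular_family:
  assumes \<delta>: "0 < \<delta>" "\<delta> < lam" and g: "\<And>x. x > 0 \<Longrightarrow> g x = G x"
  shows "\<exists>\<epsilon>0 > 0. \<exists>\<Psi> :: real \<Rightarrow> real \<Rightarrow> real.
       (\<forall>\<epsilon>\<in>{-\<epsilon>0<..<\<epsilon>0}. \<Psi> \<epsilon> \<in> Cmu (lam - \<delta>)) \<and>
       (\<forall>\<epsilon>1\<in>{-\<epsilon>0<..<\<epsilon>0}. \<forall>e>0. \<exists>d>0. \<forall>\<epsilon>\<in>{-\<epsilon>0<..<\<epsilon>0}.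
          \<bar>\<epsilon> - \<epsilon>1\<bar> < d \<longrightarrow> norm_mu (lam - \<delta>) (\<lambda>s. \<Psi> \<epsilon> s - \<Psi> \<epsilon>1 s) < e) \<and>
       (\<forall>\<epsilon>\<in>{-\<epsilon>0<..<\<epsilon>0}.
          (\<forall>t. \<Psi> \<epsilon> t > 0) \<and>
          (\<exists>x1 x2. \<forall>t. (\<Psi> \<epsilon> has_real_derivative x1 t) (at t) \<and>
                        (x1 has_real_derivative x2 t) (at t) \<and>
                        \<epsilon>^2 * x2 t - x1 t - \<Psi> \<epsilon> t + g (\<Psi> \<epsilon> (t - h)) = 0) \<and>
          (\<Psi> \<epsilon> \<longlongrightarrow> 0) at_bot \<and> (\<Psi> \<epsilon> \<longlongrightarrow> K) at_top \<and>
          ((\<lambda>s. \<Psi> \<epsilon> s * deriv psi s) has_integral (psi 0 ^ 2 / 2)) {..0}) \<and>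
       \<Psi> 0 = psi \<and>
       (\<forall>\<epsilon>\<in>{-\<epsilon>0<..<\<epsilon>0} - {0}. \<exists>t0.
          (\<lambda>t. \<Psi> \<epsilon> (t - t0) - exp (lambda1 p h \<epsilon> * t)) \<in> O[at_bot](\<lambda>t. exp (2 * lam * t)) \<and>
          (\<lambda>t. deriv (\<Psi> \<epsilon>) (t - t0) - lambda1 p h \<epsilon> * exp (lambda1 p h \<epsilon> * t))
             \<in> O[at_bot](\<lambda>t. exp (2 * lam * t)) \<and>
          (\<exists>z. \<forall>t\<le>z. deriv (\<Psi> \<epsilon>) t > 0))"
proof -
  obtain s1 D dd where s1: "s1 > 0" "s1 \<le> s0" and D: "D \<ge> 0" and dd0: "dd 1 0 1 = 0"
    and dd: "\<And>c th ka. near_base s1 c th ka \<Longrightarrow> \<bar>dd c th ka\<bar> \<le> 1 \<and> phase_integral c th ka (dd c th ka) = (psi 0)\<^sup>2 / 2"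
    and ddl: "\<And>c th ka c1 th1 ka1. near_base s1 c th ka \<Longrightarrow> near_base s1 c1 th1 ka1 \<Longrightarrow>
        \<bar>dd c th ka - dd c1 th1 ka1\<bar> \<le> D * (\<bar>c - c1\<bar> + \<bar>th - th1\<bar> + \<bar>ka - ka1\<bar>)"
    using phase by blast
  obtain s2 where s2: "s2 > 0" "s2 \<le> s0" and pos: "\<And>c th ka t. near_base s2 c th ka \<Longrightarrow> Y c th ka t > 0"
    using positive by blast
  obtain e1 E where e1: "e1 > 0" and E: "E \<ge> 0"
    and par: "\<And>\<epsilon>. \<bar>\<epsilon>\<bar> < e1 \<Longrightarrow> admissible (pc \<epsilon>) (pth \<epsilon>) (pka \<epsilon>) \<and> pc \<epsilon> \<ge> 1"
    and parl: "\<And>\<epsilon> \<epsilon>1. \<bar>\<epsilon>\<bar> < e1 \<Longrightarrow> \<bar>\<epsilon>1\<bar> < e1 \<Longrightarrow>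
      \<bar>pc \<epsilon> - pc \<epsilon>1\<bar> + \<bar>pth \<epsilon> - pth \<epsilon>1\<bar> + \<bar>pka \<epsilon> - pka \<epsilon>1\<bar> \<le> E * \<bar>\<epsilon>\<^sup>2 - \<epsilon>1\<^sup>2\<bar>"
    using parameters by blast
  define sm where "sm = min s1 s2"
  have sm: "sm > 0" "sm \<le> s1" "sm \<le> s2" using s1 s2 by (auto simp: sm_def)
  \<comment> \<open>The parameters are within E \<epsilon>^2 of the base, and \<epsilon>^2 \<le>
    |\<epsilon>| as |\<epsilon>| < 1, so the last bound puts them within \<open>sm\<close>.\<close>
  define \<epsilon>0 where "\<epsilon>0 = Min {e1, 1, sm / (E + 1)}"
  have \<epsilon>0: "\<epsilon>0 > 0" using e1 sm E by (auto simp: \<epsilon>0_def)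
  have nb: "near_base sm (pc \<epsilon>) (pth \<epsilon>) (pka \<epsilon>)" and le1: "\<bar>\<epsilon>\<bar> < e1" and le2: "\<bar>\<epsilon>\<bar> < 1" if "\<epsilon> \<in> {-\<epsilon>0<..<\<epsilon>0}" for \<epsilon>
  proof -
    have a: "\<bar>\<epsilon>\<bar> < e1" "\<bar>\<epsilon>\<bar> < 1" "\<bar>\<epsilon>\<bar> < sm / (E + 1)" using that by (auto simp: \<epsilon>0_def abs_less_iff)
    show "\<bar>\<epsilon>\<bar> < e1" "\<bar>\<epsilon>\<bar> < 1" by fact+
    have "\<epsilon>\<^sup>2 = \<bar>\<epsilon>\<bar> * \<bar>\<epsilon>\<bar>" by (simp add: power2_eq_square)
    also have "\<dots> \<le> \<bar>\<epsilon>\<bar> * 1" using a by (intro mult_left_mono) auto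
    finally have "\<epsilon>\<^sup>2 \<le> sm / (E + 1)" using a by simp
    then have "E * \<epsilon>\<^sup>2 \<le> (E + 1) * (sm / (E + 1))" using E by (intro mult_mono) auto
    also have "\<dots> = sm" using E by simp
    finally have "E * \<bar>\<epsilon>\<^sup>2 - 0\<^sup>2\<bar> \<le> sm" by simp
    then show "near_base sm (pc \<epsilon>) (pth \<epsilon>) (pka \<epsilon>)"
      using par[OF a(1)] parl[OF a(1), of 0] e1 unfolding near_base_def parameters_base by simp
  qed
  have nb_mono: "near_base r' c th ka" if "near_base r c th ka" "r \<le> r'" for r r' c th ka
    using that by (auto simp: near_base_def)
  note nb0 = nb_mono[OF nb order_trans[OF sm(2) s1(2)]] and nb1 = nb_mono[OF nb sm(2)] and nb2 = nb_mono[OF nb sm(3)]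
  define ph where "ph \<epsilon> = dd (pc \<epsilon>) (pth \<epsilon>) (pka \<epsilon>)" for \<epsilon>
  define \<Psi> where "\<Psi> \<epsilon> = (\<lambda>t. Y (pc \<epsilon>) (pth \<epsilon>) (pka \<epsilon>) (pc \<epsilon> * t + ph \<epsilon>))" for \<epsilon>
  have d1: "\<bar>ph \<epsilon>\<bar> \<le> 1" if "\<epsilon> \<in> {-\<epsilon>0<..<\<epsilon>0}" for \<epsilon> using dd[OF nb1[OF that]] by (simp add: ph_def)
  have pcl: "pc \<epsilon> * lam = lambda1 p h \<epsilon>" for \<epsilon> using lam by (simp add: pc_def)
  have dpsi: "deriv psi s = psi' s" for s by (rule DERIV_imp_deriv[OF psi_deriv])
  show ?thesis
  proof (rule exI[of _ \<epsilon>0], rule conjI[OF \<epsilon>0], rule exI[of _ \<Psi>], intro conjI ballI allI impI)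
    fix \<epsilon> assume \<epsilon>: "\<epsilon> \<in> {-\<epsilon>0<..<\<epsilon>0}"
    show "\<Psi> \<epsilon> \<in> Cmu (lam - \<delta>)" unfolding \<Psi>_def using \<delta> by (intro Z_Cmu nb0[OF \<epsilon>] d1[OF \<epsilon>]) simp
    have \<Psi>_pos: "\<Psi> \<epsilon> t > 0" for t unfolding \<Psi>_def by (rule pos[OF nb2[OF \<epsilon>]])
    then show "\<Psi> \<epsilon> t > 0" for t .
    show "\<exists>x1 x2. \<forall>t. (\<Psi> \<epsilon> has_real_derivative x1 t) (at t) \<and> (x1 has_real_derivative x2 t) (at t) \<and>
        \<epsilon>^2 * x2 t - x1 t - \<Psi> \<epsilon> t + g (\<Psi> \<epsilon> (t - h)) = 0"
      unfolding g[OF \<Psi>_pos] unfolding \<Psi>_def by (rule Z_second_order[OF nb0[OF \<epsilon>] pt_nonneg pth_def pka_def pt_root[symmetric]])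
    show "(\<Psi> \<epsilon> \<longlongrightarrow> 0) at_bot" "(\<Psi> \<epsilon> \<longlongrightarrow> K) at_top" unfolding \<Psi>_def by (rule Z_limits[OF nb0[OF \<epsilon>]])+
    have "(\<lambda>s. \<Psi> \<epsilon> s * psi' s) integrable_on {..0}"
      unfolding \<Psi>_def by (rule product_integrable[OF Yc_cont[OF nb0[OF \<epsilon>]] Y_C[OF nb0[OF \<epsilon>]]])
    moreover have "integral {..0} (\<lambda>s. \<Psi> \<epsilon> s * psi' s) = psi 0 ^ 2 / 2"
      using dd[OF nb1[OF \<epsilon>]] by (simp add: phase_integral_def \<Psi>_def ph_def)
    ultimately show "((\<lambda>s. \<Psi> \<epsilon> s * deriv psi s) has_integral (psi 0 ^ 2 / 2)) {..0}"
      unfolding dpsi by (metis integrable_integral)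
  next
    fix \<epsilon>1 e :: real assume \<epsilon>1: "\<epsilon>1 \<in> {-\<epsilon>0<..<\<epsilon>0}" and e: "e > 0"
    have "lam - \<delta> < lam" using \<delta> by simp
    from Z_norm_continuous[OF nb0[OF \<epsilon>1] d1[OF \<epsilon>1] this e] obtain \<eta> where \<eta>: "\<eta> > 0"
      and n: "\<And>c th ka d. near_base s0 c th ka \<Longrightarrow> \<bar>d\<bar> \<le> 1 \<Longrightarrow>
        \<bar>c - pc \<epsilon>1\<bar> + \<bar>th - pth \<epsilon>1\<bar> + \<bar>ka - pka \<epsilon>1\<bar> < \<eta> \<Longrightarrow> \<bar>d - ph \<epsilon>1\<bar> < \<eta> \<Longrightarrow>
        norm_mu (lam - \<delta>) (\<lambda>s. Y c th ka (c * s + d) - Y (pc \<epsilon>1) (pth \<epsilon>1) (pka \<epsilon>1) (pc \<epsilon>1 * s + ph \<epsilon>1)) < e"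
      by blast
    \<comment> \<open>The factor E + 1 passes from \<epsilon>^2 to the parameters, with the 2 coming
      from |\<epsilon> + \<epsilon>1| \<le> 2, and D + 1 passes from the parameters to the phase
      shift.\<close>
    define r where "r = \<eta> / (2 * (E + 1) * (D + 1))"
    have r: "r > 0" using \<eta> E D by (simp add: r_def)
    show "\<exists>d>0. \<forall>\<epsilon>\<in>{-\<epsilon>0<..<\<epsilon>0}. \<bar>\<epsilon> - \<epsilon>1\<bar> < d \<longrightarrow> norm_mu (lam - \<delta>) (\<lambda>s. \<Psi> \<epsilon> s - \<Psi> \<epsilon>1 s) < e"
    proof (intro exI[of _ r] conjI r ballI impI)
      fix \<epsilon> assume \<epsilon>: "\<epsilon> \<in> {-\<epsilon>0<..<\<epsilon>0}" and near: "\<bar>\<epsilon> - \<epsilon>1\<bar> < r"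
      let ?q = "\<bar>pc \<epsilon> - pc \<epsilon>1\<bar> + \<bar>pth \<epsilon> - pth \<epsilon>1\<bar> + \<bar>pka \<epsilon> - pka \<epsilon>1\<bar>"
      have "\<bar>\<epsilon>\<^sup>2 - \<epsilon>1\<^sup>2\<bar> = \<bar>\<epsilon> - \<epsilon>1\<bar> * \<bar>\<epsilon> + \<epsilon>1\<bar>" by (simp add: abs_mult[symmetric] power2_eq_square algebra_simps)
      also have "\<dots> \<le> r * 2" using near le2[OF \<epsilon>] le2[OF \<epsilon>1] by (intro mult_mono) auto
      finally have "E * \<bar>\<epsilon>\<^sup>2 - \<epsilon>1\<^sup>2\<bar> \<le> E * (r * 2)" using E by (rule mult_left_mono)
      then have q1: "?q \<le> E * (r * 2)" using parl[OF le1[OF \<epsilon>] le1[OF \<epsilon>1]] by linarith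
      have "E * (r * 2) < (E + 1) * (r * 2)" using r by simp
      also have "(E + 1) * (r * 2) = \<eta> / (D + 1)"
      proof -
        have "k * (\<eta> / (2 * k * m) * 2) = \<eta> / m" if "k > 0" for k m :: real using that by simp
        from this[of "E + 1" "D + 1"] show ?thesis using E unfolding r_def by simp
      qed
      finally have q2: "?q < \<eta> / (D + 1)" using q1 by linarith
      have "\<eta> / (D + 1) \<le> \<eta>" using \<eta> D by (simp add: divide_le_eq mult_le_cancel_left1)
      then have q3: "?q < \<eta>" using q2 by linarith
      have "\<bar>ph \<epsilon> - ph \<epsilon>1\<bar> \<le> D * ?q" unfolding ph_def by (rule ddl[OF nb1[OF \<epsilon>] nb1[OF \<epsilon>1]])
      also have "\<dots> \<le> D * (\<eta> / (D + 1))" using q2 D by (intro mult_left_mono) auto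
      also have "\<dots> < \<eta>" using \<eta> D by (simp add: field_simps)
      finally have "\<bar>ph \<epsilon> - ph \<epsilon>1\<bar> < \<eta>" .
      from n[OF nb0[OF \<epsilon>] d1[OF \<epsilon>] q3 this] show "norm_mu (lam - \<delta>) (\<lambda>s. \<Psi> \<epsilon> s - \<Psi> \<epsilon>1 s) < e" by (simp add: \<Psi>_def)
    qed
  next
    show "\<Psi> 0 = psi" by (simp add: \<Psi>_def ph_def parameters_base Y_base dd0)
  next
    fix \<epsilon> assume "\<epsilon> \<in> {-\<epsilon>0<..<\<epsilon>0} - {0}"
    then have \<epsilon>: "\<epsilon> \<in> {-\<epsilon>0<..<\<epsilon>0}" by simp
    show "\<exists>t0. (\<lambda>t. \<Psi> \<epsilon> (t - t0) - exp (lambda1 p h \<epsilon> * t)) \<in> O[at_bot](\<lambda>t. exp (2 * lam * t)) \<and>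
          (\<lambda>t. deriv (\<Psi> \<epsilon>) (t - t0) - lambda1 p h \<epsilon> * exp (lambda1 p h \<epsilon> * t)) \<in> O[at_bot](\<lambda>t. exp (2 * lam * t)) \<and>
          (\<exists>z. \<forall>t\<le>z. deriv (\<Psi> \<epsilon>) t > 0)"
      using Z_asymptotics[OF nb0[OF \<epsilon>], of "ph \<epsilon>"] unfolding pcl \<Psi>_def .
  qed
qed

end

section \<open>Reduction of the hypotheses on g to the abstract setting\<close>

theorem theorem14:
  fixes g g' :: "real \<Rightarrow> real" and h K lam :: real and \<psi> :: "real \<Rightarrow> real"
  assumes H: "hypH g g' h K"
    and GA: "globally_attracting g h K"
    and psi_nonneg: "\<forall>t. \<psi> t \<ge> 0"
    and psi_sol: "\<forall>t. (\<psi> has_real_derivative (- \<psi> t + g (\<psi> (t - h)))) (at t)"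
    and psi_lim0: "(\<psi> \<longlongrightarrow> 0) at_bot"
    and psi_limK: "(\<psi> \<longlongrightarrow> K) at_top"
    and lam_pos: "lam > 0"
    and lam_root: "lam = -1 + g' 0 * exp (- lam * h)"
  shows "\<forall>\<delta>. 0 < \<delta> \<and> \<delta> < lam \<longrightarrow>
    (\<exists>\<epsilon>0 > 0. \<exists>\<Psi> :: real \<Rightarrow> real \<Rightarrow> real.
       (\<forall>\<epsilon>\<in>{-\<epsilon>0<..<\<epsilon>0}. \<Psi> \<epsilon> \<in> Cmu (lam - \<delta>)) \<and>
       (\<forall>\<epsilon>1\<in>{-\<epsilon>0<..<\<epsilon>0}. \<forall>e>0. \<exists>d>0. \<forall>\<epsilon>\<in>{-\<epsilon>0<..<\<epsilon>0}.
          \<bar>\<epsilon> - \<epsilon>1\<bar> < d \<longrightarrow> norm_mu (lam - \<delta>) (\<lambda>s. \<Psi> \<epsilon> s - \<Psi> \<epsilon>1 s) < e) \<and>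
       (\<forall>\<epsilon>\<in>{-\<epsilon>0<..<\<epsilon>0}.
          (\<forall>t. \<Psi> \<epsilon> t > 0) \<and>
          (\<exists>x1 x2. \<forall>t. (\<Psi> \<epsilon> has_real_derivative x1 t) (at t) \<and>
                        (x1 has_real_derivative x2 t) (at t) \<and>
                        \<epsilon>^2 * x2 t - x1 t - \<Psi> \<epsilon> t + g (\<Psi> \<epsilon> (t - h)) = 0) \<and>
          (\<Psi> \<epsilon> \<longlongrightarrow> 0) at_bot \<and> (\<Psi> \<epsilon> \<longlongrightarrow> K) at_top \<and>
          ((\<lambda>s. \<Psi> \<epsilon> s * deriv \<psi> s) has_integral (\<psi> 0 ^ 2 / 2)) {..0}) \<and>
       \<Psi> 0 = \<psi> \<and>
       (\<forall>\<epsilon>\<in>{-\<epsilon>0<..<\<epsilon>0} - {0}. \<exists>t0.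
          (\<lambda>t. \<Psi> \<epsilon> (t - t0) - exp (lambda1 (g' 0) h \<epsilon> * t)) \<in> O[at_bot](\<lambda>t. exp (2 * lam * t)) \<and>
          (\<lambda>t. deriv (\<Psi> \<epsilon>) (t - t0) - lambda1 (g' 0) h \<epsilon> * exp (lambda1 (g' 0) h \<epsilon> * t))
             \<in> O[at_bot](\<lambda>t. exp (2 * lam * t)) \<and>
          (\<exists>z. \<forall>t\<le>z. deriv (\<Psi> \<epsilon>) t > 0)))"
proof -
  from H have h: "h > 0" and K: "K > 0" and roots: "{x. x \<ge> 0 \<and> g x = x} = {0, K}"
    and stab: "exp_stable g h K" and C1: "C1_nonneg g g'" and C2: "C2_near g' 0" and p: "g' 0 > 1"
    by (auto simp: hypH_def)
  \<comment> \<open>The linear extension has slope g'(0), so \<open>G\<close> is C^1 on the whole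
    line and the linear estimate for \<open>G'\<close> near 0 is trivial on the negative
    side.\<close>
  define G where "G x = (if x \<ge> 0 then g x else g' 0 * x)" for x
  define G' where "G' x = g' (max x 0)" for x
  have g0: "g 0 = 0" and gK: "g K = K" using roots by auto
  have gd: "(g has_real_derivative g' x) (at x within {0..})" if "x \<ge> 0" for x using C1 that by (auto simp: C1_nonneg_def)
  have dG: "(G has_real_derivative G' x) (at x)" for x
  proof (cases x "0::real" rule: linorder_cases)
    case less
    have "((\<lambda>x. g' 0 * x) has_real_derivative g' 0) (at x)" by (auto intro!: derivative_eq_intros)
    then have "(G has_real_derivative g' 0) (at x)"
      by (rule has_field_derivative_transform_within_open[where S = "{..<0}"]) (use less in \<open>auto simp: G_def\<close>)
    then show ?thesis using less by (simp add: G'_def)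
  next
    case greater
    have "at x within {0..} = at x" by (rule at_within_interior) (use greater in auto)
    then have "(g has_real_derivative g' x) (at x)" using gd[of x] greater by simp
    then have "(G has_real_derivative g' x) (at x)"
      by (rule has_field_derivative_transform_within_open[where S = "{0<..}"]) (use greater in \<open>auto simp: G_def\<close>)
    then show ?thesis using greater by (simp add: G'_def)
  next
    case equal
    have "(G has_real_derivative g' 0) (at 0 within {0..})"
      by (rule has_field_derivative_transform_within[OF gd[of 0] zero_less_one]) (auto simp: G_def)
    moreover have "(G has_real_derivative g' 0) (at 0 within {..0})"
    proof (rule has_field_derivative_transform_within[OF _ zero_less_one])
      show "((\<lambda>x. g' 0 * x) has_real_derivative g' 0) (at 0 within {..0})" by (auto intro!: derivative_eq_intros)
    qed (auto simp: G_def g0)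
    ultimately have "(G has_real_derivative g' 0) (at 0 within {0..} \<union> {..0})"
      unfolding has_field_derivative_iff by (auto simp: Lim_within_Un)
    moreover have "{0..} \<union> {..0::real} = UNIV" by auto
    ultimately show ?thesis using equal by (simp add: G'_def)
  qed
  have G'c: "continuous_on UNIV G'" unfolding G'_def
    by (rule continuous_on_compose2[of "{0..}" g']) (use C1 in \<open>auto simp: C1_nonneg_def intro!: continuous_intros\<close>)
  \<comment> \<open>The C^2 assumption enters through the difference quotient of g' at 0, which is
    bounded by |g''(0)| + 1 near 0.\<close>
  have G'lin: "\<exists>C r. r > 0 \<and> (\<forall>x. \<bar>x\<bar> < r \<longrightarrow> \<bar>G' x - g' 0\<bar> \<le> C * \<bar>x\<bar>)"
  proof -
    from C2 obtain r g'' where "r > 0" "\<forall>x \<in> {0..<r} \<union> {0-r<..<0+r}. (g' has_real_derivative g'' x) (at x within {0..})"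
      unfolding C2_near_def by blast
    then have "(g' has_real_derivative g'' 0) (at 0 within {0..})" by auto
    then have "((\<lambda>x. (g' x - g' 0) / (x - 0)) \<longlongrightarrow> g'' 0) (at 0 within {0..})" by (simp add: has_field_derivative_iff)
    from tendstoD[OF this zero_less_one] obtain e where e: "e > 0"
      and q: "\<And>x. x > 0 \<Longrightarrow> x < e \<Longrightarrow> \<bar>(g' x - g' 0) / x - g'' 0\<bar> < 1"
      by (auto simp: eventually_at dist_real_def)
    have "\<bar>G' x - g' 0\<bar> \<le> (\<bar>g'' 0\<bar> + 1) * \<bar>x\<bar>" if "\<bar>x\<bar> < e" for x
    proof (cases "x > 0")
      case True
      have "\<bar>(g' x - g' 0) / x\<bar> \<le> \<bar>g'' 0\<bar> + 1" using q[of x] True that by linarith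
      then have "\<bar>(g' x - g' 0) / x\<bar> * \<bar>x\<bar> \<le> (\<bar>g'' 0\<bar> + 1) * \<bar>x\<bar>" by (intro mult_right_mono) auto
      then show ?thesis using True by (simp add: G'_def)
    next
      case False
      have "0 \<le> (\<bar>g'' 0\<bar> + 1) * \<bar>x\<bar>" by simp
      then show ?thesis using False by (simp only: G'_def max_absorb2 not_less diff_self abs_zero)
    qed
    with e show ?thesis by blast
  qed
  have Gg: "G x = g x" if "x \<ge> 0" for x using that by (simp add: G_def)
  have Gnn: "G x \<ge> 0" if "x \<ge> 0" for x using C1 that by (simp add: G_def C1_nonneg_def)
  have psiG: "(\<psi> has_real_derivative (- \<psi> t + G (\<psi> (t - h)))) (at t)" for t
    using psi_sol psi_nonneg by (simp add: Gg)
  \<comment> \<open>A zero at t forces the front to vanish to the left of t, since it is nonnegative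
    and becomes nondecreasing when multiplied by exp; the equation then propagates zero to the right
    one delay at a time, against the limit K > 0.\<close>
  have psi_pos: "\<psi> t > 0" for t
  proof (rule ccontr)
    assume "\<not> \<psi> t > 0"
    then have t: "\<psi> t = 0" using psi_nonneg by (meson antisym_conv2 not_less)
    have mono: "exp a * \<psi> a \<le> exp b * \<psi> b" if "a \<le> b" for a b
    proof (rule DERIV_nonneg_mono[where f = "\<lambda>x. exp x * \<psi> x" and f' = "\<lambda>x. exp x * G (\<psi> (x - h))", OF _ _ that])
      show "((\<lambda>x. exp x * \<psi> x) has_real_derivative exp x * G (\<psi> (x - h))) (at x)" for x
        by (auto intro!: derivative_eq_intros psiG simp: algebra_simps)
      show "0 \<le> exp x * G (\<psi> (x - h))" for x using Gnn psi_nonneg by simp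
    qed
    have z: "\<psi> s = 0" if "s \<le> t + real n * h" for s n
      using that
    proof (induction n arbitrary: s)
      case 0
      then have "exp s * \<psi> s \<le> 0" using mono[of s t] t by simp
      then show ?case using psi_nonneg[rule_format, of s] by (simp add: mult_le_0_iff)
    next
      case (Suc n)
      show ?case
      proof (cases "s \<le> t")
        case False
        have "\<bar>\<psi> s\<bar> \<le> 0 + 0"
        proof (rule bound_forward[where d = \<psi> and a = t and b = s and r = "\<lambda>x. G (\<psi> (x - h))"])
          show "(\<psi> has_real_derivative - \<psi> x + G (\<psi> (x - h))) (at x within {t..})" for x
            by (rule has_field_derivative_at_within[OF psiG])
          show "\<bar>G (\<psi> (x - h))\<bar> \<le> 0" if "x \<le> s" for x
          proof -
            have "\<psi> (x - h) = 0" using Suc.prems that by (intro Suc.IH) (simp add: algebra_simps)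
            then show ?thesis by (simp add: Gg g0)
          qed
        qed (use t False in auto)
        then show ?thesis by simp
      next
        case True
        have "t \<le> t + real n * h" using h by simp
        then show ?thesis using True by (intro Suc.IH) linarith
      qed
    qed
    have "\<psi> s = 0" for s
    proof -
      obtain n :: nat where "s - t < real n * h" using reals_Archimedean3[OF h] by blast
      then show ?thesis by (intro z[of s n]) simp
    qed
    then have "\<psi> = (\<lambda>_. 0)" by auto
    then have "((\<lambda>_::real. 0::real) \<longlongrightarrow> K) at_top" using psi_limK by simp
    then show False using K by (simp add: tendsto_const_iff)
  qed
  have Gc: "continuous_on UNIV G" using DERIV_isCont[OF dG] by (auto simp: continuous_on_eq_continuous_at)
  have window: "\<exists>\<eta>>0. \<exists>n\<ge>1. \<exists>C\<ge>0. delay_window h (G' K) \<eta> n C"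
    by (rule delay_window_from_exp_stable[OF stab h K _ Gnn Gc _ dG]) (use K gK in \<open>auto simp: Gg\<close>)
  interpret delay_front G G' h K lam "g' 0" \<psi>
  proof
    show "1 + lam = g' 0 * exp (- lam * h)" using lam_root by linarith
    show "G K = K" using K gK by (simp add: Gg)
    show "G 0 = 0" by (simp add: Gg g0)
  qed (use h K dG G'c Gnn p G'lin psiG psi_pos psi_lim0 psi_limK lam_pos window in auto)
  obtain s0 A C Y Y' where "s0 > 0" "A > 0" "C > 0" "is_family s0 A C Y Y'" using family_exists by blast
  then interpret front_family G G' h K lam "g' 0" \<psi> s0 A C Y Y' by unfold_locales
  show ?thesis
    by (intro allI impI singular_family) (auto simp: Gg)
qed

end
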